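(* Let $p$ be a prime number and $\Psi=\Psi_p$. (1) For any $n=1,2,\dots$, the map $\Psi$ has $p_n := p^n-p^{n-1}$ simple zeros of valuation $-n$ in $\mathbb{Q}_p$. More precisely, for any system of representatives $a_1,\dots,a_{p_n}\in\mathbb{Z}_p$ of $(\mathbb{Z}_p/p^n\mathbb{Z}_p)^\times$ and any $j=1,\dots,p_n$, the open disc $D(a_jp^{-n},p^-)$ contains a unique zero $z^{(n)}_j\in\mathbb{Q}_p$ of $\Psi$. Then $z^{(n)}_1,\dots,z^{(n)}_{p_n}$ are all the zeros of $\Psi$ of valuation $-n$. (2) For $n=1,2,\dots$ let $z^{(n)}_1,\dots,z^{(n)}_{p_n}$ be the zeros of $\Psi$ of valuation $-n$, and set $$\psi_n(x)=\prod_{j=1}^{p_n}\Big(1-\frac{x}{z^{(n)}_j}\Big)\in 1+p^nx\mathbb{Z}_p[x].$$ Then $$\Psi(x)=x\prod_{n=1}^\infty\psi_n(x)$$ is the canonical convergent infinite Schnirelmann product expression of $\Psi(x)$ in the ring $\mathbb{Q}_p\{x\}$. (3) The inverse function $\beta(T)$ of $\Psi(T)$ (i.e. the power series such that, in $T\mathbb{Z}[[T]]$, $\Psi(\beta(T))=T=\beta(\Psi(T))$) belongs to $T+T^2\mathbb{Z}[[T]]$. Its disc of convergence is exactly $v_p(T)>-1$.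
   Context: $\Psi_p(T) \in T + T^2\mathbb{Z}[[T]]$ is the unique power series of this form satisfying $\sum_{j=0}^\infty p^{-j}\Psi_p(p^jT)^{p^j} = T$; it is $p$-adically entire. $v_p$ is the valuation of $\mathbb{C}_p$ with $v_p(p)=1$ and $|x|=p^{-v_p(x)}$; $D(c,p^-)=\{x\in\mathbb{C}_p : |x-c|<p\}$. $\mathbb{Q}_p\{x\}$ is the ring of entire functions over $\mathbb{Q}_p$ (power series over $\mathbb{Q}_p$ converging on all of $\mathbb{C}_p$) with the Fréchet topology of uniform convergence on bounded discs $p^{-r}\mathbb{C}_p^\circ$, $r\in\mathbb{Z}$. The Schnirelmann product of an entire function is its convergent factorization into a monomial and polynomial factors with constant term $1$, each collecting all zeros (with multiplicity) of one given valuation. *)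

theory Defs
  imports
    "HOL-Analysis.Uniform_Limit"
    "HOL-Library.Extended_Real"
    "HOL-Computational_Algebra.Computational_Algebra"
begin

section \<open>The field of $p$-adic complex numbers\<close>

text \<open>
  The library constrains the constant \<open>norm\<close> to real normed vector spaces, so the
  absolute value has its own name; positive definiteness follows from \<open>dist_vabs\<close>.
\<close>

class complete_ultrametric_field = field_char_0 + complete_space +
  fixes vabs :: "'a \<Rightarrow> real"
  assumes dist_vabs: "dist x y = vabs (x - y)"
    and vabs_mult: "vabs (x * y) = vabs x * vabs y"
    and vabs_add_le_max: "vabs (x + y) \<le> max (vabs x) (vabs y)"

text \<open>
  Once the absolute value of \<open>p\<close> is \<open>1/p\<close>, its restriction to the rationals is the
  \<open>p\<close>-adic absolute value, so that in a complete field the closure of the rationals is their completion.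
\<close>

definition Qp :: "'c::complete_ultrametric_field set" where
  "Qp = closure \<rat>"

definition Zp :: "'c::complete_ultrametric_field set" where
  "Zp = {x \<in> Qp. vabs x \<le> 1}"

definition algebraic_over_Qp :: "'c::complete_ultrametric_field \<Rightarrow> bool" where
  "algebraic_over_Qp x \<longleftrightarrow> (\<exists>q. q \<noteq> 0 \<and> (\<forall>i. coeff q i \<in> Qp) \<and> poly q x = 0)"

text \<open>
  The type \<open>'c\<close> is a completion of an algebraic closure of the field of \<open>p\<close>-adic numbers,
  with the absolute value normalized to be \<open>1/p\<close> at \<open>p\<close>. This determines the
  valued field up to isometric isomorphism; the results are stated for an arbitrary such \<open>'c\<close>.
\<close>

definition is_Cp :: "nat \<Rightarrow> 'c::complete_ultrametric_field itself \<Rightarrow> bool" where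
  "is_Cp p (_ :: 'c itself) \<longleftrightarrow>
     vabs (of_nat p :: 'c) = 1 / real p \<and>
     (\<forall>q :: 'c poly. degree q > 0 \<and> (\<forall>i. algebraic_over_Qp (coeff q i)) \<longrightarrow>
        (\<exists>x. algebraic_over_Qp x \<and> poly q x = 0)) \<and>
     closure {x :: 'c. algebraic_over_Qp x} = UNIV"

definition vp :: "nat \<Rightarrow> 'c::complete_ultrametric_field \<Rightarrow> ereal" where
  "vp p x = (if x = 0 then \<infinity> else ereal (- log (real p) (vabs x)))"

section \<open>Representatives of the units modulo $p^n$\<close>

definition Zp_cong :: "nat \<Rightarrow> nat \<Rightarrow> 'c::complete_ultrametric_field \<Rightarrow> 'c \<Rightarrow> bool" where
  "Zp_cong p n x y \<longleftrightarrow> (\<exists>t\<in>Zp. x - y = of_nat p ^ n * t)"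

definition Zp_unit_mod :: "nat \<Rightarrow> nat \<Rightarrow> 'c::complete_ultrametric_field \<Rightarrow> bool" where
  "Zp_unit_mod p n x \<longleftrightarrow> x \<in> Zp \<and> (\<exists>y\<in>Zp. Zp_cong p n (x * y) 1)"

definition unit_representatives ::
  "nat \<Rightarrow> nat \<Rightarrow> nat set \<Rightarrow> (nat \<Rightarrow> 'c::complete_ultrametric_field) \<Rightarrow> bool" where
  "unit_representatives p n J a \<longleftrightarrow>
     (\<forall>j\<in>J. Zp_unit_mod p n (a j)) \<and>
     (\<forall>u. Zp_unit_mod p n u \<longrightarrow> (\<exists>!j. j \<in> J \<and> Zp_cong p n u (a j)))"

section \<open>Entire functions\<close>

text \<open>
  The library constant \<open>eval_fps\<close> is restricted to real normed algebras.
\<close>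

definition fps_value :: "'c::complete_ultrametric_field fps \<Rightarrow> 'c \<Rightarrow> 'c" where
  "fps_value f x = (\<Sum>n. fps_nth f n * x ^ n)"

definition fps_convergence_set :: "'c::complete_ultrametric_field fps \<Rightarrow> 'c set" where
  "fps_convergence_set f = {x. summable (\<lambda>n. fps_nth f n * x ^ n)}"

definition entire_Qp :: "'c::complete_ultrametric_field fps set" where
  "entire_Qp = {f. (\<forall>n. fps_nth f n \<in> Qp) \<and> fps_convergence_set f = UNIV}"

definition frechet_tendsto ::
  "nat \<Rightarrow> (nat \<Rightarrow> 'c::complete_ultrametric_field fps) \<Rightarrow> 'c fps \<Rightarrow> bool" where
  "frechet_tendsto p g f \<longleftrightarrow>
     (\<forall>N. g N \<in> entire_Qp) \<and> f \<in> entire_Qp \<and>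
     (\<forall>r::int. uniform_limit ((\<lambda>y. of_nat p powi (- r) * y) ` cball 0 1)
        (\<lambda>N. fps_value (g N)) (fps_value f) sequentially)"

definition vanishing_order ::
  "'c::complete_ultrametric_field fps \<Rightarrow> 'c \<Rightarrow> nat \<Rightarrow> bool" where
  "vanishing_order f z m \<longleftrightarrow>
     (\<forall>k<m. fps_value ((fps_deriv ^^ k) f) z = 0) \<and> fps_value ((fps_deriv ^^ m) f) z \<noteq> 0"

abbreviation simple_zero :: "'c::complete_ultrametric_field fps \<Rightarrow> 'c \<Rightarrow> bool" where
  "simple_zero f z \<equiv> vanishing_order f z 1"

definition zeros_of_valuation ::
  "nat \<Rightarrow> 'c::complete_ultrametric_field fps \<Rightarrow> ereal \<Rightarrow> 'c set" where
  "zeros_of_valuation p f v = {z. fps_value f z = 0 \<and> vp p z = v}"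

text \<open>
  The factors are \<open>\<phi> 1, \<phi> 2, \<dots>\<close> (the value \<open>\<phi> 0\<close> is irrelevant), ordered by
  decreasing valuation of their zeros. The case of only finitely many factors is not covered.
\<close>

definition infinite_schnirelmann_product ::
  "nat \<Rightarrow> 'c::complete_ultrametric_field fps \<Rightarrow> 'c poly \<Rightarrow> (nat \<Rightarrow> 'c poly) \<Rightarrow> bool" where
  "infinite_schnirelmann_product p f m \<phi> \<longleftrightarrow>
     (\<exists>c k. c \<noteq> 0 \<and> m = monom c k) \<and>
     fps_of_poly m \<in> entire_Qp \<and>
     (\<forall>n\<ge>1. fps_of_poly (\<phi> n) \<in> entire_Qp \<and> coeff (\<phi> n) 0 = 1 \<and> degree (\<phi> n) > 0) \<and>
     (\<exists>v :: nat \<Rightarrow> ereal.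
        (\<forall>n\<ge>1. v (Suc n) < v n) \<and>
        (\<forall>n\<ge>1. \<forall>z. poly (\<phi> n) z = 0 \<longrightarrow> vp p z = v n) \<and>
        (\<forall>n\<ge>1. \<forall>z. vp p z = v n \<longrightarrow> vanishing_order f z (order z (\<phi> n))) \<and>
        (\<forall>z. z \<noteq> 0 \<and> fps_value f z = 0 \<longrightarrow> (\<exists>n\<ge>1. vp p z = v n))) \<and>
     frechet_tendsto p (\<lambda>N. fps_of_poly (m * (\<Prod>n=1..N. \<phi> n))) f"

section \<open>The power series $\Psi_p$\<close>

definition fps_of_int_coeffs :: "int fps \<Rightarrow> 'a::ring_1 fps" where
  "fps_of_int_coeffs f = Abs_fps (\<lambda>n. of_int (fps_nth f n))"

text \<open>The sum is a formal one, i.e. it is taken in the \<open>T\<close>-adic topology on formal power series.\<close>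

definition is_Psi :: "nat \<Rightarrow> int fps \<Rightarrow> bool" where
  "is_Psi p f \<longleftrightarrow>
     fps_nth f 0 = 0 \<and> fps_nth f 1 = 1 \<and>
     (\<lambda>j. fps_const (1 / of_nat p ^ j) *
        (fps_of_int_coeffs f oo (fps_const (of_nat p ^ j) * fps_X)) ^ (p ^ j))
     sums (fps_X :: rat fps)"

lemma fps_nth_fps_of_int_coeffs [simp]: "fps_nth (fps_of_int_coeffs f) n = of_int (fps_nth f n)"
  by (simp add: fps_of_int_coeffs_def)

lemma fps_of_int_coeffs_power:
  "fps_of_int_coeffs f ^ m = (fps_of_int_coeffs (f ^ m) :: 'a::comm_ring_1 fps)"
proof (induction m)
  case 0
  show ?case by (simp add: fps_eq_iff)
next
  case (Suc m)
  then show ?case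
    by (simp add: fps_eq_iff fps_mult_nth)
qed

lemma fps_power_nth_cong:
  fixes f g :: "int fps"
  assumes "f $ 0 = 0" "g $ 0 = 0" and eq: "\<And>k. k < n \<Longrightarrow> f $ k = g $ k" and "m \<ge> 2"
  shows "(f ^ m) $ n = (g ^ m) $ n"
proof -
  have below: "(f ^ l) $ k = (g ^ l) $ k" if "k < n" for k l
    using that
  proof (induction l arbitrary: k)
    case (Suc l)
    then show ?case by (simp add: fps_mult_nth eq)
  qed simp
  obtain l where l: "m = Suc l" "l \<ge> 1" using \<open>m \<ge> 2\<close> by (cases m) auto
  have z: "(f ^ l) $ 0 = 0" "(g ^ l) $ 0 = 0" using assms l by (auto simp: fps_nth_power_0)
  have "f $ i * (f ^ l) $ (n - i) = g $ i * (g ^ l) $ (n - i)" if "i \<le> n" for i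
    using that below[of "n - i" l] eq[of i] z assms(1,2)
    by (cases "i = 0"; cases "i = n") (auto simp: fps_power_zeroth zero_power)
  then show ?thesis unfolding l power_Suc fps_mult_nth by (intro sum.cong) auto
qed

lemma is_Psi_iff:
  assumes p: "p \<ge> 2"
  shows "is_Psi p f \<longleftrightarrow>
    f $ 0 = 0 \<and> (\<forall>n\<ge>1. f $ n = (if n = 1 then 1 else 0)
      - (\<Sum>j=1..n. int p ^ (j * (n - 1)) * (f ^ (p ^ j)) $ n))"
proof (cases "f $ 0 = 0")
  case f0: True
  define t :: "nat \<Rightarrow> rat fps" where "t = (\<lambda>j. fps_const (1 / of_nat p ^ j) *
        (fps_of_int_coeffs f oo (fps_const (of_nat p ^ j) * fps_X)) ^ (p ^ j))"
  define c where "c = (\<lambda>n j. int p ^ (j * (n - 1)) * (f ^ (p ^ j)) $ n)"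
  have big: "j < p ^ j" for j using p by (meson less_exp power_mono order.strict_trans2 zero_le)
  have c0: "c n j = 0" if "n = 0 \<or> j > n" for n j
  proof -
    have "n < p ^ j" using that big[of j] p by auto
    then show ?thesis using f0 by (simp add: c_def startsby_zero_power_prefix)
  qed
  have t: "t j $ n = of_int (c n j)" for n j
  proof -
    have "(fps_of_int_coeffs f oo (fps_const (of_nat p ^ j) * fps_X)) ^ (p ^ j)
        = (fps_of_int_coeffs (f ^ (p ^ j)) oo (fps_const (of_nat p ^ j) * fps_X) :: rat fps)"
      by (simp add: fps_compose_power fps_of_int_coeffs_power)
    then have "t j $ n = 1 / of_nat p ^ j * ((of_nat p ^ j) ^ n * of_int ((f ^ (p ^ j)) $ n))"
      by (simp add: t_def fps_compose_linear fps_of_int_coeffs_def)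
    also have "\<dots> = of_int (c n j)"
    proof (cases n)
      case 0
      with f0 p show ?thesis by (simp add: c_def fps_nth_power_0 zero_power)
    next
      case (Suc k)
      with p show ?thesis by (simp add: c_def power_mult power_add)
    qed
    finally show ?thesis .
  qed
  have part: "(\<Sum>j<N. t j) $ n = of_int (\<Sum>j\<le>n. c n j)" if "N > n" for N n
  proof -
    have "(\<Sum>j<N. t j) $ n = of_int (\<Sum>j<N. c n j)" by (simp add: fps_sum_nth t)
    also have "(\<Sum>j<N. c n j) = (\<Sum>j\<le>n. c n j)"
      using that c0 by (intro sum.mono_neutral_right) auto
    finally show ?thesis .
  qed
  have "t sums fps_X \<longleftrightarrow> (\<forall>n. (\<Sum>j\<le>n. c n j) = (if n = 1 then 1 else 0))"
    (is "?L \<longleftrightarrow> ?R")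
  proof
    assume ?L
    show ?R
    proof
      fix n
      have "\<forall>\<^sub>F N in sequentially. (\<Sum>j<N. t j) $ n = fps_X $ n"
        using \<open>?L\<close> by (simp add: sums_def tendsto_fps_iff)
      moreover have "\<forall>\<^sub>F N in sequentially. N > n" by (rule eventually_gt_at_top)
      ultimately have "\<forall>\<^sub>F N in sequentially. of_int (\<Sum>j\<le>n. c n j) = (fps_X $ n :: rat)"
        by eventually_elim (simp only: part)
      then have "of_int (\<Sum>j\<le>n. c n j) = (fps_X $ n :: rat)" by simp
      also have "\<dots> = of_int (if n = 1 then 1 else 0)" by simp
      finally show "(\<Sum>j\<le>n. c n j) = (if n = 1 then 1 else 0)" by (simp only: of_int_eq_iff)
    qed
  next
    assume R: ?R
    show ?L unfolding sums_def
    proof (rule tendsto_fpsI)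
      fix n
      show "\<forall>\<^sub>F N in sequentially. (\<Sum>j<N. t j) $ n = fps_X $ n"
        using eventually_gt_at_top[of n] by eventually_elim (simp only: part R, simp)
    qed
  qed
  also have "\<dots> \<longleftrightarrow> (\<forall>n\<ge>1. (\<Sum>j\<le>n. c n j) = (if n = 1 then 1 else 0))"
  proof -
    have "(\<Sum>j\<le>n. c n j) = (if n = 1 then 1 else 0)" if "\<not> n \<ge> 1" for n
      using that c0 by simp
    then show ?thesis by blast
  qed
  also have "\<dots> \<longleftrightarrow> (\<forall>n\<ge>1. f $ n = (if n = 1 then 1 else 0) - (\<Sum>j=1..n. c n j))"
  proof -
    have "(\<Sum>j\<le>n. c n j) = f $ n + (\<Sum>j=1..n. c n j)" for n
    proof -
      have "{..n} = insert 0 {1..n}" by auto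
      then show ?thesis by (simp add: c_def)
    qed
    then show ?thesis by (simp only: eq_diff_eq)
  qed
  finally have *: "t sums fps_X \<longleftrightarrow>
    (\<forall>n\<ge>1. f $ n = (if n = 1 then 1 else 0) - (\<Sum>j=1..n. c n j))" .
  have "f $ 1 = 1" if "\<forall>n\<ge>1. f $ n = (if n = 1 then 1 else 0) - (\<Sum>j=1..n. c n j)"
  proof -
    have "c 1 1 = 0" using p f0 by (simp add: c_def startsby_zero_power_prefix)
    with that[rule_format, of 1] show ?thesis by simp
  qed
  moreover have "is_Psi p f \<longleftrightarrow> f $ 1 = 1 \<and> t sums fps_X"
    using f0 by (simp add: is_Psi_def t_def)
  ultimately show ?thesis using * f0 unfolding c_def by blast
qed (auto simp: is_Psi_def)

lemma is_Psi_ex1: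
  assumes p: "p \<ge> 2"
  shows "\<exists>!f. is_Psi p f"
proof -
  define R :: "(nat \<Rightarrow> int) \<Rightarrow> nat \<Rightarrow> int" where
    "R = (\<lambda>a n. if n = 0 then 0 else (if n = 1 then 1 else 0)
       - (\<Sum>j=1..n. int p ^ (j * (n - 1)) * (Abs_fps (a(0 := 0)) ^ (p ^ j)) $ n))"
  have two: "p ^ j \<ge> 2" if "j \<ge> 1" for j
    using p that self_le_power[of p j] by linarith
  have R_cong: "R a n = R b n" if "\<And>k. k < n \<Longrightarrow> a k = b k" for a b n
    unfolding R_def using that two
    by (auto intro!: sum.cong arg_cong2[of _ _ _ _ "(*)"] fps_power_nth_cong)
  have adm: "adm_wf less_than R"
    by (auto simp: adm_wf_def intro: R_cong)
  define a where "a = wfrec less_than R"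
  have a: "a n = R a n" for n
    unfolding a_def by (subst wfrec_fixpoint[OF wf_less_than adm]) simp
  have iff: "is_Psi p f \<longleftrightarrow> (\<forall>n. f $ n = R (fps_nth f) n)" for f
  proof (cases "f $ 0 = 0")
    case True
    then have "Abs_fps ((fps_nth f)(0 := 0)) = f" by (auto simp: fps_eq_iff)
    with True show ?thesis unfolding is_Psi_iff[OF p] R_def
      by (auto simp: Suc_le_eq)
  next
    case False
    then show ?thesis by (auto simp: is_Psi_def R_def intro: exI[of _ 0])
  qed
  show ?thesis
  proof (rule ex1I)
    have *: "fps_nth (Abs_fps a) = a" by auto
    show "is_Psi p (Abs_fps a)" unfolding iff * using a by blast
  next
    fix f assume f: "is_Psi p f"
    have "f $ n = a n" for n
    proof (induction n rule: less_induct)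
      case (less n)
      have "f $ n = R (fps_nth f) n" using f iff by blast
      also have "\<dots> = R a n" by (rule R_cong) (rule less)
      also have "\<dots> = a n" by (rule a[symmetric])
      finally show ?case .
    qed
    then show "f = Abs_fps a" by (simp add: fps_eq_iff)
  qed
qed

definition Psi :: "nat \<Rightarrow> int fps" where
  "Psi p = (THE f. is_Psi p f)"

lemma is_Psi_Psi: "p \<ge> 2 \<Longrightarrow> is_Psi p (Psi p)"
  unfolding Psi_def by (rule theI', rule is_Psi_ex1)

definition is_compositional_inverse :: "int fps \<Rightarrow> int fps \<Rightarrow> bool" where
  "is_compositional_inverse f g \<longleftrightarrow> fps_nth g 0 = 0 \<and> f oo g = fps_X \<and> g oo f = fps_X"

end

theory Submission
  imports Defs "HOL-Number_Theory.Totient"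
begin

text \<open>
  Solving the functional equation for \<open>j = 0\<close> gives
  \<open>\<Psi>(T) = T - \<Psi>(p T)^p / p - \<Psi>(p^2 T)^(p^2) / p^2 - \<dots>\<close>, which expresses \<open>\<Psi>\<close> on the disc of radius \<open>p^n\<close>
  through its values on smaller discs. All properties follow by induction on \<open>n\<close>: the Gauss norm of
  radius \<open>p^n\<close> is last attained at the index \<open>p^n\<close>, so that \<open>\<Psi>\<close> has at most \<open>p^n\<close> zeros in that disc
  (Strassmann); \<open>\<Psi>\<close> maps the \<open>p\<close>-adic numbers to \<open>p\<close>-adic integers; and around every \<open>p\<close>-adic number \<open>c\<close>
  the map \<open>x - \<Psi>(x)\<close> is a contraction on every closed disc of radius less than \<open>p\<close>. The fixed points of
  these contractions give exactly one zero for each coset of the \<open>p\<close>-adic integers, and there are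
  \<open>p^n\<close> cosets of absolute value at most \<open>p^n\<close>; hence these are all zeros and they are simple.
  Dividing \<open>\<Psi>\<close> by the zeros of absolute value at most \<open>p^N\<close> leaves a factor whose constant term
  dominates on the disc of radius \<open>p^N\<close>, and this factor tends to 1 on every bounded disc.
\<close>

text \<open>The obstacle is the denominator p^j in the functional equation: the Gauss norm of \<Psi>
  on the disc of radius p^n is p^((p^n - 1)/(p - 1)), so bounds on coefficients alone cannot show
  |\<Psi>(x)| <= 1 for large p-adic x. The denominators are paid for by the exponents: for |a|, |b|
  <= 1 and P = p^j, the difference a^P - b^P is smaller than a - b by at least the factor max(|P|,
  |a - b|). Combined with the congruence of y^p and y modulo p, this gives integrality on the p-adic
  numbers; combined with the Lipschitz bound at p^j x, it gives the contraction near them. Radius p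
  is the limit, since the closed disc of radius p around 0 already contains p zeros. Neither
  argument sees points far from the p-adic numbers; zeros there are excluded only because the number
  of cosets equals the Weierstrass degree. For the inverse \<beta>, the decisive fact is that the
  Gauss norm of \<Psi> at radius p equals p: this bound reproduces itself in the recursion for the
  coefficients of \<beta>.\<close>

unbundle no vec_syntax

section \<open>Complete ultrametric fields\<close>

lemma tendsto_vabs_diff_iff:
  fixes f :: "'b \<Rightarrow> 'a::complete_ultrametric_field"
  shows "(f \<longlongrightarrow> l) F \<longleftrightarrow> ((\<lambda>x. vabs (f x - l)) \<longlongrightarrow> 0) F"
  by (subst tendsto_dist_iff) (simp add: dist_vabs)

lemma vabs_nonneg [simp]: "0 \<le> vabs (x::'a::complete_ultrametric_field)"
  using zero_le_dist[of x 0] by (simp add: dist_vabs)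

lemma vabs_eq_0_iff [simp]: "vabs (x::'a::complete_ultrametric_field) = 0 \<longleftrightarrow> x = 0"
  using dist_eq_0_iff[of x 0] by (simp add: dist_vabs)

lemma vabs_pos_iff [simp]: "0 < vabs (x::'a::complete_ultrametric_field) \<longleftrightarrow> x \<noteq> 0"
  using vabs_eq_0_iff[of x] vabs_nonneg[of x] by linarith

lemma vabs_0 [simp]: "vabs (0::'a::complete_ultrametric_field) = 0"
  by simp

lemma vabs_minus [simp]: "vabs (- x) = vabs (x::'a::complete_ultrametric_field)"
  using dist_commute[of x 0] by (simp add: dist_vabs)

lemma vabs_minus_commute: "vabs (x - y) = vabs (y - x :: 'a::complete_ultrametric_field)"
  using vabs_minus[of "x - y"] by simp

lemma vabs_1 [simp]: "vabs (1::'a::complete_ultrametric_field) = 1"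
proof -
  have "vabs (1::'a) * vabs (1::'a) = vabs (1::'a)" by (metis vabs_mult mult_1)
  then show ?thesis by simp
qed

lemma vabs_power: "vabs (x ^ n) = vabs (x::'a::complete_ultrametric_field) ^ n"
  by (induction n) (auto simp: vabs_mult)

lemma vabs_inverse: "vabs (inverse x) = inverse (vabs (x::'a::complete_ultrametric_field))"
proof (cases "x = 0")
  case False
  then have "vabs (inverse x) * vabs x = 1" by (simp flip: vabs_mult)
  with False show ?thesis by (simp add: field_simps)
qed simp

lemma vabs_divide: "vabs (x / y) = vabs x / vabs (y::'a::complete_ultrametric_field)"
  by (simp add: divide_inverse vabs_mult vabs_inverse)

lemma vabs_add_le:
  "vabs x \<le> C \<Longrightarrow> vabs y \<le> C \<Longrightarrow> vabs (x + y :: 'a::complete_ultrametric_field) \<le> C"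
  using vabs_add_le_max[of x y] by linarith

lemma vabs_diff_le:
  "vabs x \<le> C \<Longrightarrow> vabs y \<le> C \<Longrightarrow> vabs (x - y :: 'a::complete_ultrametric_field) \<le> C"
  using vabs_add_le[of x C "- y"] by simp

lemma vabs_add_less:
  "vabs x < C \<Longrightarrow> vabs y < C \<Longrightarrow> vabs (x + y :: 'a::complete_ultrametric_field) < C"
  using vabs_add_le_max[of x y] by linarith

lemma vabs_diff_less:
  "vabs x < C \<Longrightarrow> vabs y < C \<Longrightarrow> vabs (x - y :: 'a::complete_ultrametric_field) < C"
  using vabs_add_less[of x C "- y"] by simp

lemma vabs_add_eq_left:
  assumes "vabs y < vabs (x::'a::complete_ultrametric_field)"
  shows "vabs (x + y) = vabs x"
proof (rule antisym)
  show "vabs (x + y) \<le> vabs x" using assms by (intro vabs_add_le) auto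
  have "vabs x \<le> max (vabs (x + y)) (vabs y)" using vabs_diff_le[of "x + y" _ y] by simp
  with assms show "vabs x \<le> vabs (x + y)" by simp
qed

lemma vabs_eq_of_diff_less:
  assumes "vabs (x - y) < vabs (y::'a::complete_ultrametric_field)"
  shows "vabs x = vabs y"
  using vabs_add_eq_left[OF assms] by simp

lemma vabs_sum_le:
  fixes f :: "'b \<Rightarrow> 'a::complete_ultrametric_field"
  assumes "\<And>i. i \<in> A \<Longrightarrow> vabs (f i) \<le> C" and "0 \<le> C"
  shows "vabs (sum f A) \<le> C"
  using assms by (induction A rule: infinite_finite_induct) (auto intro: vabs_add_le)

lemma vabs_sum_less:
  fixes f :: "'b \<Rightarrow> 'a::complete_ultrametric_field"
  assumes "\<And>i. i \<in> A \<Longrightarrow> vabs (f i) < C" and "0 < C"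
  shows "vabs (sum f A) < C"
  using assms by (induction A rule: infinite_finite_induct) (auto intro: vabs_add_less)

lemma vabs_of_nat_le_1: "vabs (of_nat n :: 'a::complete_ultrametric_field) \<le> 1"
  by (induction n) (auto intro: vabs_add_le)

lemma vabs_of_int_le_1: "vabs (of_int n :: 'a::complete_ultrametric_field) \<le> 1"
  by (cases n rule: int_cases2) (auto simp: vabs_of_nat_le_1)

section \<open>Continuity of addition and multiplication\<close>

instance complete_ultrametric_field \<subseteq> topological_ab_group_add
proof
  fix a b :: 'a
  have 1: "((\<lambda>z. vabs (fst z - a)) \<longlongrightarrow> 0) (nhds a \<times>\<^sub>F nhds b)"
    using filterlim_fst[of "nhds a" "nhds b"] by (simp add: tendsto_vabs_diff_iff)
  have 2: "((\<lambda>z. vabs (snd z - b)) \<longlongrightarrow> 0) (nhds a \<times>\<^sub>F nhds b)"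
    using filterlim_snd[of "nhds b" "nhds a"] by (simp add: tendsto_vabs_diff_iff)
  show "((\<lambda>z. fst z + snd z) \<longlongrightarrow> a + b) (nhds a \<times>\<^sub>F nhds b)"
    unfolding tendsto_vabs_diff_iff[of _ "a + b"]
  proof (rule Lim_null_comparison[OF always_eventually])
    show "\<forall>z. norm (vabs (fst z + snd z - (a + b))) \<le> max (vabs (fst z - a)) (vabs (snd z - b))"
      using vabs_add_le_max[of "fst z - a" "snd z - b" for z :: "'a \<times> 'a"]
      by (simp add: algebra_simps)
    show "((\<lambda>z. max (vabs (fst z - a)) (vabs (snd z - b))) \<longlongrightarrow> 0) (nhds a \<times>\<^sub>F nhds b)"
      using tendsto_max[OF 1 2] by simp
  qed
  have "((\<lambda>x. x) \<longlongrightarrow> a) (nhds a)" by (rule filterlim_ident)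
  then show "(uminus \<longlongrightarrow> - a) (nhds a)"
    using vabs_minus_commute[of a] by (simp add: tendsto_vabs_diff_iff)
qed

instance complete_ultrametric_field \<subseteq> topological_comm_monoid_mult
proof
  fix a b :: 'a
  have 1: "((\<lambda>z. vabs (fst z - a)) \<longlongrightarrow> 0) (nhds a \<times>\<^sub>F nhds b)"
    using filterlim_fst[of "nhds a" "nhds b"] by (simp add: tendsto_vabs_diff_iff)
  have 2: "((\<lambda>z. vabs (snd z - b)) \<longlongrightarrow> 0) (nhds a \<times>\<^sub>F nhds b)"
    using filterlim_snd[of "nhds b" "nhds a"] by (simp add: tendsto_vabs_diff_iff)
  let ?B = "\<lambda>z. max (vabs (fst z - a) * vabs (snd z - b))
      (max (vabs a * vabs (snd z - b)) (vabs (fst z - a) * vabs b))"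
  show "((\<lambda>z. fst z * snd z) \<longlongrightarrow> a * b) (nhds a \<times>\<^sub>F nhds b)"
    unfolding tendsto_vabs_diff_iff[of _ "a * b"]
  proof (rule Lim_null_comparison[OF always_eventually])
    show "\<forall>z. norm (vabs (fst z * snd z - a * b)) \<le> ?B z"
    proof
      fix z :: "'a \<times> 'a"
      have "fst z * snd z - a * b
          = (fst z - a) * (snd z - b) + (a * (snd z - b) + (fst z - a) * b)"
        by (simp add: algebra_simps)
      also have "vabs \<dots> \<le> ?B z" unfolding vabs_mult[symmetric] by (intro vabs_add_le) auto
      finally show "norm (vabs (fst z * snd z - a * b)) \<le> ?B z" by simp
    qed
    show "(?B \<longlongrightarrow> 0) (nhds a \<times>\<^sub>F nhds b)"
      using tendsto_max[OF tendsto_mult[OF 1 2] tendsto_max[OF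
        tendsto_mult[OF tendsto_const[of "vabs a"] 2] tendsto_mult[OF 1 tendsto_const[of "vabs b"]]]]
      by simp
  qed
qed

section \<open>Limits and series\<close>

lemma tendsto_0_iff_vabs:
  fixes f :: "'b \<Rightarrow> 'a::complete_ultrametric_field"
  shows "(f \<longlongrightarrow> 0) F \<longleftrightarrow> ((\<lambda>x. vabs (f x)) \<longlongrightarrow> 0) F"
  using tendsto_vabs_diff_iff[of f 0] by simp

lemma tendsto_vabs:
  fixes f :: "'b \<Rightarrow> 'a::complete_ultrametric_field"
  assumes "(f \<longlongrightarrow> l) F"
  shows "((\<lambda>x. vabs (f x)) \<longlongrightarrow> vabs l) F"
  using tendsto_dist[OF assms tendsto_const[of 0]] by (simp add: dist_vabs)

lemma vabs_le_of_tendsto: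
  fixes f :: "nat \<Rightarrow> 'a::complete_ultrametric_field"
  assumes "f \<longlonglongrightarrow> l" and "\<And>n. vabs (f n) \<le> C"
  shows "vabs l \<le> C"
  using Lim_bounded[OF tendsto_vabs[OF assms(1)]] assms(2) by blast

lemma vabs_sums_le:
  fixes f :: "nat \<Rightarrow> 'a::complete_ultrametric_field"
  assumes "f sums l" and "\<And>n. vabs (f n) \<le> C"
  shows "vabs l \<le> C"
proof -
  have "0 \<le> C" using assms(2)[of 0] vabs_nonneg[of "f 0"] by linarith
  then show ?thesis
    by (intro vabs_le_of_tendsto[OF assms(1)[unfolded sums_def]] vabs_sum_le assms(2))
qed

lemma sums_diff_ultrametric:
  fixes f g :: "nat \<Rightarrow> 'a::complete_ultrametric_field"
  assumes "f sums a" and "g sums b"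
  shows "(\<lambda>n. f n - g n) sums (a - b)"
  using tendsto_diff[OF assms[unfolded sums_def]] by (simp add: sums_def sum_subtractf)

lemma sums_mult_ultrametric:
  fixes f :: "nat \<Rightarrow> 'a::complete_ultrametric_field"
  assumes "f sums a"
  shows "(\<lambda>n. c * f n) sums (c * a)"
  using tendsto_mult[OF tendsto_const[of c] assms[unfolded sums_def]]
  by (simp add: sums_def sum_distrib_left)

lemma sums_Suc_shift:
  fixes f :: "nat \<Rightarrow> 'a::complete_ultrametric_field"
  assumes "f sums l"
  shows "(\<lambda>n. f (Suc n)) sums (l - f 0)"
proof -
  have "(\<lambda>n. (\<Sum>i<Suc n. f i) - f 0) \<longlonglongrightarrow> l - f 0"
    by (rule tendsto_diff[OF LIMSEQ_Suc[OF assms[unfolded sums_def]] tendsto_const])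
  then show ?thesis by (simp only: sums_def sum.lessThan_Suc_shift add_diff_cancel_left')
qed

text \<open>By the ultrametric inequality a block of the series is at most its largest term, so
  terms tending to 0 already make the partial sums Cauchy, and the field is complete.\<close>

lemma summable_iff_tendsto_0:
  fixes f :: "nat \<Rightarrow> 'a::complete_ultrametric_field"
  shows "summable f \<longleftrightarrow> f \<longlonglongrightarrow> 0"
proof
  assume "summable f"
  then obtain l where l: "(\<lambda>n. \<Sum>i<n. f i) \<longlonglongrightarrow> l" by (auto simp: summable_def sums_def)
  have "(\<lambda>n. (\<Sum>i<Suc n. f i) - (\<Sum>i<n. f i)) \<longlonglongrightarrow> l - l"
    by (intro tendsto_diff l LIMSEQ_Suc)
  then show "f \<longlonglongrightarrow> 0" by simp
next
  assume f: "f \<longlonglongrightarrow> 0"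
  have "Cauchy (\<lambda>n. \<Sum>i<n. f i)"
  proof (rule metric_CauchyI)
    fix e :: real assume e: "0 < e"
    obtain N where N: "\<And>n. n \<ge> N \<Longrightarrow> vabs (f n) < e / 2"
      using order_tendstoD(2)[OF f[unfolded tendsto_0_iff_vabs], of "e / 2"] e
      unfolding eventually_sequentially by auto
    have *: "dist (\<Sum>i<m. f i) (\<Sum>i<n. f i) < e" if "N \<le> m" "m \<le> n" for m n
    proof -
      have "(\<Sum>i<n. f i) - (\<Sum>i<m. f i) = sum f {m..<n}"
        using that by (simp add: sum_diff_nat_ivl[of 0 m n f] lessThan_atLeast0)
      moreover have "vabs (sum f {m..<n}) \<le> e / 2"
        using that e by (intro vabs_sum_le less_imp_le[OF N]) auto
      ultimately show ?thesis using e
        by (simp add: dist_vabs vabs_minus_commute[of "\<Sum>i<m. f i"])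
    qed
    show "\<exists>M. \<forall>m\<ge>M. \<forall>n\<ge>M. dist (\<Sum>i<m. f i) (\<Sum>i<n. f i) < e"
    proof (intro exI allI impI)
      fix m n assume "N \<le> m" "N \<le> n"
      then show "dist (\<Sum>i<m. f i) (\<Sum>i<n. f i) < e"
        using *[of m n] *[of n m] by (cases "m \<le> n") (auto simp: dist_commute)
    qed
  qed
  then show "summable f"
    using Cauchy_convergent_iff unfolding summable_def sums_def convergent_def by blast
qed

text \<open>Besides estimating truncation errors, this bounds a partial sum by the later terms when
  l = 0, which is how it is used at a zero of a power series.\<close>

lemma tail_vabs_le:
  fixes f :: "nat \<Rightarrow> 'a::complete_ultrametric_field"
  assumes "f sums l" and le: "\<And>i. i \<ge> k \<Longrightarrow> vabs (f i) \<le> C"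
  shows "vabs (l - (\<Sum>i<k. f i)) \<le> C"
proof (rule vabs_le_of_tendsto)
  show "(\<lambda>n. (\<Sum>i<n + k. f i) - (\<Sum>i<k. f i)) \<longlonglongrightarrow> l - (\<Sum>i<k. f i)"
    by (rule tendsto_diff[OF LIMSEQ_ignore_initial_segment[OF assms(1)[unfolded sums_def]] tendsto_const])
  fix n
  have "0 \<le> C" using le[of k] vabs_nonneg[of "f k"] by linarith
  moreover have "(\<Sum>i<n + k. f i) - (\<Sum>i<k. f i) = sum f {k..<n + k}"
    by (simp add: sum_diff_nat_ivl[of 0 k "n + k" f] lessThan_atLeast0)
  ultimately show "vabs ((\<Sum>i<n + k. f i) - (\<Sum>i<k. f i)) \<le> C"
    using le by (auto intro: vabs_sum_le)
qed

text \<open>a^n - b^n = (a - b) S, where S is congruent to n b^(n-1) modulo a - b. The second bound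
  is the source of the gains below: for n a power of p the factor |n| is small.\<close>

lemma vabs_diff_power_le:
  fixes a b :: "'a::complete_ultrametric_field"
  assumes "vabs a \<le> 1" "vabs b \<le> 1"
  shows "vabs (a ^ n - b ^ n) \<le> vabs (a - b)"
    and "vabs (a ^ n - b ^ n) \<le> vabs (a - b) * max (vabs (of_nat n :: 'a)) (vabs (a - b))"
proof -
  have *: "vabs (a ^ n - b ^ n) \<le> vabs (a - b)" for n
  proof -
    have "vabs (\<Sum>i<n. b ^ (n - Suc i) * a ^ i) \<le> 1"
      using assms by (intro vabs_sum_le) (auto simp: vabs_mult vabs_power intro!: mult_le_one power_le_one)
    then have "vabs (a - b) * vabs (\<Sum>i<n. b ^ (n - Suc i) * a ^ i) \<le> vabs (a - b)"
      using mult_left_mono[of _ 1 "vabs (a - b)"] by simp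
    then show ?thesis by (simp only: power_diff_sumr2 vabs_mult)
  qed
  then show "vabs (a ^ n - b ^ n) \<le> vabs (a - b)" .
  let ?S = "\<Sum>i<n. b ^ (n - Suc i) * a ^ i"
  let ?m = "max (vabs (of_nat n :: 'a)) (vabs (a - b))"
  have "?S = of_nat n * b ^ (n - 1) + (\<Sum>i<n. b ^ (n - Suc i) * (a ^ i - b ^ i))"
    by (simp add: right_diff_distrib sum_subtractf flip: power_add)
  moreover have "vabs (of_nat n * b ^ (n - 1)) \<le> vabs (of_nat n :: 'a)"
    using assms by (simp add: vabs_mult vabs_power power_le_one mult_left_le)
  moreover have "vabs (b ^ (n - Suc i) * (a ^ i - b ^ i)) \<le> vabs (a - b)" for i
    using mult_mono[of "vabs (b ^ (n - Suc i))" 1, OF _ *[of i]] assms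
    by (simp add: vabs_mult vabs_power power_le_one)
  then have "vabs (\<Sum>i<n. b ^ (n - Suc i) * (a ^ i - b ^ i)) \<le> vabs (a - b)"
    by (intro vabs_sum_le) auto
  ultimately have "vabs ?S \<le> ?m"
    using vabs_add_le[of "of_nat n * b ^ (n - 1)" ?m "\<Sum>i<n. b ^ (n - Suc i) * (a ^ i - b ^ i)"]
    by (simp only: max.coboundedI1 max.coboundedI2)
  then show "vabs (a ^ n - b ^ n) \<le> vabs (a - b) * ?m"
    unfolding power_diff_sumr2 vabs_mult by (intro mult_left_mono) auto
qed

lemma vabs_diff_power_le_radius:
  fixes a b :: "'a::complete_ultrametric_field"
  assumes "vabs a \<le> r" "vabs b \<le> r"
  shows "vabs (a ^ Suc n - b ^ Suc n) \<le> vabs (a - b) * r ^ n"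
proof -
  have r: "0 \<le> r" using assms(1) vabs_nonneg[of a] by linarith
  have "vabs (b ^ (Suc n - Suc i) * a ^ i) \<le> r ^ n" if "i < Suc n" for i
  proof -
    have "vabs (b ^ (Suc n - Suc i) * a ^ i) \<le> r ^ (n - i) * r ^ i"
      using assms r by (auto simp: vabs_mult vabs_power intro!: mult_mono power_mono)
    also have "\<dots> = r ^ n" using that by (simp flip: power_add)
    finally show ?thesis .
  qed
  then have "vabs (\<Sum>i<Suc n. b ^ (Suc n - Suc i) * a ^ i) \<le> r ^ n"
    using r by (intro vabs_sum_le) auto
  then show ?thesis unfolding power_diff_sumr2 vabs_mult by (intro mult_left_mono) auto
qed

section \<open>Power series over ultrametric fields and the theorem of Strassmann\<close>

text \<open>If i + j is large, one index is large while the other factor stays bounded. This is the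
  form in which Cauchy products need the smallness.\<close>

lemma products_eventually_small:
  fixes A B :: "nat \<Rightarrow> real"
  assumes A: "A \<longlonglongrightarrow> 0" "\<And>i. 0 \<le> A i" and B: "B \<longlonglongrightarrow> 0" "\<And>i. 0 \<le> B i" and e: "0 < e"
  obtains M where "\<And>i j. M \<le> i + j \<Longrightarrow> A i * B j \<le> e"
proof -
  obtain K where K: "0 < K" "\<And>i. A i \<le> K"
    using convergent_imp_Bseq[OF convergentI[OF A(1)]] A(2) by (auto simp: Bseq_def)
  obtain L where L: "0 < L" "\<And>i. B i \<le> L"
    using convergent_imp_Bseq[OF convergentI[OF B(1)]] B(2) by (auto simp: Bseq_def)
  obtain N1 where N1: "\<And>n. n \<ge> N1 \<Longrightarrow> A n < e / L"
    using order_tendstoD(2)[OF A(1), of "e / L"] e L(1) by (auto simp: eventually_sequentially)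
  obtain N2 where N2: "\<And>n. n \<ge> N2 \<Longrightarrow> B n < e / K"
    using order_tendstoD(2)[OF B(1), of "e / K"] e K(1) by (auto simp: eventually_sequentially)
  show thesis
  proof (rule that[of "N1 + N2"])
    fix i j assume "N1 + N2 \<le> i + j"
    then consider "N1 \<le> i" | "N2 \<le> j" by linarith
    then show "A i * B j \<le> e"
    proof cases
      case 1
      have "A i * B j \<le> (e / L) * L"
        using A(2) B(2) L e by (intro mult_mono less_imp_le[OF N1[OF 1]] L(2)) auto
      then show ?thesis using L by simp
    next
      case 2
      have "A i * B j \<le> K * (e / K)"
        using A(2) B(2) K e by (intro mult_mono less_imp_le[OF N2[OF 2]] K(2)) auto
      then show ?thesis using K by simp
    qed
  qed
qed

text \<open>Convergence on the closed disc of radius r, read off the coefficients; r may thus be any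
  real number, even one that is not the absolute value of a point.\<close>

definition fps_conv :: "real \<Rightarrow> 'a::complete_ultrametric_field fps \<Rightarrow> bool" where
  "fps_conv r f \<longleftrightarrow> (\<lambda>k. vabs (f $ k) * r ^ k) \<longlonglongrightarrow> 0"

text \<open>The Gauss norm of radius r is at most C; stated as a bound, it makes sense without a
  supremum.\<close>

definition gauss_le :: "real \<Rightarrow> real \<Rightarrow> 'a::complete_ultrametric_field fps \<Rightarrow> bool" where
  "gauss_le r C f \<longleftrightarrow> (\<forall>k. vabs (f $ k) * r ^ k \<le> C)"

lemma gauss_leD: "gauss_le r C f \<Longrightarrow> vabs (f $ k) * r ^ k \<le> C"
  by (simp add: gauss_le_def)

lemma gauss_le_nonneg: "gauss_le r C f \<Longrightarrow> 0 \<le> C"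
  using order_trans[OF vabs_nonneg gauss_leD[of r C f 0, simplified]] .

lemma fps_mult_nth_vabs_le:
  assumes "0 \<le> r" "0 \<le> C"
    and "\<And>i. i \<le> n \<Longrightarrow> vabs (f $ i) * r ^ i * (vabs (g $ (n - i)) * r ^ (n - i)) \<le> C"
  shows "vabs ((f * g) $ n :: 'a::complete_ultrametric_field) * r ^ n \<le> C"
\<comment> \<open>Radius 0 is included because series are evaluated with r = |x|, where x may be 0;
  the division by r^n below has to avoid it.\<close>
proof (cases "r = 0 \<and> n > 0")
  case False
  then have r: "0 < r ^ n" using assms(1) by (cases "n = 0") auto
  have "vabs (f $ i * g $ (n - i)) \<le> C / r ^ n" if "i \<le> n" for i
  proof -
    have "r ^ n = r ^ i * r ^ (n - i)" using that by (simp flip: power_add)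
    then show ?thesis using assms(3)[OF that] r by (simp add: field_simps vabs_mult)
  qed
  then have "vabs ((f * g) $ n) \<le> C / r ^ n"
    unfolding fps_mult_nth using assms(2) r by (intro vabs_sum_le) auto
  then show ?thesis using r by (simp add: field_simps)
qed (use assms(2) in \<open>auto simp: power_0_left\<close>)

lemma gauss_le_mult:
  assumes "0 \<le> r" "gauss_le r C f" "gauss_le r D g"
  shows "gauss_le r (C * D) (f * g)"
  unfolding gauss_le_def using assms gauss_le_nonneg[OF assms(2)] gauss_le_nonneg[OF assms(3)]
  by (intro allI fps_mult_nth_vabs_le mult_mono gauss_leD) auto

lemma gauss_le_1: "gauss_le r 1 1"
  by (simp add: gauss_le_def)

lemma gauss_le_power:
  assumes "0 \<le> r" "gauss_le r C f"
  shows "gauss_le r (C ^ m) (f ^ m)"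
  by (induction m) (auto intro: gauss_le_mult gauss_le_1 assms)

lemma fps_conv_mono:
  assumes "fps_conv r f" "0 \<le> s" "s \<le> r"
  shows "fps_conv s f"
  unfolding fps_conv_def
proof (rule Lim_null_comparison[OF always_eventually assms(1)[unfolded fps_conv_def]], intro allI)
  show "norm (vabs (f $ k) * s ^ k) \<le> vabs (f $ k) * r ^ k" for k
    using assms by (auto intro!: mult_left_mono power_mono)
qed

lemma fps_conv_mult:
  assumes "0 \<le> r" "fps_conv r f" "fps_conv r g"
  shows "fps_conv r (f * g)"
  unfolding fps_conv_def
proof (rule LIMSEQ_I)
  fix e :: real assume e: "0 < e"
  obtain M where M: "\<And>i j. M \<le> i + j \<Longrightarrow>
      vabs (f $ i) * r ^ i * (vabs (g $ j) * r ^ j) \<le> e / 2"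
    using products_eventually_small[OF assms(2)[unfolded fps_conv_def] _ assms(3)[unfolded fps_conv_def],
        of "e / 2"] assms(1) e by auto
  show "\<exists>N. \<forall>n\<ge>N. norm (vabs ((f * g) $ n) * r ^ n - 0) < e"
  proof (intro exI allI impI)
    fix n assume "M \<le> n"
    then have "vabs ((f * g) $ n) * r ^ n \<le> e / 2"
      using assms(1) e by (intro fps_mult_nth_vabs_le M) auto
    then show "norm (vabs ((f * g) $ n) * r ^ n - 0) < e"
      using e assms(1) by (simp add: abs_mult)
  qed
qed

lemma fps_conv_of_poly: "fps_conv r (fps_of_poly q)"
proof -
  have "\<forall>\<^sub>F k in sequentially. 0 = vabs (fps_of_poly q $ k) * r ^ k"
    using eventually_gt_at_top[of "degree q"] by eventually_elim (simp add: coeff_eq_0)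
  then show ?thesis unfolding fps_conv_def by (rule Lim_transform_eventually[OF tendsto_const])
qed

lemma fps_conv_fps_const: "fps_conv r (fps_const c)"
  using fps_conv_of_poly[of r "[:c:]"] by (simp add: fps_of_poly_const)

lemma fps_conv_fps_X: "fps_conv r fps_X"
  using fps_conv_of_poly[of r "[:0, 1:]"] by (simp add: fps_of_poly_fps_X)

lemma fps_conv_1: "fps_conv r 1"
  using fps_conv_fps_const[of r 1] by simp

lemma fps_conv_power: "0 \<le> r \<Longrightarrow> fps_conv r f \<Longrightarrow> fps_conv r (f ^ m)"
  by (induction m) (auto intro: fps_conv_mult fps_conv_1)

lemma fps_conv_diff:
  assumes "0 \<le> r" "fps_conv r f" "fps_conv r g"
  shows "fps_conv r (f - g)"
  unfolding fps_conv_def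
proof (rule Lim_null_comparison[OF always_eventually])
  let ?B = "\<lambda>k. max (vabs (f $ k) * r ^ k) (vabs (g $ k) * r ^ k)"
  show "?B \<longlonglongrightarrow> 0"
    using tendsto_max[OF assms(2,3)[unfolded fps_conv_def]] by simp
  show "\<forall>k. norm (vabs ((f - g) $ k) * r ^ k) \<le> ?B k"
  proof
    fix k
    have "vabs (f $ k - g $ k) \<le> max (vabs (f $ k)) (vabs (g $ k))"
      by (rule vabs_diff_le) auto
    then have "vabs (f $ k - g $ k) * r ^ k \<le> max (vabs (f $ k)) (vabs (g $ k)) * r ^ k"
      using assms(1) by (intro mult_right_mono) auto
    also have "\<dots> = ?B k" using assms(1) by (simp add: max_mult_distrib_right)
    finally show "norm (vabs ((f - g) $ k) * r ^ k) \<le> ?B k" using assms(1) by simp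
  qed
qed

text \<open>The factor k + 1 has absolute value at most 1, so differentiation costs only the index
  shift, a factor 1/r.\<close>

lemma fps_conv_deriv:
  assumes "0 < r" "fps_conv r f"
  shows "fps_conv r (fps_deriv f)"
  unfolding fps_conv_def
proof (rule Lim_null_comparison[OF always_eventually])
  show "(\<lambda>k. vabs (f $ Suc k) * r ^ Suc k / r) \<longlonglongrightarrow> 0"
    using tendsto_divide[OF LIMSEQ_Suc[OF assms(2)[unfolded fps_conv_def]] tendsto_const[of r]]
      assms(1) by simp
  show "\<forall>k. norm (vabs (fps_deriv f $ k) * r ^ k) \<le> vabs (f $ Suc k) * r ^ Suc k / r"
  proof
    fix k
    have "vabs (of_nat (Suc k) :: 'a) \<le> 1" by (rule vabs_of_nat_le_1)
    then have "vabs (of_nat (Suc k) :: 'a) * vabs (f $ Suc k) \<le> vabs (f $ Suc k)"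
      by (rule mult_left_le_one_le[OF vabs_nonneg vabs_nonneg])
    then have "vabs (of_nat (Suc k) :: 'a) * vabs (f $ Suc k) * r ^ k \<le> vabs (f $ Suc k) * r ^ k"
      using assms(1) by (intro mult_right_mono) auto
    then show "norm (vabs (fps_deriv f $ k) * r ^ k) \<le> vabs (f $ Suc k) * r ^ Suc k / r"
      using assms(1) by (simp add: vabs_mult del: of_nat_Suc)
  qed
qed

section \<open>Values of power series\<close>

lemma fps_value_sums:
  assumes "fps_conv (vabs x) f"
  shows "(\<lambda>k. f $ k * x ^ k) sums fps_value f x"
proof -
  have "summable (\<lambda>k. f $ k * x ^ k)"
    using assms unfolding summable_iff_tendsto_0 tendsto_0_iff_vabs fps_conv_def
    by (simp add: vabs_mult vabs_power)
  then show ?thesis by (simp add: fps_value_def summable_sums)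
qed

lemma mem_fps_convergence_set_iff: "x \<in> fps_convergence_set f \<longleftrightarrow> fps_conv (vabs x) f"
  unfolding fps_convergence_set_def mem_Collect_eq summable_iff_tendsto_0 tendsto_0_iff_vabs fps_conv_def
  by (simp add: vabs_mult vabs_power)

lemma vabs_fps_value_le:
  assumes "fps_conv (vabs x) f" "gauss_le (vabs x) C f"
  shows "vabs (fps_value f x) \<le> C"
  using gauss_leD[OF assms(2)]
  by (intro vabs_sums_le[OF fps_value_sums[OF assms(1)]]) (simp add: vabs_mult vabs_power)

lemma fps_value_eqI: "(\<lambda>k. f $ k * x ^ k) sums v \<Longrightarrow> fps_value f x = v"
  unfolding fps_value_def by (rule sums_unique[symmetric])

lemma fps_value_diff:
  assumes "fps_conv (vabs x) f" "fps_conv (vabs x) g"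
  shows "fps_value (f - g) x = fps_value f x - fps_value g x"
  using sums_diff_ultrametric[OF assms[THEN fps_value_sums]]
  by (intro fps_value_eqI) (simp add: algebra_simps)

lemma fps_value_mult:
  assumes f: "fps_conv (vabs x) f" and g: "fps_conv (vabs x) g"
  shows "fps_value (f * g) x = fps_value f x * fps_value g x"
proof -
  define a where "a = (\<lambda>k. f $ k * x ^ k)"
  define b where "b = (\<lambda>k. g $ k * x ^ k)"
  have a: "a sums fps_value f x" and b: "b sums fps_value g x"
    unfolding a_def b_def using assms by (auto intro: fps_value_sums)
  have ab: "(f * g) $ k * x ^ k = (\<Sum>i\<le>k. a i * b (k - i))" for k
  proof -
    have "f $ i * g $ (k - i) * x ^ k = a i * b (k - i)" if "i \<le> k" for i
    proof -
      have "x ^ k = x ^ i * x ^ (k - i)" using that by (simp flip: power_add)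
      then show ?thesis by (simp add: a_def b_def)
    qed
    then show ?thesis by (simp add: fps_mult_nth sum_distrib_right atLeast0AtMost)
  qed
  define P where "P = (\<lambda>n. (\<Sum>i<n. a i) * (\<Sum>j<n. b j))"
  define Q where "Q = (\<lambda>n. \<Sum>k<n. (f * g) $ k * x ^ k)"
  \<comment> \<open>The product of the partial sums differs from the partial sum of the Cauchy
    product by the corner i + j >= n of the square, whose terms are uniformly small.\<close>
  have PQ: "P n - Q n = (\<Sum>(i,j)\<in>{..<n} \<times> {..<n} - {(i,j). i + j < n}. a i * b j)" for n
  proof -
    have "P n = (\<Sum>(i,j)\<in>{..<n} \<times> {..<n}. a i * b j)"
      by (simp add: P_def sum_product sum.cartesian_product)
    moreover have "Q n = (\<Sum>(i,j)\<in>{(i,j). i + j < n}. a i * b j)"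
      by (simp add: Q_def ab sum.triangle_reindex)
    moreover have "{(i, j). i + j < n} \<subseteq> {..<n} \<times> {..<n}" by auto
    ultimately show ?thesis by (simp add: sum_diff)
  qed
  have "(\<lambda>n. P n - Q n) \<longlonglongrightarrow> 0"
    unfolding tendsto_0_iff_vabs
  proof (rule LIMSEQ_I)
    fix e :: real assume e: "0 < e"
    obtain M where M: "\<And>i j. M \<le> i + j \<Longrightarrow> vabs (a i) * vabs (b j) \<le> e / 2"
      using products_eventually_small[of "\<lambda>i. vabs (a i)" "\<lambda>j. vabs (b j)" "e / 2"] f g e
      by (auto simp: fps_conv_def a_def b_def vabs_mult vabs_power)
    have "vabs (P n - Q n) \<le> e / 2" if "M \<le> n" for n
      unfolding PQ using that e by (intro vabs_sum_le) (auto simp: vabs_mult simp del: le_divide_eq_numeral1 intro!: M)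
    then show "\<exists>N. \<forall>n\<ge>N. norm (vabs (P n - Q n) - 0) < e"
      using e by (intro exI[of _ M]) fastforce
  qed
  moreover have "P \<longlonglongrightarrow> fps_value f x * fps_value g x"
    unfolding P_def using tendsto_mult[OF a[unfolded sums_def] b[unfolded sums_def]] .
  ultimately have "(\<lambda>n. P n - (P n - Q n)) \<longlonglongrightarrow> fps_value f x * fps_value g x - 0"
    using tendsto_diff by blast
  then show ?thesis by (intro fps_value_eqI) (simp add: sums_def Q_def)
qed

lemma fps_value_add:
  assumes "fps_conv (vabs x) f" "fps_conv (vabs x) g"
  shows "fps_value (f + g) x = fps_value f x + fps_value g x"
  using sums_add[OF assms[THEN fps_value_sums]]
  by (intro fps_value_eqI) (simp add: algebra_simps)

lemma fps_value_of_poly: "fps_value (fps_of_poly q) x = poly q x"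
proof (rule fps_value_eqI)
  have "(\<lambda>k. fps_of_poly q $ k * x ^ k) sums (\<Sum>k\<le>degree q. fps_of_poly q $ k * x ^ k)"
    by (intro sums_finite) (auto simp: coeff_eq_0)
  then show "(\<lambda>k. fps_of_poly q $ k * x ^ k) sums poly q x" by (simp add: poly_altdef)
qed

lemma fps_value_fps_const: "fps_value (fps_const c) x = c"
  using fps_value_of_poly[of "[:c:]" x] by (simp add: fps_of_poly_const)

lemma fps_value_fps_X: "fps_value fps_X x = x"
  using fps_value_of_poly[of "[:0, 1:]" x] by (simp add: fps_of_poly_fps_X)

lemma fps_value_1: "fps_value 1 x = 1"
  using fps_value_fps_const[of 1 x] by simp

lemma fps_value_power:
  assumes "fps_conv (vabs x) f"
  shows "fps_value (f ^ m) x = fps_value f x ^ m"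
  by (induction m) (auto simp: fps_value_1 fps_value_mult fps_conv_power assms)

text \<open>\<open>N\<close> is the Weierstrass degree of \<open>f\<close> on the disc of radius \<open>r\<close>.\<close>

definition last_dominant :: "real \<Rightarrow> nat \<Rightarrow> 'a::complete_ultrametric_field fps \<Rightarrow> bool" where
  "last_dominant r N f \<longleftrightarrow> gauss_le r (vabs (f $ N) * r ^ N) f \<and>
     (\<forall>k>N. vabs (f $ k) * r ^ k < vabs (f $ N) * r ^ N)"

text \<open>The Gauss norm is multiplicative and the Weierstrass degree additive: in the coefficient
  of index N + M every summand except \<open>f $ N * g $ M\<close> has one index beyond N or M and
  is strictly smaller, so nothing cancels.\<close>

lemma last_dominant_mult:
  assumes f: "last_dominant r N f" and g: "last_dominant r M g" and r: "0 < r"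
  shows "last_dominant r (N + M) (f * g)"
    and "vabs ((f * g) $ (N + M)) * r ^ (N + M) = vabs (f $ N) * r ^ N * (vabs (g $ M) * r ^ M)"
proof -
  define A where "A = (\<lambda>k. vabs (f $ k) * r ^ k)"
  define B where "B = (\<lambda>k. vabs (g $ k) * r ^ k)"
  have A: "A k \<le> A N" "k > N \<Longrightarrow> A k < A N" "0 \<le> A k" for k
    using f r by (auto simp: last_dominant_def gauss_le_def A_def)
  have B: "B k \<le> B M" "k > M \<Longrightarrow> B k < B M" "0 \<le> B k" for k
    using g r by (auto simp: last_dominant_def gauss_le_def B_def)
  have pos: "0 < A N" "0 < B M"
    using A(2,3)[of "Suc N"] B(2,3)[of "Suc M"] by auto
  have AB: "vabs (f $ i * g $ j) = A i * B j / r ^ (i + j)" for i j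
    using r by (simp add: A_def B_def vabs_mult power_add)
  have strict: "A i * B j < A N * B M" if "i > N \<or> j > M" for i j
    using that
  proof
    assume "i > N"
    then have "A i * B j \<le> A i * B M" using A B by (intro mult_left_mono) auto
    also have "\<dots> < A N * B M" using A(2) \<open>i > N\<close> pos by (intro mult_strict_right_mono) auto
    finally show ?thesis .
  next
    assume "j > M"
    then have "A i * B j \<le> A N * B j" using A B by (intro mult_right_mono) auto
    also have "\<dots> < A N * B M" using B(2) \<open>j > M\<close> pos by (intro mult_strict_left_mono) auto
    finally show ?thesis .
  qed
  have "vabs ((f * g) $ (N + M)) = vabs (f $ N * g $ M)"
  proof -
    let ?I = "{0..N + M} - {N}"
    have "vabs (\<Sum>i\<in>?I. f $ i * g $ (N + M - i)) < vabs (f $ N * g $ M)"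
    proof (rule vabs_sum_less)
      fix i assume "i \<in> ?I"
      then have "i > N \<or> N + M - i > M" "i + (N + M - i) = N + M" by auto
      then show "vabs (f $ i * g $ (N + M - i)) < vabs (f $ N * g $ M)"
        unfolding AB using strict r by (simp add: divide_strict_right_mono)
    qed (use pos r in \<open>simp add: AB\<close>)
    moreover have "(f * g) $ (N + M) = f $ N * g $ M + (\<Sum>i\<in>?I. f $ i * g $ (N + M - i))"
      unfolding fps_mult_nth by (subst sum.remove[of _ N]) auto
    ultimately show ?thesis by (simp add: vabs_add_eq_left)
  qed
  then show eq: "vabs ((f * g) $ (N + M)) * r ^ (N + M) = vabs (f $ N) * r ^ N * (vabs (g $ M) * r ^ M)"
    using r by (simp add: AB) (simp add: A_def B_def)
  have "vabs ((f * g) $ k) * r ^ k < A N * B M" if "k > N + M" for k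
  proof -
    have "vabs ((f * g) $ k) < A N * B M / r ^ k"
      unfolding fps_mult_nth
    proof (rule vabs_sum_less)
      fix i assume "i \<in> {0..k}"
      then have "i > N \<or> k - i > M" "i + (k - i) = k" using that by auto
      then show "vabs (f $ i * g $ (k - i)) < A N * B M / r ^ k"
        unfolding AB using strict r by (simp add: divide_strict_right_mono)
    qed (use pos r in simp)
    then show ?thesis using r by (simp add: field_simps)
  qed
  moreover have "gauss_le r (A N * B M) (f * g)"
    using f g r unfolding last_dominant_def A_def B_def by (intro gauss_le_mult) auto
  ultimately show "last_dominant r (N + M) (f * g)"
    unfolding last_dominant_def eq by (simp add: A_def B_def)
qed

lemma last_dominant_1: "0 < r \<Longrightarrow> last_dominant r 0 1"
  by (simp add: last_dominant_def gauss_le_def)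

lemma last_dominant_power:
  assumes "last_dominant r N f" and "0 < r"
  shows "last_dominant r (m * N) (f ^ m)"
    and "vabs ((f ^ m) $ (m * N)) * r ^ (m * N) = (vabs (f $ N) * r ^ N) ^ m"
proof -
  have "last_dominant r (m * N) (f ^ m) \<and>
      vabs ((f ^ m) $ (m * N)) * r ^ (m * N) = (vabs (f $ N) * r ^ N) ^ m"
    using assms by (induction m) (simp_all add: last_dominant_1 last_dominant_mult)
  then show "last_dominant r (m * N) (f ^ m)"
    and "vabs ((f ^ m) $ (m * N)) * r ^ (m * N) = (vabs (f $ N) * r ^ N) ^ m" by auto
qed

text \<open>From index N on, g is strictly below the common bound and cannot disturb the dominance
  of f; below N a weak bound suffices. Applied with f the term j = 1 of the functional equation and
  g - f = \<Psi>.\<close>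

lemma last_dominant_diff:
  assumes f: "last_dominant r N f" and r: "0 < r"
    and g: "gauss_le r (vabs (f $ N) * r ^ N) g"
    and small: "\<And>k. k \<ge> N \<Longrightarrow> vabs (g $ k) * r ^ k < vabs (f $ N) * r ^ N"
  shows "last_dominant r N (g - f)" and "vabs ((g - f) $ N) = vabs (f $ N)"
proof -
  have "vabs (g $ N) < vabs (- f $ N)" using small[of N] r by simp
  then show eq: "vabs ((g - f) $ N) = vabs (f $ N)"
    using vabs_add_eq_left[of "g $ N" "- f $ N"] by simp
  define C where "C = vabs (f $ N) * r ^ N"
  have "vabs ((g - f) $ k) * r ^ k \<le> C" for k
  proof -
    have "vabs (g $ k - f $ k) \<le> C / r ^ k"
      using f g r by (intro vabs_diff_le)
        (auto simp: last_dominant_def gauss_le_def C_def pos_le_divide_eq)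
    then show ?thesis using r by (simp add: pos_le_divide_eq)
  qed
  moreover have "vabs ((g - f) $ k) * r ^ k < C" if "k > N" for k
  proof -
    have "vabs (g $ k - f $ k) < C / r ^ k"
      using f small that r by (intro vabs_diff_less)
        (auto simp: last_dominant_def gauss_le_def C_def pos_less_divide_eq)
    then show ?thesis using r by (simp add: pos_less_divide_eq)
  qed
  ultimately show "last_dominant r N (g - f)"
    unfolding last_dominant_def gauss_le_def eq C_def by blast
qed

text \<open>Turns the strict inequalities beyond N into one gap, since limits of sums preserve only
  weak bounds. Half of the maximum takes care of all but finitely many indices.\<close>

lemma last_dominant_uniform:
  assumes "last_dominant r N f" and conv: "fps_conv r f" and r: "0 < r"
  obtains D where "0 \<le> D" "D < vabs (f $ N) * r ^ N" "\<And>k. k > N \<Longrightarrow> vabs (f $ k) * r ^ k \<le> D"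
proof -
  define A where "A = (\<lambda>k. vabs (f $ k) * r ^ k)"
  have A: "A \<longlonglongrightarrow> 0" "\<And>k. k > N \<Longrightarrow> A k < A N" "\<And>k. A k \<le> A N"
    using assms by (auto simp: last_dominant_def fps_conv_def A_def gauss_le_def)
  have "0 \<le> A (Suc N)" using r by (simp add: A_def)
  then have pos: "0 < A N" using A(2)[of "Suc N"] by linarith
  obtain M where M: "\<And>k. k \<ge> M \<Longrightarrow> A k < A N / 2"
    using order_tendstoD(2)[OF A(1), of "A N / 2"] pos by (auto simp: eventually_sequentially)
  define D where "D = Max (insert (A N / 2) (A ` {N<..M}))"
  show thesis
  proof (rule that[of D])
    have "A N / 2 \<le> D" unfolding D_def by (rule Max_ge) auto
    with pos show "0 \<le> D" by simp
    show "D < vabs (f $ N) * r ^ N"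
      using pos A(2) unfolding D_def by (subst Max_less_iff) (auto simp: A_def mult.commute)
    fix k assume k: "k > N"
    show "vabs (f $ k) * r ^ k \<le> D"
    proof (cases "k \<le> M")
      case True
      then have "A k \<le> D" unfolding D_def using k by (intro Max_ge) auto
      then show ?thesis by (simp add: A_def)
    next
      case False
      then show ?thesis using M[of k] \<open>A N / 2 \<le> D\<close> by (simp add: A_def)
    qed
  qed
qed

text \<open>Division by 1 - X/z. At a zero the coefficients of the quotient are, up to scaling,
  tails of the series f(z), so they are governed by the coefficients of f beyond k; this lowers the
  Weierstrass degree by one.\<close>

lemma last_dominant_divide_zero:
  assumes dom: "last_dominant r N f" and conv: "fps_conv r f" and r: "0 < r"
    and z: "z \<noteq> 0" "vabs z \<le> r" "fps_value f z = 0"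
  obtains g where "f = fps_of_poly [:1, - (1 / z):] * g" "last_dominant r (N - 1) g" "fps_conv r g" "N \<ge> 1"
proof -
  \<comment> \<open>Multiplying f by the geometric series of X/z makes the coefficient of index k
    equal to the partial sum \<open>t k\<close> divided by z^k.\<close>
  define t where "t = (\<lambda>k. \<Sum>i<Suc k. f $ i * z ^ i)"
  define g where "g = Abs_fps (\<lambda>k. t k / z ^ k)"
  have g: "g $ k = t k / z ^ k" for k by (simp add: g_def)
  have sums0: "(\<lambda>k. f $ k * z ^ k) sums 0"
    using fps_value_sums[OF fps_conv_mono[OF conv vabs_nonneg z(2)]] z(3) by simp
  have zr: "0 < vabs z" "0 < vabs z / r" "vabs z / r \<le> 1" using z r by auto
  have G: "vabs (g $ k) * r ^ k \<le> D * (vabs z / r)"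
    if D: "\<And>i. i > k \<Longrightarrow> vabs (f $ i) * r ^ i \<le> D" for k D
  proof -
    have "0 \<le> vabs (f $ Suc k) * r ^ Suc k" using r by simp
    with D[of "Suc k"] have D0: "0 \<le> D" by linarith
    have "vabs (f $ i * z ^ i) \<le> D * (vabs z / r) ^ Suc k" if "i \<ge> Suc k" for i
    proof -
      have "vabs (f $ i * z ^ i) = vabs (f $ i) * r ^ i * (vabs z / r) ^ i"
        using r by (simp add: vabs_mult vabs_power power_divide)
      also have "\<dots> \<le> D * (vabs z / r) ^ Suc k"
        using that zr D0 r by (intro mult_mono D power_decreasing) auto
      finally show ?thesis .
    qed
    then have "vabs (t k) \<le> D * (vabs z / r) ^ Suc k"
      using tail_vabs_le[OF sums0, of "Suc k"] by (simp add: t_def del: sum.lessThan_Suc)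
    then have "vabs (g $ k) * r ^ k \<le> D * (vabs z / r) ^ Suc k / vabs z ^ k * r ^ k"
      unfolding g vabs_divide vabs_power using r zr by (intro mult_right_mono divide_right_mono) auto
    also have "\<dots> = D * (vabs z / r)"
      using zr(1) r by (simp add: power_divide)
    finally show ?thesis .
  qed
  have step: "f $ Suc k = g $ Suc k - g $ k / z" for k
    using z(1) by (simp add: g t_def field_simps)
  have fg: "f = fps_of_poly [:1, - (1 / z):] * g"
  proof (rule fps_ext)
    fix k
    have "fps_of_poly [:1, - (1 / z):] * g = g - fps_const (1 / z) * (fps_X * g)"
      by (simp add: fps_of_poly_pCons algebra_simps fps_of_poly_const flip: fps_const_neg)
    then show "f $ k = (fps_of_poly [:1, - (1 / z):] * g) $ k"
      using step by (cases k) (simp_all add: g t_def del: sum.lessThan_Suc, simp)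
  qed
  define C where "C = vabs (f $ N) * r ^ N"
  obtain D where D: "0 \<le> D" "D < C" "\<And>k. k > N \<Longrightarrow> vabs (f $ k) * r ^ k \<le> D"
    using last_dominant_uniform[OF dom conv r] unfolding C_def by blast
  have C: "vabs (f $ k) * r ^ k \<le> C" for k
    using dom by (auto simp: last_dominant_def gauss_le_def C_def)
  have small: "vabs (g $ k) * r ^ k < C * (vabs z / r)" if "k \<ge> N" for k
  proof -
    have "vabs (g $ k) * r ^ k \<le> D * (vabs z / r)" using that D(3) by (intro G) auto
    also have "\<dots> < C * (vabs z / r)" using D(2) zr by (intro mult_strict_right_mono) auto
    finally show ?thesis .
  qed
  have Czr: "C * (vabs z / r) \<le> C" using D zr mult_left_mono[of "vabs z / r" 1 C] by auto
  \<comment> \<open>A series dominated by its constant term has no zero in the disc: for N = 0 the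
    coefficient \<open>g $ 0 = f $ 0\<close> would be strictly below its own size.\<close>
  have N: "N \<ge> 1"
  proof (rule ccontr)
    assume "\<not> N \<ge> 1"
    then have "N = 0" by simp
    moreover have "g $ 0 = f $ 0" by (simp add: g t_def)
    ultimately have "C < C * (vabs z / r)" using small[of 0] by (simp add: C_def)
    with Czr show False by simp
  qed
  then obtain M where M: "N = Suc M" by (cases N) auto
  have "vabs (g $ N) * r ^ N < vabs (f $ N) * r ^ N"
    using small[of N] Czr by (simp add: C_def)
  then have "vabs (g $ N) < vabs (f $ N)" using r by simp
  \<comment> \<open>In the coefficient N of (1 - X/z) g the summand \<open>g $ N\<close> is too
    small, so \<open>g $ M / z\<close> carries the size of \<open>f $ N\<close>, and M becomes the
    new Weierstrass degree.\<close>
  moreover have "g $ M / z = - f $ N + g $ N" using step[of M] by (simp add: M)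
  ultimately have "vabs (g $ M / z) = vabs (f $ N)"
    using vabs_add_eq_left[of "g $ N" "- f $ N"] by simp
  then have gM: "vabs (g $ M) * r ^ M = C * (vabs z / r)"
    using zr r by (simp add: C_def M vabs_divide field_simps)
  have conv_g: "fps_conv r g"
    unfolding fps_conv_def
  proof (rule LIMSEQ_I)
    fix e :: real assume e: "0 < e"
    obtain K where K: "\<And>k. k \<ge> K \<Longrightarrow> vabs (f $ k) * r ^ k < e / 2"
      using order_tendstoD(2)[OF conv[unfolded fps_conv_def], of "e / 2"] e
      by (auto simp: eventually_sequentially)
    have "vabs (g $ k) * r ^ k < e" if "k \<ge> K" for k
    proof -
      have "vabs (g $ k) * r ^ k \<le> e / 2 * (vabs z / r)"
        using that K by (intro G less_imp_le) auto
      also have "\<dots> \<le> e / 2" using zr e mult_left_mono[of "vabs z / r" 1 "e / 2"] by auto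
      finally show ?thesis using e by simp
    qed
    then show "\<exists>N. \<forall>n\<ge>N. norm (vabs (g $ n) * r ^ n - 0) < e"
      using r by (intro exI[of _ K]) (simp add: abs_mult)
  qed
  have "gauss_le r (vabs (g $ M) * r ^ M) g"
    unfolding gauss_le_def gM using C by (intro allI G)
  then have "last_dominant r (N - 1) g"
    using small by (auto simp: last_dominant_def M gM)
  with fg N conv_g show thesis by (intro that)
qed

text \<open>The linear factors already split off do not vanish at a further zero, which therefore
  passes to the cofactor. Each division lowers the Weierstrass degree by one, so the degree bounds
  the number of distinct zeros.\<close>

lemma strassmann_factorization:
  assumes dom: "last_dominant r N f" and conv: "fps_conv r f" and r: "0 < r" and "finite Z"
    and Z: "\<And>z. z \<in> Z \<Longrightarrow> z \<noteq> 0 \<and> vabs z \<le> r \<and> fps_value f z = 0"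
  shows "card Z \<le> N \<and> (\<exists>g. f = fps_of_poly (\<Prod>z\<in>Z. [:1, - (1 / z):]) * g \<and>
           last_dominant r (N - card Z) g \<and> fps_conv r g)"
  using \<open>finite Z\<close> Z
proof (induction Z rule: finite_induct)
  case empty
  then show ?case using dom conv by auto
next
  case (insert w Z)
  then obtain g where g: "card Z \<le> N" "f = fps_of_poly (\<Prod>z\<in>Z. [:1, - (1 / z):]) * g"
      "last_dominant r (N - card Z) g" "fps_conv r g"
    by auto
  have w: "w \<noteq> 0" "vabs w \<le> r" "fps_value f w = 0" using insert.prems by auto
  have "fps_conv (vabs w) g"
    using g(4) w(2) by (auto intro: fps_conv_mono)
  then have "poly (\<Prod>z\<in>Z. [:1, - (1 / z):]) w * fps_value g w = 0"
    using w(3) g(2) by (simp add: fps_value_mult fps_conv_of_poly fps_value_of_poly)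
  moreover have "poly (\<Prod>z\<in>Z. [:1, - (1 / z):]) w \<noteq> 0"
    using insert.hyps insert.prems by (auto simp: poly_prod)
  ultimately have "fps_value g w = 0" by simp
  from last_dominant_divide_zero[OF g(3,4) r w(1,2) this]
  obtain h where h: "g = fps_of_poly [:1, - (1 / w):] * h" "last_dominant r (N - card Z - 1) h"
      "fps_conv r h" "N - card Z \<ge> 1" .
  have "f = fps_of_poly (\<Prod>z\<in>insert w Z. [:1, - (1 / z):]) * h"
    using insert.hyps by (simp add: g(2) h(1) fps_of_poly_mult mult_ac)
  then show ?case using h insert.hyps by auto
qed

text \<open>Such a g has no zeros on the disc. The second bound comes from (|x|/r)^k <= |x|/r for k
  >= 1; it makes a cofactor with constant term 1 tend to 1 on a fixed disc when r grows.\<close>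

lemma last_dominant_0_approx:
  assumes dom: "last_dominant r 0 g" and conv: "fps_conv r g" and r: "0 < r" and x: "vabs x \<le> r"
  shows "fps_value g x \<noteq> 0"
    and "vabs (fps_value g x - g $ 0) \<le> vabs (g $ 0) * (vabs x / r)"
proof -
  have sums: "(\<lambda>k. g $ k * x ^ k) sums fps_value g x"
    by (intro fps_value_sums fps_conv_mono[OF conv]) (auto simp: x)
  obtain D where D: "0 \<le> D" "D < vabs (g $ 0)" "\<And>k. k > 0 \<Longrightarrow> vabs (g $ k) * r ^ k \<le> D"
    using last_dominant_uniform[OF dom conv r] by auto
  have "vabs (fps_value g x - (\<Sum>i<1. g $ i * x ^ i)) \<le> D"
  proof (rule tail_vabs_le[OF sums])
    fix k :: nat assume "k \<ge> 1"
    have "vabs (g $ k) * vabs x ^ k \<le> vabs (g $ k) * r ^ k"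
      using x by (intro mult_left_mono power_mono) auto
    with D(3)[of k] \<open>k \<ge> 1\<close> show "vabs (g $ k * x ^ k) \<le> D" by (simp add: vabs_mult vabs_power)
  qed
  then have "vabs (fps_value g x - g $ 0) < vabs (g $ 0)" using D by simp
  then have "vabs (fps_value g x) = vabs (g $ 0)" by (rule vabs_eq_of_diff_less)
  then show "fps_value g x \<noteq> 0" using D by auto
  have "vabs (fps_value g x - (\<Sum>i<1. g $ i * x ^ i)) \<le> vabs (g $ 0) * (vabs x / r)"
  proof (rule tail_vabs_le[OF sums])
    fix k :: nat assume k: "k \<ge> 1"
    have "vabs (g $ k * x ^ k) = vabs (g $ k) * r ^ k * (vabs x / r) ^ k"
      using r by (simp add: vabs_mult vabs_power power_divide)
    also have "\<dots> \<le> vabs (g $ 0) * (vabs x / r)"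
    proof (rule mult_mono)
      show "vabs (g $ k) * r ^ k \<le> vabs (g $ 0)" using D k by (meson less_imp_le order_trans less_le_trans zero_less_one)
      show "(vabs x / r) ^ k \<le> vabs x / r"
        using power_decreasing[OF k, of "vabs x / r"] x r by simp
    qed (use r in auto)
    finally show "vabs (g $ k * x ^ k) \<le> vabs (g $ 0) * (vabs x / r)" .
  qed
  then show "vabs (fps_value g x - g $ 0) \<le> vabs (g $ 0) * (vabs x / r)" by simp
qed

text \<open>The derivative at z is -Q(z)/z with Q the product of the other factors, and this is
  nonzero.\<close>

lemma order_prod_linear_factors:
  fixes Z :: "'a::field_char_0 set"
  assumes "finite Z" "z \<in> Z" "0 \<notin> Z"
  shows "order z (\<Prod>w\<in>Z. [:1, - (1 / w):]) = 1"
proof -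
  define Q where "Q = (\<Prod>w\<in>Z - {z}. [:1, - (1 / w):])"
  have eq: "(\<Prod>w\<in>Z. [:1, - (1 / w):]) = [:1, - (1 / z):] * Q"
    unfolding Q_def using assms by (intro prod.remove)
  have z: "z \<noteq> 0" using assms by auto
  have "poly Q z \<noteq> 0" unfolding Q_def using assms by (auto simp: poly_prod)
  moreover have "poly (pderiv ([:1, - (1 / z):] * Q)) z = - (poly Q z / z)"
    unfolding pderiv_mult using z by (simp add: pderiv_pCons)
  ultimately have d: "poly (pderiv ([:1, - (1 / z):] * Q)) z \<noteq> 0" using z by simp
  then have "[:1, - (1 / z):] * Q \<noteq> 0" by (metis pderiv_0 poly_0)
  moreover have "poly ([:1, - (1 / z):] * Q) z = 0" unfolding poly_mult using z by simp
  ultimately have "order z ([:1, - (1 / z):] * Q) = Suc (order z (pderiv ([:1, - (1 / z):] * Q)))"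
    by (rule order_pderiv)
  then show ?thesis unfolding eq by (simp only: order_0I[OF d] One_nat_def)
qed

section \<open>Compositional inverses over the integers\<close>

text \<open>As \<open>f $ 1 = 1\<close>, the coefficient g_n can be isolated in the coefficient n of
  f(g); the summands with k >= 2 involve only earlier coefficients because g has no constant term.
  The equation is thus a recursion for g.\<close>

lemma fps_compose_eq_X_iff:
  fixes f g :: "'a::comm_ring_1 fps"
  assumes "f $ 0 = 0" "f $ 1 = 1" "g $ 0 = 0"
  shows "f oo g = fps_X \<longleftrightarrow>
    (\<forall>n\<ge>1. g $ n = (if n = 1 then 1 else 0) - (\<Sum>k=2..n. f $ k * (g ^ k) $ n))"
proof -
  have pos: "(f oo g) $ n = g $ n + (\<Sum>k=2..n. f $ k * (g ^ k) $ n)" if "n \<ge> 1" for n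
  proof -
    have "{0..n} = insert 0 (insert 1 {2..n})" using that by auto
    then show ?thesis using assms(1,2) by (simp add: fps_compose_nth)
  qed
  have zero: "(f oo g) $ 0 = (fps_X :: 'a fps) $ 0" using assms by (simp add: fps_compose_nth)
  have split: "(\<forall>n. P n) \<longleftrightarrow> P 0 \<and> (\<forall>n\<ge>1. P n)" for P :: "nat \<Rightarrow> bool"
    by (metis One_nat_def Suc_leI gr0I)
  have "f oo g = fps_X \<longleftrightarrow> (\<forall>n\<ge>1. (f oo g) $ n = fps_X $ n)"
    unfolding fps_eq_iff split[of "\<lambda>n. (f oo g) $ n = fps_X $ n"] using zero by blast
  also have "\<dots> \<longleftrightarrow> (\<forall>n\<ge>1. g $ n + (\<Sum>k=2..n. f $ k * (g ^ k) $ n) = (if n = 1 then 1 else 0))"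
    using pos by (simp add: fps_X_def)
  finally show ?thesis by (simp only: eq_diff_eq)
qed

lemma right_compositional_inverse_exists:
  fixes f :: "int fps"
  assumes f: "f $ 0 = 0" "f $ 1 = 1"
  shows "\<exists>g. g $ 0 = 0 \<and> g $ 1 = 1 \<and> f oo g = fps_X"
proof -
  \<comment> \<open>The update \<open>a(0 := 0)\<close> gives every candidate sequence a vanishing
    constant term, so that \<open>R a n\<close> depends only on values below n for all a, as
    well-founded recursion demands.\<close>
  define R :: "(nat \<Rightarrow> int) \<Rightarrow> nat \<Rightarrow> int" where
    "R = (\<lambda>a n. if n = 0 then 0 else (if n = 1 then 1 else 0)
       - (\<Sum>k=2..n. f $ k * (Abs_fps (a(0 := 0)) ^ k) $ n))"
  have R_cong: "R a n = R b n" if "\<And>k. k < n \<Longrightarrow> a k = b k" for a b n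
    unfolding R_def using that
    by (auto intro!: sum.cong arg_cong2[of _ _ _ _ "(*)"] fps_power_nth_cong)
  have adm: "adm_wf less_than R" by (auto simp: adm_wf_def intro: R_cong)
  define a where "a = wfrec less_than R"
  have a: "a n = R a n" for n
    unfolding a_def by (subst wfrec_fixpoint[OF wf_less_than adm]) simp
  define g where "g = Abs_fps a"
  have a0: "a 0 = 0" by (subst a) (simp add: R_def)
  then have *: "Abs_fps (a(0 := 0)) = g" by (simp add: g_def fun_upd_idem)
  have g0: "g $ 0 = 0" by (simp add: g_def a0)
  have "g $ n = (if n = 1 then 1 else 0) - (\<Sum>k=2..n. f $ k * (g ^ k) $ n)" if "n \<ge> 1" for n
    using a[of n] that unfolding R_def * by (simp add: g_def)
  then have "f oo g = fps_X" using f g0 by (subst fps_compose_eq_X_iff) auto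
  moreover have "g $ 1 = 1" using a[of 1] by (simp add: g_def R_def)
  ultimately show ?thesis using g0 by blast
qed

text \<open>As in a monoid: the right inverse g has itself a right inverse h, associativity gives f
  = h, and g is then two-sided.\<close>

lemma compositional_inverse_ex1:
  fixes f :: "int fps"
  assumes f: "f $ 0 = 0" "f $ 1 = 1"
  shows "\<exists>!g. is_compositional_inverse f g"
proof -
  obtain g where g: "g $ 0 = 0" "g $ 1 = 1" "f oo g = fps_X"
    using right_compositional_inverse_exists[OF f] by blast
  obtain h where h: "h $ 0 = 0" "h $ 1 = 1" "g oo h = fps_X"
    using right_compositional_inverse_exists[OF g(1,2)] by blast
  have "f = f oo (g oo h)" by (simp add: h(3))
  also have "\<dots> = (f oo g) oo h" by (rule fps_compose_assoc[OF h(1) g(1)])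
  also have "\<dots> = h" using h(1) by (simp add: g(3))
  finally have "g oo f = fps_X" using h(3) by simp
  with g have "is_compositional_inverse f g" by (simp add: is_compositional_inverse_def)
  moreover have "g' = g" if "is_compositional_inverse f g'" for g'
  proof -
    have g': "g' $ 0 = 0" "g' oo f = fps_X" using that by (auto simp: is_compositional_inverse_def)
    have "g' = g' oo (f oo g)" by (simp add: g(3))
    also have "\<dots> = (g' oo f) oo g" by (rule fps_compose_assoc[OF g(1) f(1)])
    also have "\<dots> = g" using g(1) by (simp add: g'(2))
    finally show ?thesis .
  qed
  ultimately show ?thesis by blast
qed

section \<open>The $p$-adic numbers inside an ultrametric field\<close>

lemma Rats_subset_Qp: "\<rat> \<subseteq> Qp"
  unfolding Qp_def by (rule closure_subset)

lemma closed_Qp: "closed Qp"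
  by (simp add: Qp_def)

lemma Qp_of_int: "of_int m \<in> Qp"
  using Rats_subset_Qp Rats_of_int by blast

lemma Qp_of_nat: "of_nat m \<in> Qp"
  using Qp_of_int[of "int m"] by simp

lemma Qp_0: "0 \<in> Qp" and Qp_1: "1 \<in> Qp"
  using Qp_of_nat[of 0] Qp_of_nat[of 1] by auto

lemma Qp_closed_binop:
  fixes f :: "'a::complete_ultrametric_field \<Rightarrow> 'a \<Rightarrow> 'a"
  assumes "x \<in> Qp" "y \<in> Qp"
    and rat: "\<And>a b. a \<in> \<rat> \<Longrightarrow> b \<in> \<rat> \<Longrightarrow> f a b \<in> \<rat>"
    and lim: "\<And>X Y. X \<longlonglongrightarrow> x \<Longrightarrow> Y \<longlonglongrightarrow> y \<Longrightarrow> (\<lambda>n. f (X n) (Y n)) \<longlonglongrightarrow> f x y"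
  shows "f x y \<in> Qp"
proof -
  obtain X Y where X: "\<And>n. X n \<in> \<rat>" "X \<longlonglongrightarrow> x" and Y: "\<And>n. Y n \<in> \<rat>" "Y \<longlonglongrightarrow> y"
    using assms(1,2) unfolding Qp_def closure_sequential by blast
  then have "\<And>n. f (X n) (Y n) \<in> \<rat>" by (auto intro: rat)
  with lim[OF X(2) Y(2)] show ?thesis
    unfolding Qp_def closure_sequential by (intro exI[of _ "\<lambda>n. f (X n) (Y n)"]) auto
qed

lemma Qp_add: "x \<in> Qp \<Longrightarrow> y \<in> Qp \<Longrightarrow> x + y \<in> Qp"
  by (rule Qp_closed_binop) (auto intro: tendsto_add)

lemma Qp_diff: "x \<in> Qp \<Longrightarrow> y \<in> Qp \<Longrightarrow> x - y \<in> Qp"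
  by (rule Qp_closed_binop) (auto intro: tendsto_diff)

lemma Qp_mult: "x \<in> Qp \<Longrightarrow> y \<in> Qp \<Longrightarrow> x * y \<in> Qp"
  by (rule Qp_closed_binop) (auto intro: tendsto_mult)

lemma Qp_power: "x \<in> Qp \<Longrightarrow> x ^ n \<in> Qp"
  by (induction n) (auto intro: Qp_mult Qp_1)

lemma Qp_sum: "(\<And>i. i \<in> A \<Longrightarrow> f i \<in> Qp) \<Longrightarrow> sum f A \<in> Qp"
  by (induction A rule: infinite_finite_induct) (auto intro: Qp_add Qp_0)

lemma Qp_sums: "f sums l \<Longrightarrow> (\<And>n. f n \<in> Qp) \<Longrightarrow> l \<in> Qp"
  unfolding sums_def by (rule closed_sequentially[OF closed_Qp]) (auto intro: Qp_sum)

lemma Qp_approx: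
  assumes "x \<in> Qp" "0 < e"
  obtains q where "q \<in> \<rat>" "vabs (q - x) < e"
  using assms unfolding Qp_def closure_approachable by (auto simp: dist_vabs)

lemma Qp_inverse:
  assumes "x \<in> Qp"
  shows "inverse x \<in> Qp"
proof (cases "x = 0")
  case False
  show ?thesis unfolding Qp_def closure_approachable
  proof (intro allI impI)
    fix e :: real assume e: "0 < e"
    \<comment> \<open>Distance below |x| forces |q| = |x|, so q is nonzero; distance below e |x|^2
      then makes the inverses differ by less than e.\<close>
    obtain q where q: "q \<in> \<rat>" "vabs (q - x) < min (vabs x) (e * (vabs x * vabs x))"
      using Qp_approx[OF assms, of "min (vabs x) (e * (vabs x * vabs x))"] False e by auto
    then have eq: "vabs q = vabs x" by (intro vabs_eq_of_diff_less) auto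
    then have "q \<noteq> 0" using False by auto
    then have "inverse q - inverse x = - (q - x) / (q * x)"
      using False by (simp add: field_simps)
    then have "vabs (inverse q - inverse x) = vabs (q - x) / (vabs x * vabs x)"
      by (metis vabs_divide vabs_minus vabs_mult eq)
    also have "\<dots> < e" using q(2) False by (simp add: pos_divide_less_eq)
    finally show "\<exists>y\<in>\<rat>. dist y (inverse x) < e"
      using q(1) by (intro bexI[of _ "inverse q"]) (auto simp: dist_vabs)
  qed
qed (simp add: Qp_0)

lemma Qp_divide: "x \<in> Qp \<Longrightarrow> y \<in> Qp \<Longrightarrow> x / y \<in> Qp"
  by (simp add: divide_inverse Qp_mult Qp_inverse)

lemma Qp_poly_mult:
  assumes "\<And>i. coeff a i \<in> Qp" "\<And>i. coeff b i \<in> Qp"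
  shows "coeff (a * b) i \<in> Qp"
  unfolding coeff_mult by (intro Qp_sum Qp_mult assms)

lemma Qp_poly_prod:
  assumes "\<And>x i. x \<in> A \<Longrightarrow> coeff (f x) i \<in> Qp"
  shows "coeff (prod f A) i \<in> Qp"
  using assms
proof (induction A arbitrary: i rule: infinite_finite_induct)
  case (insert x A)
  have "coeff (f x * prod f A) i \<in> Qp" by (intro Qp_poly_mult insert.IH insert.prems) auto
  then show ?case using insert.hyps by simp
qed (auto simp: coeff_1 Qp_0 Qp_1)

lemma fps_of_poly_entire_Qp:
  assumes "\<And>i. coeff q i \<in> Qp"
  shows "fps_of_poly q \<in> entire_Qp"
  using assms by (auto simp: entire_Qp_def mem_fps_convergence_set_iff fps_conv_of_poly)

lemma linear_factor_Qp: "z \<in> Qp \<Longrightarrow> coeff [:1, - (1 / z):] i \<in> Qp"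
  using Qp_diff[OF Qp_0 Qp_divide[OF Qp_1]]
  by (auto simp: coeff_pCons Qp_0 Qp_1 split: nat.split)

section \<open>The ring of p-adic integers\<close>

lemma Zp_diff: "x \<in> Zp \<Longrightarrow> y \<in> Zp \<Longrightarrow> x - y \<in> Zp"
  by (auto simp: Zp_def intro: Qp_diff vabs_diff_le)

lemma Zp_mult: "x \<in> Zp \<Longrightarrow> y \<in> Zp \<Longrightarrow> x * y \<in> Zp"
  by (auto simp: Zp_def vabs_mult intro: Qp_mult mult_le_one)

lemma Zp_0: "0 \<in> Zp"
  by (simp add: Zp_def Qp_0)

lemma Zp_of_nat: "of_nat n \<in> Zp"
  by (simp add: Zp_def Qp_of_nat vabs_of_nat_le_1)

lemma Zp_power: "x \<in> Zp \<Longrightarrow> x ^ n \<in> Zp"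
  by (induction n) (use Zp_of_nat[of 1] in \<open>auto intro: Zp_mult\<close>)

lemma double_le_power: "2 * j \<le> (p::nat) ^ j" if "p \<ge> 2"
proof (induction j)
  case (Suc j)
  show ?case
  proof (cases j)
    case 0
    then show ?thesis using that by simp
  next
    case (Suc k)
    then have "2 * Suc j \<le> 2 * (2 * j)" by simp
    also have "\<dots> \<le> p * p ^ j" using that Suc.IH by (intro mult_mono) auto
    finally show ?thesis by simp
  qed
qed simp

text \<open>Fermat's little theorem by induction on n: in (n + 1)^p all inner binomial coefficients
  are divisible by p.\<close>

lemma prime_dvd_power_prime_diff:
  assumes p: "prime p"
  shows "int p dvd int n ^ p - int n"
proof (induction n)
  case 0
  then show ?case using prime_gt_0_nat[OF p] by (simp add: power_0_left)
next
  case (Suc n)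
  have "{..p} = insert 0 (insert p {0<..<p})" using prime_gt_0_nat[OF p] by auto
  then have "(int n + 1) ^ p = 1 + int n ^ p + (\<Sum>k\<in>{0<..<p}. int (p choose k) * int n ^ k)"
    using prime_gt_0_nat[OF p] unfolding binomial_ring by simp
  moreover have "int p dvd (\<Sum>k\<in>{0<..<p}. int (p choose k) * int n ^ k)"
    using dvd_choose_prime[OF _ _ _ p] by (intro dvd_sum dvd_mult2) auto
  ultimately have "int p dvd (int n + 1) ^ p - int n ^ p - 1" by simp
  from dvd_add[OF this Suc.IH] show ?case by (simp add: algebra_simps)
qed

locale padic_valued_field =
  fixes p :: nat and K :: "'c::complete_ultrametric_field itself"
  assumes prime: "prime p" and vabs_p: "vabs (of_nat p :: 'c) = 1 / real p"
begin

lemma p_ge_2: "p \<ge> 2"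
  using prime prime_ge_2_nat by blast

lemma p_pos: "real p > 0" "real p \<ge> 1" "real p > 1" "of_nat p \<noteq> (0::'c)"
  using p_ge_2 by auto

lemma vabs_p_power: "vabs (of_nat p ^ n :: 'c) = 1 / real p ^ n"
  by (simp add: vabs_power vabs_p power_divide)

section \<open>Integers, residues modulo p and Fermat congruences in the valued field\<close>

lemma vabs_of_int_dvd:
  assumes "int p dvd m"
  shows "vabs (of_int m :: 'c) \<le> 1 / real p"
proof -
  obtain k where "m = int p * k" using assms by blast
  then have "vabs (of_int m :: 'c) = 1 / real p * vabs (of_int k :: 'c)"
    by (simp add: vabs_mult vabs_p)
  also have "\<dots> \<le> 1 / real p" using vabs_of_int_le_1[of k, where 'a = 'c] p_pos by (simp add: divide_right_mono)
  finally show ?thesis .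
qed

text \<open>Bezout gives u p + v m = 1, so |m v| = |1 - u p| = 1; as |v| <= 1, this forces |m| >=
  1.\<close>

lemma vabs_of_int_not_dvd:
  assumes "\<not> int p dvd m"
  shows "vabs (of_int m :: 'c) = 1"
proof (rule antisym[OF vabs_of_int_le_1])
  have "coprime (int p) m" using assms prime by (simp add: prime_imp_coprime)
  then obtain u v where "u * int p + v * m = 1" using coprime_iff_gcd_eq_1 bezout_int by metis
  then have "of_int (u * int p + v * m) = (1::'c)" by simp
  then have one: "of_int m * of_int v = 1 - of_int (u * int p :: int) * (1::'c)"
    by (simp add: algebra_simps)
  have "vabs (of_int (u * int p) :: 'c) < vabs (1 :: 'c)"
    using vabs_of_int_dvd[of "u * int p"] p_pos by (auto intro: le_less_trans)
  then have "vabs (1 - of_int (u * int p) :: 'c) = 1"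
    using vabs_add_eq_left[of "- of_int (u * int p)" "1::'c"] by simp
  then have "1 = vabs (of_int m :: 'c) * vabs (of_int v :: 'c)"
    using one by (simp flip: vabs_mult)
  also have "\<dots> \<le> vabs (of_int m :: 'c)"
    using vabs_of_int_le_1[of v, where 'a = 'c] by (simp add: mult_left_le)
  finally show "1 \<le> vabs (of_int m :: 'c)" .
qed

text \<open>The residue field of \<open>Zp\<close> consists of classes of integers: y is close to a
  fraction a/b with b prime to p, and b is inverted modulo p by Bezout.\<close>

lemma Zp_approx:
  fixes y :: 'c
  assumes "y \<in> Zp"
  obtains m where "vabs (y - of_int m) \<le> 1 / real p"
proof -
  obtain q where q: "q \<in> \<rat>" "vabs (q - y) < 1 / real p"
    using Qp_approx[of y "1 / real p"] assms p_pos by (auto simp: Zp_def)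
  have "vabs (y + (q - y)) \<le> 1"
    using q(2) assms p_pos by (intro vabs_add_le) (auto simp: Zp_def intro: less_imp_le[OF less_le_trans])
  then have q1: "vabs q \<le> 1" by simp
  obtain r where r: "q = of_rat r" using q(1) by (auto elim: Rats_cases)
  obtain a b where ab: "r = Rat.Fract a b" "b > 0" "coprime a b" by (cases r) auto
  then have qab: "q = of_int a / of_int b" using r by (simp add: of_rat_rat)
  \<comment> \<open>Otherwise a is prime to p, the fraction being reduced, and |q| = 1/|b| >
    1.\<close>
  have b: "\<not> int p dvd b"
  proof
    assume pb: "int p dvd b"
    then have "\<not> int p dvd a"
      using ab(3) p_ge_2 coprime_common_divisor[of a b "int p"] by auto
    then have "vabs q = 1 / vabs (of_int b :: 'c)" by (simp add: qab vabs_divide vabs_of_int_not_dvd)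
    moreover have "0 < vabs (of_int b :: 'c)" "vabs (of_int b :: 'c) < 1"
      using ab(2) vabs_of_int_dvd[OF pb] p_pos by (auto intro: le_less_trans)
    ultimately show False using q1 by simp
  qed
  then have "coprime (int p) b" using prime by (simp add: prime_imp_coprime)
  then obtain v u where uv: "v * int p + u * b = 1" using coprime_iff_gcd_eq_1 bezout_int by metis
  have "of_int (v * int p + u * b) = (1::'c)" using uv by simp
  then have *: "of_int b * of_int u = 1 - of_int (v * int p :: int) * (1::'c)"
    by (simp add: algebra_simps)
  have "q - of_int (a * u) = of_int a * (1 - of_int b * of_int u) / of_int b"
    using ab(2) by (simp add: qab field_simps)
  also have "\<dots> = of_int (int p * (a * v)) / of_int b" by (simp add: * algebra_simps)
  finally have "vabs (q - of_int (a * u)) \<le> 1 / real p"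
    using vabs_of_int_dvd[of "int p * (a * v)"] by (simp add: vabs_divide vabs_of_int_not_dvd[OF b])
  then have "vabs ((q - of_int (a * u)) - (q - y)) \<le> 1 / real p"
    by (rule vabs_diff_le[OF _ less_imp_le[OF q(2)]])
  then show thesis by (intro that[of "a * u"]) simp
qed

lemma Zp_power_p_diff:
  fixes y :: 'c
  assumes "y \<in> Zp"
  shows "vabs (y ^ p - y) \<le> 1 / real p"
proof -
  obtain k where k: "vabs (y - of_int k) \<le> 1 / real p" using Zp_approx[OF assms] .
  \<comment> \<open>Fermat's theorem was proved for natural numbers, so the integer k is replaced by
    its residue.\<close>
  define n where "n = nat (k mod int p)"
  define m where "m = int n"
  have "m = k mod int p" using p_ge_2 by (simp add: m_def n_def)
  then have "int p dvd k - m" by simp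
  from vabs_add_le[OF k vabs_of_int_dvd[OF this]]
  have m: "vabs (y - of_int m) \<le> 1 / real p" by simp
  have y: "vabs y \<le> 1" using assms by (simp add: Zp_def)
  have "int p dvd m ^ p - m" unfolding m_def by (rule prime_dvd_power_prime_diff[OF prime])
  then have 1: "vabs (of_int m ^ p - of_int m :: 'c) \<le> 1 / real p"
    using vabs_of_int_dvd[of "m ^ p - m"] by simp
  have 2: "vabs (y ^ p - of_int m ^ p) \<le> 1 / real p"
    using vabs_diff_power_le(1)[OF y vabs_of_int_le_1, of p m] m by simp
  have "y ^ p - y = (y ^ p - of_int m ^ p) + ((of_int m ^ p - of_int m) - (y - of_int m))" by simp
  also have "vabs \<dots> \<le> 1 / real p" by (intro vabs_add_le[OF 2] vabs_diff_le[OF 1 m])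
  finally show ?thesis .
qed

text \<open>Each further p-th power gains a factor 1/p because both |p| and the difference itself
  are at most 1/p. These congruences cancel the denominators of the functional equation.\<close>

lemma Zp_power_p_power_diff:
  fixes y :: 'c
  assumes "y \<in> Zp"
  shows "vabs (y ^ (p ^ Suc j) - y ^ (p ^ j)) \<le> 1 / real p ^ Suc j"
proof (induction j)
  case 0
  then show ?case using Zp_power_p_diff[OF assms] by simp
next
  case (Suc j)
  let ?a = "y ^ (p ^ Suc j)" and ?b = "y ^ (p ^ j)"
  have "vabs y \<le> 1" using assms by (simp add: Zp_def)
  then have ab: "vabs ?a \<le> 1" "vabs ?b \<le> 1" by (simp_all add: vabs_power power_le_one)
  have "1 / real p ^ Suc j \<le> 1 / real p" using p_pos by (simp add: field_simps)
  then have m: "max (vabs (of_nat p :: 'c)) (vabs (?a - ?b)) \<le> 1 / real p"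
    using Suc.IH by (simp add: vabs_p)
  have "y ^ (p ^ Suc (Suc j)) = ?a ^ p" "y ^ (p ^ Suc j) = ?b ^ p"
    by (simp_all add: power_mult[symmetric] mult.commute)
  then have "vabs (y ^ (p ^ Suc (Suc j)) - y ^ (p ^ Suc j)) = vabs (?a ^ p - ?b ^ p)" by metis
  also have "\<dots> \<le> vabs (?a - ?b) * max (vabs (of_nat p :: 'c)) (vabs (?a - ?b))"
    by (rule vabs_diff_power_le(2)[OF ab])
  also have "\<dots> \<le> 1 / real p ^ Suc j * (1 / real p)"
    using Suc.IH m p_pos by (intro mult_mono) (auto simp: le_max_iff_disj)
  finally show ?case by (simp add: mult.commute)
qed

section \<open>Gauss norms and the functional equation of $\Psi$\<close>

definition \<Psi> :: "'c fps" where
  "\<Psi> = fps_of_int_coeffs (Psi p)"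

text \<open>This is p^(-j) \<Psi>(p^j T)^(p^j): the factors p^(j k) and p^(-j) combine to p^(j (k -
  1)). At k = 0, where truncated subtraction would matter, the coefficient of the power
  vanishes.\<close>

definition Psi_term :: "nat \<Rightarrow> 'c fps" where
  "Psi_term j = Abs_fps (\<lambda>k. of_nat p ^ (j * (k - 1)) * (\<Psi> ^ (p ^ j)) $ k)"

lemma Psi_nth_0: "\<Psi> $ 0 = 0" and Psi_nth_1: "\<Psi> $ 1 = 1"
  using is_Psi_Psi[OF p_ge_2] by (auto simp: \<Psi>_def is_Psi_def)

lemma Psi_power_nth_eq_0: "k < m \<Longrightarrow> (\<Psi> ^ m) $ k = 0"
  using startsby_zero_power_prefix[OF Psi_nth_0] by blast

lemma Psi_term_0: "Psi_term 0 = \<Psi>"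
  by (simp add: Psi_term_def fps_eq_iff)

lemma Psi_term_nth_eq_0: "k < p ^ j \<Longrightarrow> Psi_term j $ k = 0"
  by (simp add: Psi_term_def Psi_power_nth_eq_0)

lemma le_power_p: "j < p ^ j"
  using p_ge_2 by (meson less_exp power_mono order.strict_trans2 zero_le)

text \<open>The sum can stop at j = k since the term j starts in degree p^j > j.\<close>

lemma fps_X_eq_sum_Psi_term: "(fps_X :: 'c fps) $ k = (\<Sum>j\<le>k. Psi_term j $ k)"
proof (cases k)
  case 0
  then show ?thesis by (simp add: Psi_term_0 Psi_nth_0)
next
  case (Suc i)
  have rec: "\<forall>n\<ge>1. Psi p $ n = (if n = 1 then 1 else 0)
      - (\<Sum>j=1..n. int p ^ (j * (n - 1)) * (Psi p ^ (p ^ j)) $ n)"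
    using is_Psi_Psi[OF p_ge_2] unfolding is_Psi_iff[OF p_ge_2] by blast
  have "of_int (Psi p $ k) = (of_int ((if k = 1 then 1 else 0)
      - (\<Sum>j=1..k. int p ^ (j * (k - 1)) * (Psi p ^ (p ^ j)) $ k)) :: 'c)"
    using rec[rule_format, of k] Suc by simp
  also have "\<dots> = fps_X $ k - (\<Sum>j=1..k. Psi_term j $ k)"
    by (simp add: Psi_term_def \<Psi>_def fps_of_int_coeffs_power)
  finally have "fps_X $ k = Psi_term 0 $ k + (\<Sum>j=1..k. Psi_term j $ k)"
    by (simp add: Psi_term_0 \<Psi>_def)
  moreover have "{..k} = insert 0 {1..k}" by auto
  ultimately show ?thesis by simp
qed

lemma vabs_Psi_power_nth_le_1: "vabs ((\<Psi> ^ m) $ k) \<le> 1"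
  by (simp add: \<Psi>_def fps_of_int_coeffs_power vabs_of_int_le_1)

lemma vabs_Psi_nth_le_1: "vabs (\<Psi> $ k) \<le> 1"
  using vabs_Psi_power_nth_le_1[of 1 k] by simp

text \<open>Substituting p^j T turns the radius p^n into p^(n - j), and the division by p^j costs
  p^j: estimates at radius p^n reduce to powers of \<Psi> at smaller radii.\<close>

lemma Psi_term_norm:
  assumes "j \<le> n"
  shows "vabs (Psi_term j $ k) * (real p ^ n) ^ k
       = real p ^ j * (vabs ((\<Psi> ^ (p ^ j)) $ k) * (real p ^ (n - j)) ^ k)"
proof (cases k)
  case 0
  then have "(\<Psi> ^ (p ^ j)) $ k = 0" using p_pos by (intro Psi_power_nth_eq_0) simp
  then show ?thesis by (simp add: Psi_term_def)
next
  case (Suc i)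
  have n: "n = j + (n - j)" using assms by simp
  have "(real p ^ n) ^ k = real p ^ (j * i) * real p ^ j * (real p ^ (n - j)) ^ k"
    by (subst n) (simp add: Suc algebra_simps flip: power_add power_mult)
  then show ?thesis
    using p_pos by (simp add: Psi_term_def vabs_mult vabs_p_power Suc del: power_Suc)
qed

lemma gauss_le_Psi_term_low:
  assumes "j \<le> n" and "gauss_le (real p ^ (n - j)) C \<Psi>"
  shows "gauss_le (real p ^ n) (real p ^ j * C ^ (p ^ j)) (Psi_term j)"
  unfolding gauss_le_def Psi_term_norm[OF assms(1)]
  by (intro allI mult_left_mono gauss_leD gauss_le_power assms(2)) auto

text \<open>Only degrees k >= p^j >= 2 j occur. There j (k - 1) - n k >= k - j >= j because j > n,
  and this is the power of p gained.\<close>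

lemma gauss_le_Psi_term_high:
  assumes "n < j"
  shows "gauss_le (real p ^ n) (1 / real p ^ j) (Psi_term j)"
  unfolding gauss_le_def
proof
  fix k
  show "vabs (Psi_term j $ k) * (real p ^ n) ^ k \<le> 1 / real p ^ j"
  proof (cases "k < p ^ j")
    case False
    then have k: "p ^ j \<le> k" by simp
    then have k1: "k \<ge> 1" using p_pos by (metis One_nat_def Suc_leI le_trans of_nat_0_less_iff zero_less_power)
    have "j + j + n * k \<le> k + n * k" using double_le_power[OF p_ge_2, of j] k by simp
    also have "\<dots> = Suc n * k" by simp
    also have "\<dots> \<le> j * k" using assms by (intro mult_right_mono) auto
    also have "\<dots> = j * (k - 1) + j" using k1 by (cases k) auto
    finally have e: "j + n * k \<le> j * (k - 1)" by simp
    have "vabs (Psi_term j $ k) \<le> 1 / real p ^ (j * (k - 1))"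
      using vabs_Psi_power_nth_le_1 by (simp add: Psi_term_def vabs_mult vabs_p_power divide_right_mono)
    then have "vabs (Psi_term j $ k) * (real p ^ n) ^ k \<le> 1 / real p ^ (j * (k - 1)) * (real p ^ n) ^ k"
      by (intro mult_right_mono) auto
    also have "\<dots> \<le> 1 / real p ^ j"
    proof -
      have "real p ^ (j + n * k) \<le> real p ^ (j * (k - 1))" using e p_pos by (intro power_increasing) auto
      then show ?thesis using p_pos unfolding power_mult[symmetric] by (simp add: field_simps power_add)
    qed
    finally show ?thesis .
  qed (simp add: Psi_term_nth_eq_0)
qed

text \<open>\<open>psum n\<close> = (p^n - 1)/(p - 1) is the logarithm to base p of the Gauss norm
  of \<Psi> at radius p^n.\<close>

definition psum :: "nat \<Rightarrow> nat" where
  "psum n = (\<Sum>i<n. p ^ i)"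

lemma psum_add: "psum (n + j) = p ^ j * psum n + psum j"
  by (induction n) (auto simp: psum_def power_add algebra_simps)

lemma psum_ge: "n \<le> psum n"
  using sum_mono[of "{..<n}" "\<lambda>_. 1" "\<lambda>i. p ^ i"] p_pos by (simp add: psum_def Suc_le_eq)

text \<open>Term j has Gauss norm at most p^(p^j psum (n - j) + j), whereas by
  \<open>psum_add\<close> the norm sought is p^(p^j psum (n - j) + psum j). As
  \<open>psum 1 = 1\<close>, the term j = 1 can reach it, and all j >= 2 stay strictly
  below.\<close>

lemma psum_gt: "2 \<le> n \<Longrightarrow> n < psum n"
proof -
  assume "2 \<le> n"
  then obtain m where n: "n = m + 2" by (metis add.commute le_Suc_ex)
  have "psum n = p\<^sup>2 * psum m + (p + 1)" unfolding n psum_add by (simp add: psum_def numeral_2_eq_2)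
  moreover have "1 * psum m \<le> p\<^sup>2 * psum m" using p_ge_2 by (intro mult_right_mono) auto
  ultimately show "n < psum n" using psum_ge[of m] p_ge_2 n by linarith
qed

text \<open>
  In \<open>\<Psi>(T) = T - \<Sum>j\<ge>1. p^-j \<Psi>(p^j T)^(p^j)\<close> the term \<open>j = 1\<close> dominates on the disc of radius \<open>p^n\<close>
  when \<open>n \<ge> 1\<close>, so that the Weierstrass degree is multiplied by \<open>p\<close> from \<open>n - 1\<close> to \<open>n\<close>.
\<close>

lemma last_dominant_Psi_aux:
  "last_dominant (real p ^ n) (p ^ n) \<Psi> \<and> vabs (\<Psi> $ (p ^ n)) * (real p ^ n) ^ (p ^ n) = real p ^ psum n"
proof (induction n rule: less_induct)
  case (less n)
  show ?case
  proof (cases n)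
    case 0
    have "vabs (\<Psi> $ k) < 1" if "k > 1" for k
    proof -
      have "(\<Sum>j\<le>k. Psi_term j $ k) = \<Psi> $ k + (\<Sum>j=1..k. Psi_term j $ k)"
      proof -
        have "{..k} = insert 0 {1..k}" by auto
        then show ?thesis by (simp add: Psi_term_0)
      qed
      then have "\<Psi> $ k = - (\<Sum>j=1..k. Psi_term j $ k)"
        using fps_X_eq_sum_Psi_term[of k] that by (simp add: eq_neg_iff_add_eq_0)
      moreover have "vabs (\<Sum>j=1..k. Psi_term j $ k) < 1"
      proof (rule vabs_sum_less)
        fix j assume "j \<in> {1..k}"
        then have "vabs (Psi_term j $ k) \<le> 1 / real p ^ j" "1 / real p ^ j < 1"
          using gauss_leD[OF gauss_le_Psi_term_high[of 0 j], of k] p_pos by (auto simp: one_less_power)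
        then show "vabs (Psi_term j $ k) < 1" by linarith
      qed simp
      ultimately show ?thesis by simp
    qed
    then show ?thesis using 0 vabs_Psi_nth_le_1 Psi_nth_1
      by (simp add: last_dominant_def gauss_le_def psum_def)
  next
    case (Suc m)
    let ?r = "real p ^ n" and ?C = "real p ^ psum n"
    have r: "0 < ?r" using p_pos by simp
    have IH: "gauss_le (real p ^ i) (real p ^ psum i) \<Psi>" if "i < n" for i
      using less.IH[OF that] by (auto simp: last_dominant_def)
    have m: "last_dominant (real p ^ m) (p ^ m) \<Psi>"
        "vabs (\<Psi> $ (p ^ m)) * (real p ^ m) ^ (p ^ m) = real p ^ psum m"
      using less.IH[of m] Suc by auto
    have norm1: "vabs (Psi_term 1 $ k) * ?r ^ k = real p * (vabs ((\<Psi> ^ p) $ k) * (real p ^ m) ^ k)" for k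
      using Psi_term_norm[of 1 n k] Suc by simp
    have pn: "p * p ^ m = p ^ n" using Suc by simp
    have psn: "psum n = p * psum m + 1" using psum_add[of m 1] Suc by (simp add: psum_def)
    have pw: "last_dominant (real p ^ m) (p ^ n) (\<Psi> ^ p)"
        "vabs ((\<Psi> ^ p) $ (p ^ n)) * (real p ^ m) ^ (p ^ n) = (real p ^ psum m) ^ p"
      using last_dominant_power[OF m(1), of p] p_pos unfolding m(2) pn by auto
    have top: "vabs (Psi_term 1 $ (p ^ n)) * ?r ^ (p ^ n) = ?C"
      unfolding norm1 pw(2) psn by (simp add: mult.commute flip: power_mult)
    have dom1: "last_dominant ?r (p ^ n) (Psi_term 1)"
      using pw(1) p_pos unfolding last_dominant_def gauss_le_def norm1 by simp
    \<comment> \<open>The functional equation identifies R with X minus the terms j >= 2, and those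
      terms are all strictly below the bound.\<close>
    define R where "R = \<Psi> + Psi_term 1"
    have Rk: "R $ k = fps_X $ k - (\<Sum>j=2..k. Psi_term j $ k)" for k
    proof (cases "k = 0")
      case True
      have "Psi_term 1 $ 0 = 0" using p_pos by (intro Psi_term_nth_eq_0) auto
      then show ?thesis using True by (simp add: R_def Psi_nth_0)
    next
      case False
      then have "{..k} = insert 0 (insert 1 {2..k})" by auto
      then show ?thesis using fps_X_eq_sum_Psi_term[of k] by (simp add: R_def Psi_term_0 algebra_simps)
    qed
    have term_less: "vabs (Psi_term j $ k) * ?r ^ k < ?C" if "2 \<le> j" for j k
    proof (cases "j \<le> n")
      case True
      have "vabs (Psi_term j $ k) * ?r ^ k \<le> real p ^ j * (real p ^ psum (n - j)) ^ (p ^ j)"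
        using True that by (intro gauss_leD gauss_le_Psi_term_low IH) auto
      also have "\<dots> = real p ^ (p ^ j * psum (n - j) + j)"
        by (simp add: power_add mult.commute flip: power_mult)
      also have "\<dots> < real p ^ (p ^ j * psum (n - j) + psum j)"
        using psum_gt[OF that] p_pos by (intro power_strict_increasing) auto
      also have "\<dots> = ?C" using psum_add[of "n - j" j] True by simp
      finally show ?thesis .
    next
      case False
      then have "vabs (Psi_term j $ k) * ?r ^ k \<le> 1 / real p ^ j"
        using gauss_leD[OF gauss_le_Psi_term_high] by simp
      also have "\<dots> < 1" using that p_pos by (simp add: one_less_power)
      also have "1 \<le> ?C" using p_pos by (intro one_le_power) auto
      finally show ?thesis .
    qed
    have sum_small: "vabs (\<Sum>j=2..k. Psi_term j $ k) < ?C / ?r ^ k" for k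
      using term_less r p_pos by (intro vabs_sum_less) (auto simp: pos_less_divide_eq)
    have R_small: "vabs (R $ k) * ?r ^ k < ?C" if "k \<ge> p ^ n" for k
    proof -
      have "p ^ 1 \<le> p ^ n" using Suc p_pos by (intro power_increasing) auto
      then have "k > 1" using that p_ge_2 by simp
      then have "vabs (R $ k) < ?C / ?r ^ k" using sum_small[of k] by (simp add: Rk)
      then show ?thesis using r by (simp add: pos_less_divide_eq)
    qed
    have "vabs (R $ k) * ?r ^ k \<le> ?C" for k
    proof -
      \<comment> \<open>For n = 1 the coefficient of X attains the bound. This happens in degree 1 <
        p^n, where a weak inequality is enough.\<close>
      have "vabs ((fps_X :: 'c fps) $ k) \<le> ?C / ?r ^ k"
        using p_pos psum_ge[of n] by (simp add: fps_X_def pos_le_divide_eq power_increasing)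
      then have "vabs (R $ k) \<le> ?C / ?r ^ k" unfolding Rk
        using sum_small[of k] by (intro vabs_diff_le) auto
      then show ?thesis using r by (simp add: pos_le_divide_eq)
    qed
    then have "gauss_le ?r ?C R" by (simp add: gauss_le_def)
    with R_small have "last_dominant ?r (p ^ n) (R - Psi_term 1)"
        "vabs ((R - Psi_term 1) $ (p ^ n)) = vabs (Psi_term 1 $ (p ^ n))"
      by (intro last_dominant_diff[OF dom1 r]; simp only: top)+
    moreover have "R - Psi_term 1 = \<Psi>" by (simp add: R_def)
    ultimately show ?thesis using top by (simp only:)
  qed
qed

lemma last_dominant_Psi: "last_dominant (real p ^ n) (p ^ n) \<Psi>"
  using last_dominant_Psi_aux by blast

lemma gauss_le_Psi: "gauss_le (real p ^ n) (real p ^ psum n) \<Psi>"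
  using last_dominant_Psi_aux[of n] by (auto simp: last_dominant_def)

section \<open>\<Psi> as an entire function, and its functional equation at points\<close>

lemma obtain_power_p_gt:
  obtains n where "(x::real) < real p ^ n"
  using real_arch_pow[OF p_pos(3)] by blast

text \<open>A Gauss bound at some larger radius p^n makes the terms at radius r decay
  geometrically.\<close>

lemma fps_conv_Psi:
  assumes "0 \<le> r"
  shows "fps_conv r \<Psi>"
proof -
  obtain n where n: "r < real p ^ n" by (rule obtain_power_p_gt)
  let ?q = "r / real p ^ n"
  have q: "0 \<le> ?q" "?q < 1" using assms n p_pos by auto
  show ?thesis unfolding fps_conv_def
  proof (rule Lim_null_comparison[OF always_eventually])
    show "(\<lambda>k. real p ^ psum n * ?q ^ k) \<longlonglongrightarrow> 0"
      using tendsto_mult[OF tendsto_const[of "real p ^ psum n"] LIMSEQ_power_zero[of ?q]] q by simp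
    show "\<forall>k. norm (vabs (\<Psi> $ k) * r ^ k) \<le> real p ^ psum n * ?q ^ k"
    proof
      fix k
      have "vabs (\<Psi> $ k) * r ^ k = vabs (\<Psi> $ k) * (real p ^ n) ^ k * ?q ^ k"
        using p_pos by (simp add: power_divide)
      also have "\<dots> \<le> real p ^ psum n * ?q ^ k"
        using q by (intro mult_right_mono gauss_leD[OF gauss_le_Psi]) auto
      finally show "norm (vabs (\<Psi> $ k) * r ^ k) \<le> real p ^ psum n * ?q ^ k"
        using assms by simp
    qed
  qed
qed

abbreviation psi :: "'c \<Rightarrow> 'c" where
  "psi \<equiv> fps_value \<Psi>"

lemma Psi_term_sums:
  "(\<lambda>k. Psi_term j $ k * x ^ k) sums (psi (of_nat p ^ j * x) ^ (p ^ j) / of_nat p ^ j)"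
proof -
  let ?y = "of_nat p ^ j * x"
  have "fps_conv (vabs ?y) (\<Psi> ^ (p ^ j))" by (intro fps_conv_power fps_conv_Psi) auto
  then have "(\<lambda>k. (\<Psi> ^ (p ^ j)) $ k * ?y ^ k) sums (psi ?y ^ (p ^ j))"
    using fps_value_sums fps_value_power[OF fps_conv_Psi] by (metis vabs_nonneg)
  from sums_mult_ultrametric[OF this, of "1 / of_nat p ^ j"]
  have "(\<lambda>k. 1 / of_nat p ^ j * ((\<Psi> ^ (p ^ j)) $ k * ?y ^ k)) sums (psi ?y ^ (p ^ j) / of_nat p ^ j)"
    by simp
  moreover have "1 / of_nat p ^ j * ((\<Psi> ^ (p ^ j)) $ k * ?y ^ k) = Psi_term j $ k * x ^ k" for k
  proof (cases k)
    case 0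
    then have "(\<Psi> ^ (p ^ j)) $ k = 0" using p_pos by (intro Psi_power_nth_eq_0) simp
    then show ?thesis by (simp add: Psi_term_def)
  next
    case (Suc i)
    have "(of_nat p ^ j * x) ^ k = of_nat p ^ j * (of_nat p ^ (j * i) * x ^ k)"
      by (simp add: Suc power_mult_distrib power_mult[symmetric] mult_ac power_add)
    then show ?thesis using p_pos by (simp add: Psi_term_def Suc del: power_Suc)
  qed
  ultimately show ?thesis by simp
qed

lemma fps_conv_Psi_term:
  fixes x :: 'c
  shows "fps_conv (vabs x) (Psi_term j)"
  using Psi_term_sums[of j x] sums_summable
  by (auto simp: mem_fps_convergence_set_iff[symmetric] fps_convergence_set_def)

lemma fps_value_Psi_term: "fps_value (Psi_term j) x = psi (of_nat p ^ j * x) ^ (p ^ j) / of_nat p ^ j"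
  by (rule fps_value_eqI[OF Psi_term_sums])

text \<open>The formal remainder after N terms has coefficients built from the terms j >= N alone,
  so its Gauss norm at radius p^n with n < N is at most p^-N. This passes from the formal identity
  to values without exchanging infinite sums.\<close>

lemma Psi_functional_equation:
  "(\<lambda>j. psi (of_nat p ^ j * x) ^ (p ^ j) / of_nat p ^ j) sums x"
proof -
  define D where "D = (\<lambda>N. fps_X - (\<Sum>j<N. Psi_term j))"
  have D: "fps_conv (vabs x) (D N) \<and>
      fps_value (D N) x = x - (\<Sum>j<N. psi (of_nat p ^ j * x) ^ (p ^ j) / of_nat p ^ j)" for N
  proof (induction N)
    case 0
    then show ?case by (simp add: D_def fps_conv_fps_X fps_value_fps_X)
  next
    case (Suc N)
    have "D (Suc N) = D N - Psi_term N" by (simp add: D_def diff_diff_eq)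
    then show ?case using Suc.IH
      by (simp add: fps_conv_diff fps_value_diff fps_conv_Psi_term fps_value_Psi_term)
  qed
  obtain n where n: "vabs x < real p ^ n" by (rule obtain_power_p_gt)
  have le: "vabs (fps_value (D N) x) \<le> 1 / real p ^ N" if N: "N > n" for N
  proof (rule vabs_fps_value_le)
    show "fps_conv (vabs x) (D N)" using D by blast
    show "gauss_le (vabs x) (1 / real p ^ N) (D N)" unfolding gauss_le_def
    proof
      fix k
      have "D N $ k = (\<Sum>j\<le>k. Psi_term j $ k) - (\<Sum>j<N. Psi_term j $ k)"
        unfolding D_def fps_sub_nth fps_sum_nth fps_X_eq_sum_Psi_term ..
      also have "(\<Sum>j<N. Psi_term j $ k) = (\<Sum>j\<in>{..<N} \<inter> {..k}. Psi_term j $ k)"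
        by (intro sum.mono_neutral_right)
          (auto intro!: Psi_term_nth_eq_0 intro: less_trans[OF _ le_power_p])
      also have "(\<Sum>j\<le>k. Psi_term j $ k) - \<dots> = (\<Sum>j\<in>{..k} - {..<N} \<inter> {..k}. Psi_term j $ k)"
        by (rule sum_diff[symmetric]) auto
      finally have Dk: "D N $ k = (\<Sum>j\<in>{..k} - {..<N} \<inter> {..k}. Psi_term j $ k)" .
      have pk: "0 < (real p ^ n) ^ k" using p_pos by simp
      have "vabs (D N $ k) \<le> 1 / real p ^ N / (real p ^ n) ^ k"
        unfolding Dk
      proof (rule vabs_sum_le)
        fix j assume "j \<in> {..k} - {..<N} \<inter> {..k}"
        then have j: "N \<le> j" by auto
        have "vabs (Psi_term j $ k) * (real p ^ n) ^ k \<le> 1 / real p ^ j"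
          using j N by (intro gauss_leD[OF gauss_le_Psi_term_high]) auto
        also have "\<dots> \<le> 1 / real p ^ N"
          using j p_pos by (intro divide_left_mono power_increasing) auto
        finally show "vabs (Psi_term j $ k) \<le> 1 / real p ^ N / (real p ^ n) ^ k"
          by (simp only: pos_le_divide_eq[OF pk])
      qed (use p_pos in simp)
      then have "vabs (D N $ k) * (real p ^ n) ^ k \<le> 1 / real p ^ N"
        by (simp only: pos_le_divide_eq[OF pk])
      moreover have "vabs (D N $ k) * vabs x ^ k \<le> vabs (D N $ k) * (real p ^ n) ^ k"
        using n by (intro mult_left_mono power_mono) auto
      ultimately show "vabs (D N $ k) * vabs x ^ k \<le> 1 / real p ^ N" by linarith
    qed
  qed
  have "(\<lambda>N. fps_value (D N) x) \<longlonglongrightarrow> 0"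
    unfolding tendsto_0_iff_vabs
  proof (rule Lim_null_comparison)
    show "(\<lambda>N. (1 / real p) ^ N) \<longlonglongrightarrow> 0" using p_pos by (intro LIMSEQ_power_zero) simp
    show "\<forall>\<^sub>F N in sequentially. norm (vabs (fps_value (D N) x)) \<le> (1 / real p) ^ N"
      using eventually_gt_at_top[of n] by eventually_elim (simp add: le power_divide)
  qed
  from tendsto_diff[OF tendsto_const[of x] this] show ?thesis
    using D by (simp add: sums_def)
qed

section \<open>The zeros of $\Psi$\<close>

lemma psi_Qp:
  assumes "x \<in> Qp"
  shows "psi x \<in> Qp"
proof (rule Qp_sums[OF fps_value_sums])
  show "\<Psi> $ k * x ^ k \<in> Qp" for k
    using assms by (auto simp: \<Psi>_def intro: Qp_mult Qp_of_int Qp_power)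
qed (simp add: fps_conv_Psi)

lemma vabs_p_power_mult: "vabs (of_nat p ^ j * x) = vabs (x::'c) / real p ^ j"
  by (simp add: vabs_mult vabs_p_power)

lemma vabs_p_power_mult_le:
  assumes "vabs (x::'c) \<le> real p ^ Suc n"
  shows "vabs (of_nat p ^ Suc j * x) \<le> real p ^ n"
proof -
  have "real p ^ Suc n \<le> real p ^ n * real p ^ Suc j"
    using p_pos unfolding power_add[symmetric] by (intro power_increasing) auto
  with assms have "vabs x \<le> real p ^ n * real p ^ Suc j" by linarith
  moreover have "0 < real p ^ Suc j" using p_pos by simp
  ultimately show ?thesis unfolding vabs_p_power_mult by (simp only: pos_divide_le_eq)
qed

text \<open>
  Dividing the functional equation at \<open>p x\<close> by \<open>p\<close> gives a second expansion of \<open>x\<close>; subtracting it from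
  the one at \<open>x\<close> leaves \<open>\<Psi>(x)\<close> as a sum of terms that are integral by Fermat's little theorem.
\<close>

lemma vabs_psi_le_1:
  assumes "x \<in> Qp"
  shows "vabs (psi x) \<le> 1"
proof -
  have "\<forall>x\<in>Qp. vabs x \<le> real p ^ n \<longrightarrow> vabs (psi x) \<le> 1" for n
  proof (induction n)
    case 0
    show ?case
    proof (intro ballI impI vabs_fps_value_le)
      fix x :: 'c assume x: "vabs x \<le> real p ^ 0"
      show "fps_conv (vabs x) \<Psi>" by (simp add: fps_conv_Psi)
      show "gauss_le (vabs x) 1 \<Psi>" unfolding gauss_le_def
        using x vabs_Psi_nth_le_1 by (simp add: mult_le_one power_le_one)
    qed
  next
    case (Suc n)
    show ?case
    proof (intro ballI impI)
      fix x :: 'c assume x: "x \<in> Qp" "vabs x \<le> real p ^ Suc n"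
      define y where "y = (\<lambda>j. psi (of_nat p ^ Suc j * x))"
      have y: "y j \<in> Zp" for j
      proof -
        have "vabs (of_nat p ^ Suc j * x) \<le> real p ^ n" by (rule vabs_p_power_mult_le[OF x(2)])
        moreover have px: "of_nat p ^ Suc j * x \<in> Qp" by (intro Qp_mult Qp_power Qp_of_nat x(1))
        ultimately show ?thesis using Suc.IH psi_Qp[OF px] by (simp only: y_def Zp_def mem_Collect_eq)
      qed
      have 1: "(\<lambda>j. y j ^ (p ^ Suc j) / of_nat p ^ Suc j) sums (x - psi x)"
        using sums_Suc_shift[OF Psi_functional_equation[of x]] by (simp add: y_def)
      have 2: "(\<lambda>j. y j ^ (p ^ j) / of_nat p ^ Suc j) sums x"
        using sums_mult_ultrametric[OF Psi_functional_equation[of "of_nat p * x"], of "1 / of_nat p"] p_pos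
        by (simp add: y_def field_simps)
      have "vabs ((x - psi x) - x) \<le> 1"
      proof (rule vabs_sums_le[OF sums_diff_ultrametric[OF 1 2]])
        fix j
        have "vabs (y j ^ (p ^ Suc j) / of_nat p ^ Suc j - y j ^ (p ^ j) / of_nat p ^ Suc j)
            = vabs (y j ^ (p ^ Suc j) - y j ^ (p ^ j)) / (1 / real p ^ Suc j)"
          unfolding diff_divide_distrib[symmetric] vabs_divide vabs_p_power ..
        also have "\<dots> \<le> 1 / real p ^ Suc j / (1 / real p ^ Suc j)"
          using p_pos by (intro divide_right_mono Zp_power_p_power_diff y) simp
        also have "\<dots> = 1" using p_pos by simp
        finally show "vabs (y j ^ (p ^ Suc j) / of_nat p ^ Suc j - y j ^ (p ^ j) / of_nat p ^ Suc j) \<le> 1" .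
      qed
      then show "vabs (psi x) \<le> 1" by simp
    qed
  qed
  moreover obtain n where "vabs x < real p ^ n" by (rule obtain_power_p_gt)
  ultimately show ?thesis using assms by (meson less_imp_le)
qed

text \<open>The Gauss norm p at radius p gives |\<Psi>_k| <= p^(1 - k). Hence the monomials of
  degree k >= 2 have Lipschitz constants at most (\<rho>/p)^(k - 1) <= \<rho>/p, and the monomial T
  cancels against u - v.\<close>

lemma psi_lipschitz_unit_disc:
  assumes \<rho>: "1 \<le> \<rho>" "\<rho> < real p" and uv: "vabs u \<le> \<rho>" "vabs v \<le> \<rho>"
  shows "vabs (psi u - psi v - (u - v)) \<le> \<rho> / real p * vabs (u - v)"
proof -
  define h where "h = \<Psi> - fps_X"
  have conv: "fps_conv (vabs x) h" for x :: 'c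
    by (simp add: h_def fps_conv_diff fps_conv_Psi fps_conv_fps_X)
  have val: "fps_value h x = psi x - x" for x
    by (simp add: h_def fps_value_diff fps_conv_Psi fps_conv_fps_X fps_value_fps_X)
  have "(\<lambda>k. h $ k * u ^ k - h $ k * v ^ k) sums (fps_value h u - fps_value h v)"
    by (intro sums_diff_ultrametric fps_value_sums conv)
  then have "vabs (fps_value h u - fps_value h v) \<le> \<rho> / real p * vabs (u - v)"
  proof (rule vabs_sums_le)
    fix k
    show "vabs (h $ k * u ^ k - h $ k * v ^ k) \<le> \<rho> / real p * vabs (u - v)"
    proof (cases "k < 2")
      case True
      then have "k = 0 \<or> k = 1" by auto
      then show ?thesis using \<rho> Psi_nth_0 Psi_nth_1 by (auto simp: h_def)
    next
      case False
      then obtain i where k: "k = Suc (Suc i)" by (metis less_2_cases_iff not0_implies_Suc One_nat_def)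
      have "vabs (\<Psi> $ k) * real p ^ k \<le> real p"
        using gauss_leD[OF gauss_le_Psi[of 1], of k] by (simp add: psum_def)
      then have hk: "vabs (h $ k) \<le> 1 / real p ^ Suc i"
        using p_pos by (simp add: h_def k field_simps)
      have "h $ k * u ^ k - h $ k * v ^ k = h $ k * (u ^ Suc (Suc i) - v ^ Suc (Suc i))"
        by (simp add: k algebra_simps)
      also have "vabs \<dots> \<le> 1 / real p ^ Suc i * (vabs (u - v) * \<rho> ^ Suc i)"
        unfolding vabs_mult using hk p_pos
        by (intro mult_mono vabs_diff_power_le_radius uv) auto
      also have "\<dots> = (\<rho> / real p) ^ Suc i * vabs (u - v)"
        by (simp add: power_divide)
      also have "\<dots> \<le> \<rho> / real p * vabs (u - v)"
        using \<rho> power_decreasing[of 1 "Suc i" "\<rho> / real p"] by (intro mult_right_mono) auto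
      finally show ?thesis .
    qed
  qed
  then show ?thesis by (simp add: val algebra_simps)
qed

text \<open>Induction on the size of the centre: p^(j+1) c is smaller, so \<Psi>(p^(j+1) x) is
  integral and 1-Lipschitz in p^(j+1) x. Its power of exponent p^(j+1) then gains the factor
  \<rho>/p, while |p^(j+1)| from the scaling of u - v cancels the denominator.\<close>

lemma psi_lipschitz:
  assumes \<rho>: "1 \<le> \<rho>" "\<rho> < real p" and "c \<in> Qp" and "vabs (u - c) \<le> \<rho>" "vabs (v - c) \<le> \<rho>"
  shows "vabs (psi u - psi v - (u - v)) \<le> \<rho> / real p * vabs (u - v)"
proof -
  have "\<forall>c u v. c \<in> Qp \<longrightarrow> vabs c \<le> real p ^ n \<longrightarrow> vabs (u - c) \<le> \<rho> \<longrightarrow> vabs (v - c) \<le> \<rho> \<longrightarrow>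
      vabs (psi u - psi v - (u - v)) \<le> \<rho> / real p * vabs (u - v)" for n
  proof (induction n)
    case 0
    show ?case
    proof (intro allI impI psi_lipschitz_unit_disc[OF \<rho>])
      fix c u v :: 'c
      assume "vabs c \<le> real p ^ 0" "vabs (u - c) \<le> \<rho>" "vabs (v - c) \<le> \<rho>"
      then show "vabs u \<le> \<rho>" "vabs v \<le> \<rho>"
        using \<rho> vabs_add_le[of "u - c" \<rho> c] vabs_add_le[of "v - c" \<rho> c] by auto
    qed
  next
    case (Suc n)
    show ?case
    proof (intro allI impI)
      fix c u v :: 'c
      assume c: "c \<in> Qp" "vabs c \<le> real p ^ Suc n"
        and u: "vabs (u - c) \<le> \<rho>" and v: "vabs (v - c) \<le> \<rho>"
      define a where "a = (\<lambda>x j. psi (of_nat p ^ Suc j * x) ^ (p ^ Suc j) / of_nat p ^ Suc j)"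
      have a: "a x sums (x - psi x)" for x
        using sums_Suc_shift[OF Psi_functional_equation[of x]] by (simp add: a_def)
      have uv: "vabs (u - v) \<le> \<rho>" using vabs_diff_le[OF u v] by simp
      have "vabs ((u - psi u) - (v - psi v)) \<le> \<rho> / real p * vabs (u - v)"
      proof (rule vabs_sums_le[OF sums_diff_ultrametric[OF a a]])
        fix j
        let ?q = "of_nat p ^ Suc j :: 'c" and ?P = "real p ^ Suc j"
        have P: "real p \<le> ?P" "0 < ?P" using p_pos by auto
        have C: "?q * c \<in> Qp" "vabs (?q * c) \<le> real p ^ n"
          using Qp_mult[OF Qp_power[OF Qp_of_nat] c(1)] vabs_p_power_mult_le[OF c(2)] .
        have scale: "vabs (?q * x - ?q * y) = vabs (x - y) / ?P" for x y :: 'c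
          unfolding right_diff_distrib[symmetric] vabs_p_power_mult ..
        have small: "vabs (?q * x - ?q * c) \<le> 1" if "vabs (x - c) \<le> \<rho>" for x
        proof -
          have "vabs (x - c) \<le> ?P" using that \<rho> P(1) by linarith
          then show ?thesis unfolding scale using P(2) by (simp only: divide_le_eq_1_pos)
        qed
        have lip: "vabs (psi (?q * x) - psi (?q * y)) \<le> vabs (?q * x - ?q * y)"
          if "vabs (x - c) \<le> \<rho>" "vabs (y - c) \<le> \<rho>" for x y
        proof -
          have "vabs (?q * x - ?q * c) \<le> \<rho>" "vabs (?q * y - ?q * c) \<le> \<rho>"
            using small[OF that(1)] small[OF that(2)] \<rho> by auto
          then have "vabs (psi (?q * x) - psi (?q * y) - (?q * x - ?q * y))
              \<le> \<rho> / real p * vabs (?q * x - ?q * y)"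
            using Suc.IH C by blast
          also have "\<dots> \<le> 1 * vabs (?q * x - ?q * y)" using \<rho> by (intro mult_right_mono) auto
          finally have "vabs ((psi (?q * x) - psi (?q * y) - (?q * x - ?q * y)) + (?q * x - ?q * y))
              \<le> vabs (?q * x - ?q * y)"
            by (intro vabs_add_le) auto
          then show ?thesis by simp
        qed
        \<comment> \<open>At the centre the bound is integrality on the p-adic numbers; the
          Lipschitz estimate carries it to the whole disc, which the scaling has shrunk to radius at
          most 1.\<close>
        have bound: "vabs (psi (?q * x)) \<le> 1" if "vabs (x - c) \<le> \<rho>" for x
        proof -
          have "vabs (psi (?q * x) - psi (?q * c)) \<le> 1"
            using lip[of x c] small[of x] that \<rho> by fastforce
          from vabs_add_le[OF this vabs_psi_le_1[OF C(1)]] show ?thesis by simp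
        qed
        let ?A = "psi (?q * u)" and ?B = "psi (?q * v)"
        have AB: "vabs (?A - ?B) \<le> vabs (u - v) / ?P" using lip[OF u v] unfolding scale .
        have "vabs (u - v) / ?P \<le> \<rho> / real p"
          using uv \<rho> P p_pos by (intro frac_le) auto
        then have m: "max (vabs (of_nat (p ^ Suc j) :: 'c)) (vabs (?A - ?B)) \<le> \<rho> / real p"
        proof (intro max.boundedI)
          show "vabs (of_nat (p ^ Suc j) :: 'c) \<le> \<rho> / real p"
            using \<rho> P p_pos unfolding of_nat_power vabs_p_power by (intro frac_le) auto
        qed (use AB in linarith)
        have "a u j - a v j = (?A ^ (p ^ Suc j) - ?B ^ (p ^ Suc j)) / ?q"
          unfolding a_def diff_divide_distrib ..
        then have "vabs (a u j - a v j) = vabs (?A ^ (p ^ Suc j) - ?B ^ (p ^ Suc j)) * ?P"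
          unfolding vabs_divide vabs_p_power by (simp add: vabs_divide vabs_p_power del: power_Suc)
        also have "\<dots> \<le> (vabs (?A - ?B) * max (vabs (of_nat (p ^ Suc j) :: 'c)) (vabs (?A - ?B))) * ?P"
          using P by (intro mult_right_mono vabs_diff_power_le(2) bound u v) auto
        also have "\<dots> \<le> (vabs (u - v) / ?P * (\<rho> / real p)) * ?P"
          using P AB m by (intro mult_right_mono mult_mono) (auto simp: le_max_iff_disj)
        also have "\<dots> = \<rho> / real p * vabs (u - v)" using P by simp
        finally show "vabs (a u j - a v j) \<le> \<rho> / real p * vabs (u - v)" .
      qed
      then show "vabs (psi u - psi v - (u - v)) \<le> \<rho> / real p * vabs (u - v)"
        using vabs_minus_commute[of "psi u - psi v" "u - v"] by (simp add: algebra_simps)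
    qed
  qed
  moreover obtain n where "vabs c < real p ^ n" by (rule obtain_power_p_gt)
  ultimately show ?thesis using assms(3-5) by (meson less_imp_le)
qed

lemma psi_inj_on_disc:
  assumes "c \<in> Qp" "vabs (u - c) < real p" "vabs (v - c) < real p" "psi u = psi v"
  shows "u = v"
proof (rule ccontr)
  assume "u \<noteq> v"
  \<comment> \<open>The ratio \<rho>/p approaches 1 on the open disc, but two given points lie in a
    closed disc of radius \<rho> < p. The 1 is the lower limit for \<rho> in
    \<open>psi_lipschitz\<close>.\<close>
  define \<rho> where "\<rho> = max 1 (max (vabs (u - c)) (vabs (v - c)))"
  have \<rho>: "1 \<le> \<rho>" "\<rho> < real p" using assms p_pos by (auto simp: \<rho>_def)
  have "vabs (u - c) \<le> \<rho>" "vabs (v - c) \<le> \<rho>" by (auto simp: \<rho>_def)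
  from psi_lipschitz[OF \<rho> assms(1) this]
  have "vabs (u - v) \<le> \<rho> / real p * vabs (u - v)"
    using assms(4) vabs_minus_commute[of u v] by simp
  moreover have "\<rho> / real p * vabs (u - v) < 1 * vabs (u - v)"
    using \<rho> \<open>u \<noteq> v\<close> by (intro mult_strict_right_mono) auto
  ultimately show False by simp
qed

text \<open>Integrality on \<open>Qp\<close> makes x - \<Psi>(x) a map of \<open>?S\<close> into
  itself, and \<rho> = 1 gives the ratio 1/p; intersecting with \<open>Qp\<close> puts the zero
  there.\<close>

lemma psi_zero_exists:
  assumes "c \<in> Qp"
  shows "\<exists>z\<in>Qp. vabs (z - c) \<le> 1 \<and> psi z = 0"
proof -
  let ?S = "Qp \<inter> cball c 1"
  have S: "x \<in> ?S \<longleftrightarrow> x \<in> Qp \<and> vabs (x - c) \<le> 1" for x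
    by (simp add: dist_vabs vabs_minus_commute[of c x])
  have "\<exists>!x\<in>?S. x - psi x = x"
  proof (rule Banach_fix[where c = "1 / real p"])
    show "complete ?S" by (simp add: complete_eq_closed closed_Int closed_Qp)
    show "?S \<noteq> {}" using assms by auto
    show "(\<lambda>x. x - psi x) ` ?S \<subseteq> ?S"
    proof (intro image_subsetI)
      fix x assume "x \<in> ?S"
      then have x: "x \<in> Qp" "vabs (x - c) \<le> 1" using S[of x] by blast+
      have "vabs ((x - c) - psi x) \<le> 1" by (intro vabs_diff_le[OF x(2)] vabs_psi_le_1 x)
      moreover have "(x - c) - psi x = (x - psi x) - c" by simp
      ultimately show "x - psi x \<in> ?S" unfolding S using x psi_Qp by (auto intro: Qp_diff)
    qed
    show "dist (x - psi x) (y - psi y) \<le> 1 / real p * dist x y" if "x \<in> ?S" "y \<in> ?S" for x y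
    proof -
      have "vabs (x - c) \<le> 1" "vabs (y - c) \<le> 1" using that S[of x] S[of y] by blast+
      from psi_lipschitz[OF order.refl p_pos(3) assms this]
      show ?thesis unfolding dist_vabs
        using vabs_minus_commute[of "psi x - psi y" "x - y"] by (simp add: algebra_simps)
    qed
  qed (use p_pos in auto)
  then obtain z where "z \<in> ?S" "psi z = 0" by auto
  then show ?thesis using S[of z] by blast
qed

section \<open>Counting the zeros\<close>

definition psi_zeros :: "nat \<Rightarrow> 'c set" where
  "psi_zeros n = {z. psi z = 0 \<and> vabs z = real p ^ n}"

lemma disc_vabs_eq:
  fixes c :: 'c
  assumes "vabs c = real p ^ n" "n \<ge> 1" "vabs (z - c) < real p"
  shows "vabs z = real p ^ n"
proof -
  have "real p \<le> real p ^ n" using assms(2) p_pos by (intro self_le_power) auto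
  with assms have "vabs (z - c) < vabs c" by linarith
  with assms(1) show ?thesis using vabs_eq_of_diff_less by metis
qed

text \<open>The centres m/p^n with m a totative of p^n have absolute value p^n and lie in distinct
  cosets of the p-adic integers, each of which holds a zero. Euler's totient counts them.\<close>

lemma psi_zeros_lower:
  assumes n: "n \<ge> 1"
  shows "\<exists>W. finite W \<and> card W = p ^ n - p ^ (n - 1) \<and> W \<subseteq> psi_zeros n \<inter> Qp"
proof -
  define c where "c = (\<lambda>m. of_nat m / of_nat p ^ n :: 'c)"
  have c: "c m \<in> Qp" for m by (auto simp: c_def intro!: Qp_divide Qp_of_nat Qp_power)
  obtain \<zeta> where \<zeta>: "\<And>m. \<zeta> m \<in> Qp" "\<And>m. vabs (\<zeta> m - c m) \<le> 1" "\<And>m. psi (\<zeta> m) = 0"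
    using psi_zero_exists[OF c] by metis
  let ?M = "totatives (p ^ n)"
  have vc: "vabs (c m) = real p ^ n" if "m \<in> ?M" for m
  proof -
    have "coprime m (p ^ n)" using that by (simp add: totatives_def)
    then have "coprime m p" using n by simp
    then have "\<not> p dvd m" using p_ge_2 coprime_common_divisor[of m p p] by auto
    then have "vabs (of_int (int m) :: 'c) = 1" by (intro vabs_of_int_not_dvd) simp
    then show ?thesis by (simp add: c_def vabs_divide vabs_p_power)
  qed
  have "inj_on \<zeta> ?M"
  proof (rule inj_onI, rule ccontr)
    fix m m' assume m: "m \<in> ?M" "m' \<in> ?M" "\<zeta> m = \<zeta> m'" "m \<noteq> m'"
    have "vabs ((\<zeta> m' - c m') - (\<zeta> m - c m)) \<le> 1" by (rule vabs_diff_le[OF \<zeta>(2) \<zeta>(2)])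
    then have "vabs (c m - c m') \<le> 1" using m(3) by (simp add: algebra_simps)
    moreover have "c m - c m' = of_int (int m - int m') / of_nat p ^ n"
      by (simp add: c_def diff_divide_distrib)
    ultimately have le: "vabs (of_int (int m - int m') :: 'c) \<le> 1 / real p ^ n"
      using p_pos by (simp add: vabs_divide vabs_p_power field_simps)
    define k where "k = int m - int m'"
    have k: "k \<noteq> 0" "\<bar>k\<bar> < int p ^ n"
      using m by (auto simp: k_def totatives_def simp flip: of_nat_power)
    \<comment> \<open>With k = p^i q and q prime to p, |k| = p^-i, so |k| <= p^-n forces i >=
      n.\<close>
    have "int p ^ n dvd k"
    proof (rule ccontr)
      assume ndvd: "\<not> int p ^ n dvd k"
      obtain i q where iq: "k = int p ^ i * q" "\<not> int p dvd q"
        using prime k(1) multiplicity_decompose'[of k "int p"] by (metis not_prime_unit prime_int_nat_transfer prime_nat_int_transfer)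
      have "i < n" using ndvd iq(1) by (meson dvd_triv_left dvd_trans le_imp_power_dvd not_less)
      have "vabs (of_int k :: 'c) = 1 / real p ^ i"
        using iq by (simp add: vabs_mult vabs_p_power vabs_of_int_not_dvd)
      moreover have "1 / real p ^ n < 1 / real p ^ i"
        using \<open>i < n\<close> p_pos by (intro divide_strict_left_mono power_strict_increasing) auto
      ultimately show False using le by (simp add: k_def)
    qed
    then show False using k dvd_imp_le_int[of k "int p ^ n"] by simp
  qed
  then have "card (\<zeta> ` ?M) = p ^ n - p ^ (n - 1)"
    using totient_prime_power[OF prime, of n] n
    by (cases n) (simp_all add: card_image totient_def[symmetric] algebra_simps)
  moreover have "\<zeta> ` ?M \<subseteq> psi_zeros n \<inter> Qp"
    using \<zeta> disc_vabs_eq[OF vc n le_less_trans[OF \<zeta>(2) p_pos(3)]] by (auto simp: psi_zeros_def)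
  ultimately show ?thesis by (intro exI[of _ "\<zeta> ` ?M"]) auto
qed

text \<open>The zero at the origin is split off first, since 1 - T/z needs z nonzero; \<Psi>/T has
  Weierstrass degree p^n - 1 at radius p^n.\<close>

lemma strassmann_Psi:
  assumes "finite Z" and Z: "\<And>z. z \<in> Z \<Longrightarrow> z \<noteq> 0 \<and> vabs z \<le> real p ^ n \<and> psi z = 0"
  shows "card Z \<le> p ^ n - 1 \<and> (\<exists>g. \<Psi> = fps_X * (fps_of_poly (\<Prod>z\<in>Z. [:1, - (1 / z):]) * g) \<and>
           last_dominant (real p ^ n) (p ^ n - 1 - card Z) g \<and> fps_conv (real p ^ n) g)"
proof -
  define \<Phi> where "\<Phi> = fps_shift 1 \<Psi>"
  let ?r = "real p ^ n"
  have r: "0 < ?r" using p_pos by simp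
  have eq: "\<Psi> = fps_X * \<Phi>"
  proof (rule fps_ext)
    show "\<Psi> $ k = (fps_X * \<Phi>) $ k" for k by (cases k) (simp_all add: \<Phi>_def Psi_nth_0)
  qed
  have scale: "vabs (\<Phi> $ k) * ?r ^ k = vabs (\<Psi> $ Suc k) * ?r ^ Suc k / ?r" for k
    using p_pos by (simp add: \<Phi>_def)
  obtain M where M: "p ^ n = Suc M" using p_pos by (metis not0_implies_Suc of_nat_0_less_iff power_not_zero less_irrefl)
  have dom: "last_dominant ?r (p ^ n - 1) \<Phi>"
    using last_dominant_Psi[of n] r
    unfolding last_dominant_def gauss_le_def scale M
    by (auto intro!: divide_right_mono divide_strict_right_mono simp del: power_Suc)
  have conv: "fps_conv s \<Phi>" if "0 < s" for s
  proof -
    have "(\<lambda>k. vabs (\<Psi> $ Suc k) * s ^ Suc k / s) \<longlonglongrightarrow> 0"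
      using tendsto_divide[OF LIMSEQ_Suc[OF fps_conv_Psi[of s, unfolded fps_conv_def]] tendsto_const[of s]] that
      by simp
    then show ?thesis using that by (simp add: fps_conv_def \<Phi>_def)
  qed
  have "fps_value \<Phi> z = 0" if "z \<in> Z" for z
  proof -
    have "psi z = z * fps_value \<Phi> z"
      unfolding eq using Z[OF that] by (subst fps_value_mult) (auto simp: fps_conv_fps_X fps_value_fps_X conv)
    then show ?thesis using Z[OF that] by simp
  qed
  then have "card Z \<le> p ^ n - 1 \<and> (\<exists>g. \<Phi> = fps_of_poly (\<Prod>z\<in>Z. [:1, - (1 / z):]) * g \<and>
           last_dominant ?r (p ^ n - 1 - card Z) g \<and> fps_conv ?r g)"
    using Z by (intro strassmann_factorization[OF dom conv[OF r] r assms(1)]) auto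
  then show ?thesis using eq by metis
qed

definition psi_zeros_upto :: "nat \<Rightarrow> 'c set" where
  "psi_zeros_upto n = {z. psi z = 0 \<and> z \<noteq> 0 \<and> vabs z \<le> real p ^ n}"

lemma psi_zeros_disjoint: "z \<in> psi_zeros k \<Longrightarrow> z \<in> psi_zeros l \<Longrightarrow> k = l"
  using p_pos by (simp add: psi_zeros_def)

lemma psi_zeros_subset_upto: "k \<le> n \<Longrightarrow> psi_zeros k \<subseteq> psi_zeros_upto n"
  using p_pos by (auto simp: psi_zeros_def psi_zeros_upto_def power_increasing)

lemma sum_degrees: "(\<Sum>k=1..n. p ^ k - p ^ (k - 1)) = p ^ n - 1"
proof (induction n)
  case (Suc n)
  have "p ^ n \<le> p ^ Suc n" using p_pos by (intro power_increasing) auto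
  moreover have "1 \<le> p ^ n" using p_pos by simp
  ultimately show ?case using Suc.IH by simp
qed simp

lemma psi_zeros_count:
  "finite (psi_zeros_upto n) \<and> card (psi_zeros_upto n) = p ^ n - 1 \<and>
   psi_zeros_upto n = (\<Union>k\<in>{1..n}. psi_zeros k) \<and>
   (\<forall>k\<in>{1..n}. psi_zeros k \<subseteq> Qp \<and> card (psi_zeros k) = p ^ k - p ^ (k - 1))"
proof -
  obtain W where W: "\<And>k. k \<ge> 1 \<Longrightarrow> finite (W k)" "\<And>k. k \<ge> 1 \<Longrightarrow> card (W k) = p ^ k - p ^ (k - 1)"
      "\<And>k. k \<ge> 1 \<Longrightarrow> W k \<subseteq> psi_zeros k \<inter> Qp"
    using psi_zeros_lower by metis
  define U where "U = (\<Union>k\<in>{1..n}. W k)"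
  have fin: "finite U" using W(1) by (auto simp: U_def)
  have disj: "W k \<inter> W l = {}" if "k \<ge> 1" "l \<ge> 1" "k \<noteq> l" for k l
    using W(3)[OF that(1)] W(3)[OF that(2)] psi_zeros_disjoint[of _ k l] that(3) by blast
  have "card U = (\<Sum>k=1..n. card (W k))"
    unfolding U_def using W(1) disj by (intro card_UN_disjoint) auto
  also have "\<dots> = (\<Sum>k=1..n. p ^ k - p ^ (k - 1))" using W(2) by (intro sum.cong) auto
  finally have card: "card U = p ^ n - 1" by (simp only: sum_degrees)
  have sub: "U \<subseteq> psi_zeros_upto n"
    unfolding U_def using W(3) psi_zeros_subset_upto by fastforce
  have upto: "psi_zeros_upto n = U"
  proof (rule ccontr)
    assume "psi_zeros_upto n \<noteq> U"
    then obtain w where w: "w \<in> psi_zeros_upto n" "w \<notin> U" using sub by blast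
    \<comment> \<open>One more zero would make p^n nonzero zeros in the disc, beyond the Weierstrass
      degree of \<Psi>/T.\<close>
    have "card (insert w U) \<le> p ^ n - 1"
      using strassmann_Psi[of "insert w U" n] fin w(1) sub by (auto simp: psi_zeros_upto_def)
    then show False using fin w(2) card by simp
  qed
  have eq: "psi_zeros k = W k" if "k \<in> {1..n}" for k
  proof
    show "W k \<subseteq> psi_zeros k" using that W(3) by auto
    show "psi_zeros k \<subseteq> W k"
    proof
      fix z assume z: "z \<in> psi_zeros k"
      then have "z \<in> U" using psi_zeros_subset_upto[of k n] that upto by auto
      then obtain l where l: "l \<in> {1..n}" "z \<in> W l" by (auto simp: U_def)
      then have "z \<in> psi_zeros l" using W(3)[of l] by auto
      with z l show "z \<in> W k" using psi_zeros_disjoint by metis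
    qed
  qed
  show ?thesis using fin card upto eq W by (auto simp: U_def)
qed

lemma
  assumes "n \<ge> 1"
  shows psi_zeros_subset_Qp: "psi_zeros n \<subseteq> Qp"
    and card_psi_zeros: "card (psi_zeros n) = p ^ n - p ^ (n - 1)"
    and finite_psi_zeros: "finite (psi_zeros n)"
proof -
  show "psi_zeros n \<subseteq> Qp" "card (psi_zeros n) = p ^ n - p ^ (n - 1)"
    using psi_zeros_count[of n] assms by auto
  show "finite (psi_zeros n)"
    using psi_zeros_count[of n] psi_zeros_subset_upto[of n n] finite_subset by blast
qed

lemma psi_zeros_0: "psi_zeros 0 = {}"
  using psi_zeros_subset_upto[of 0 0] psi_zeros_count[of 0] by simp

lemma Psi_factorization:
  obtains g where "\<Psi> = fps_X * (fps_of_poly (\<Prod>z\<in>psi_zeros_upto n. [:1, - (1 / z):]) * g)"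
    "last_dominant (real p ^ n) 0 g" "fps_conv (real p ^ n) g"
proof -
  have fin: "finite (psi_zeros_upto n)" "card (psi_zeros_upto n) = p ^ n - 1"
    using psi_zeros_count[of n] by blast+
  have "z \<noteq> 0 \<and> vabs z \<le> real p ^ n \<and> psi z = 0" if "z \<in> psi_zeros_upto n" for z
    using that by (simp add: psi_zeros_upto_def)
  from strassmann_Psi[OF fin(1) this] show thesis
    unfolding fin(2) diff_self_eq_0 using that by blast
qed

lemma nonzero_psi_zero_cases:
  assumes "psi z = 0" "z \<noteq> 0"
  obtains n where "n \<ge> 1" "z \<in> psi_zeros n"
proof -
  obtain m where "vabs z < real p ^ m" by (rule obtain_power_p_gt)
  then have "z \<in> psi_zeros_upto m" using assms by (simp add: psi_zeros_upto_def)
  then have "z \<in> (\<Union>k\<in>{1..m}. psi_zeros k)" using psi_zeros_count[of m] by metis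
  then show thesis using that by auto
qed

lemma power_p_diff_pos: "n \<ge> 1 \<Longrightarrow> p ^ (n - 1) < p ^ n"
  using p_ge_2 by (intro power_strict_increasing) auto

lemma psi_zeros_nonempty: "n \<ge> 1 \<Longrightarrow> psi_zeros n \<noteq> {}"
  using card_psi_zeros[of n] power_p_diff_pos[of n] by auto

lemma zero_notin_psi_zeros: "0 \<notin> psi_zeros n"
  using p_pos by (simp add: psi_zeros_def)

text \<open>The zeros of the disc are split off once each, so the cofactor of 1 - T/z does not
  vanish at z: the other linear factors have other roots, and the remaining factor is dominated by
  its constant term. The product rule then applies.\<close>

lemma psi_deriv_nonzero:
  assumes "z \<in> psi_zeros n"
  shows "fps_value (fps_deriv \<Psi>) z \<noteq> 0"
proof -
  let ?r = "real p ^ n" and ?Z = "psi_zeros_upto n"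
  have r: "0 < ?r" using p_pos by simp
  have z: "z \<in> ?Z" using psi_zeros_subset_upto assms by blast
  then have z0: "z \<noteq> 0" "vabs z \<le> ?r" by (auto simp: psi_zeros_upto_def)
  have fin: "finite ?Z" using psi_zeros_count[of n] by blast
  obtain g where g: "\<Psi> = fps_X * (fps_of_poly (\<Prod>w\<in>?Z. [:1, - (1 / w):]) * g)"
      "last_dominant ?r 0 g" "fps_conv ?r g"
    by (rule Psi_factorization)
  define Q where "Q = (\<Prod>w\<in>?Z - {z}. [:1, - (1 / w):])"
  define L where "L = fps_of_poly [:1, - (1 / z):]"
  define h where "h = fps_X * (fps_of_poly Q * g)"
  have prod: "(\<Prod>w\<in>?Z. [:1, - (1 / w):]) = [:1, - (1 / z):] * Q"
    unfolding Q_def using fin z by (intro prod.remove)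
  have Psi: "\<Psi> = L * h" unfolding g(1) prod h_def L_def fps_of_poly_mult by (simp add: mult_ac)
  have conv_g: "fps_conv (vabs z) g" using g(3) z0 by (auto intro: fps_conv_mono)
  have "poly Q z \<noteq> 0"
    unfolding Q_def using fin by (auto simp: poly_prod psi_zeros_upto_def)
  moreover have "fps_value g z \<noteq> 0" by (rule last_dominant_0_approx(1)[OF g(2,3) r z0(2)])
  ultimately have hz: "fps_value h z \<noteq> 0" unfolding h_def using z0(1)
    by (simp add: fps_value_mult fps_conv_mult fps_conv_fps_X fps_conv_of_poly conv_g
        fps_value_fps_X fps_value_of_poly)
  have conv_h: "fps_conv (vabs z) h" unfolding h_def
    by (intro fps_conv_mult fps_conv_fps_X fps_conv_of_poly conv_g) auto
  have conv_L: "fps_conv (vabs z) L" unfolding L_def by (rule fps_conv_of_poly)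
  have "0 < vabs z" using z0 by simp
  note dconv = fps_conv_deriv[OF this]
  have dL: "fps_value (fps_deriv L) z = - (1 / z)"
    unfolding L_def by (simp add: fps_of_poly_pderiv[symmetric] fps_value_of_poly pderiv_pCons)
  have Lz: "fps_value L z = 0" using z0 by (simp add: L_def fps_value_of_poly)
  have "fps_value (fps_deriv \<Psi>) z = fps_value (fps_deriv L) z * fps_value h z + fps_value L z * fps_value (fps_deriv h) z"
    unfolding Psi fps_deriv_mult
    by (simp add: fps_value_add fps_value_mult fps_conv_mult conv_h conv_L dconv add.commute)
  then show ?thesis using dL Lz hz z0 by simp
qed

section \<open>The product expansion\<close>

definition psi_poly :: "nat \<Rightarrow> 'c poly" where
  "psi_poly n = (\<Prod>z\<in>psi_zeros n. [:1, - (1 / z):])"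

abbreviation psi_partial :: "nat \<Rightarrow> 'c poly" where
  "psi_partial n \<equiv> [:0, 1:] * (\<Prod>k=1..n. psi_poly k)"

lemma prod_psi_zeros_upto: "(\<Prod>z\<in>psi_zeros_upto n. [:1, - (1 / z):]) = (\<Prod>k=1..n. psi_poly k)"
proof -
  have "(\<Prod>z\<in>(\<Union>k\<in>{1..n}. psi_zeros k). [:1, - (1 / z):]) = (\<Prod>k=1..n. psi_poly k)"
    unfolding psi_poly_def using psi_zeros_disjoint finite_psi_zeros
    by (intro prod.UNION_disjoint) auto
  then show ?thesis using psi_zeros_count[of n] by metis
qed

text \<open>With \<Psi> = P g the error is |P| |g - 1|. Here |g(x)| = 1, so |P(x)| = |\<Psi>(x)| is
  bounded independently of N, while |g(x) - 1| <= p^m/p^N.\<close>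

lemma psi_partial_approx:
  assumes x: "vabs x \<le> real p ^ m" and N: "m < N"
  shows "vabs (poly (psi_partial N) x - psi x) \<le> real p ^ psum m * (real p ^ m / real p ^ N)"
proof -
  let ?r = "real p ^ N" and ?P = "psi_partial N"
  have r: "0 < ?r" using p_pos by simp
  have mN: "real p ^ m < ?r" using N p_pos by (intro power_strict_increasing) auto
  obtain g where g: "\<Psi> = fps_X * (fps_of_poly (\<Prod>k=1..N. psi_poly k) * g)"
      "last_dominant ?r 0 g" "fps_conv ?r g"
    using Psi_factorization[of N] unfolding prod_psi_zeros_upto .
  have P: "\<Psi> = fps_of_poly ?P * g"
    unfolding g(1) by (simp add: fps_of_poly_mult fps_of_poly_fps_X mult_ac)
  have "fps_of_poly (\<Prod>k=1..N. psi_poly k) $ 0 = 1"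
    by (simp add: poly_0_coeff_0[symmetric] poly_prod psi_poly_def)
  \<comment> \<open>Comparison of the coefficients of T: that of \<Psi> is 1, and the polynomial
    factors have constant term 1.\<close>
  then have g0: "g $ 0 = 1"
    using Psi_nth_1 unfolding g(1) by (simp add: fps_mult_nth)
  have xr: "vabs x \<le> ?r" using x mN by linarith
  have "vabs (fps_value g x - 1) \<le> vabs x / ?r"
    using last_dominant_0_approx(2)[OF g(2,3) r xr] by (simp add: g0)
  also have "\<dots> \<le> real p ^ m / ?r" using x r by (intro divide_right_mono) auto
  finally have ga: "vabs (fps_value g x - 1) \<le> real p ^ m / ?r" .
  also have "\<dots> < 1" using mN r by simp
  finally have "vabs (fps_value g x) = vabs (1::'c)" by (intro vabs_eq_of_diff_less) simp
  moreover have psi: "psi x = poly ?P x * fps_value g x"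
    unfolding P using fps_conv_mono[OF g(3) vabs_nonneg xr]
    by (simp only: fps_value_mult fps_conv_of_poly fps_value_of_poly)
  ultimately have "vabs (poly ?P x) = vabs (psi x)" by (simp add: vabs_mult)
  also have "\<dots> \<le> real p ^ psum m"
  proof (rule vabs_fps_value_le)
    show "gauss_le (vabs x) (real p ^ psum m) \<Psi>" unfolding gauss_le_def
    proof
      fix k
      have "vabs (\<Psi> $ k) * vabs x ^ k \<le> vabs (\<Psi> $ k) * (real p ^ m) ^ k"
        using x by (intro mult_left_mono power_mono) auto
      also have "\<dots> \<le> real p ^ psum m" by (rule gauss_leD[OF gauss_le_Psi])
      finally show "vabs (\<Psi> $ k) * vabs x ^ k \<le> real p ^ psum m" .
    qed
  qed (simp add: fps_conv_Psi)
  finally have "vabs (poly ?P x) * vabs (fps_value g x - 1) \<le> real p ^ psum m * (real p ^ m / ?r)"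
    using ga p_pos by (intro mult_mono) auto
  moreover have "vabs (poly ?P x - psi x) = vabs (poly ?P x) * vabs (fps_value g x - 1)"
    unfolding vabs_minus_commute[of "poly ?P x"] psi vabs_mult[symmetric]
    by (simp only: right_diff_distrib mult_1_right)
  ultimately show ?thesis by (simp only:)
qed

lemma psi_poly_Qp: "n \<ge> 1 \<Longrightarrow> coeff (psi_poly n) i \<in> Qp"
  unfolding psi_poly_def using psi_zeros_subset_Qp by (intro Qp_poly_prod linear_factor_Qp) auto

lemma psi_partial_entire: "fps_of_poly (psi_partial N) \<in> entire_Qp"
  by (intro fps_of_poly_entire_Qp Qp_poly_mult Qp_poly_prod psi_poly_Qp)
    (auto simp: coeff_pCons Qp_0 Qp_1 split: nat.split)

lemma Psi_entire: "\<Psi> \<in> entire_Qp"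
  by (auto simp: entire_Qp_def mem_fps_convergence_set_iff fps_conv_Psi)
    (simp add: \<Psi>_def Qp_of_int)

lemma frechet_tendsto_psi_partial: "frechet_tendsto p (\<lambda>N. fps_of_poly (psi_partial N)) \<Psi>"
  unfolding frechet_tendsto_def
proof (intro conjI allI psi_partial_entire Psi_entire uniform_limitI)
  fix r :: int and e :: real
  assume e: "0 < e"
  let ?S = "(\<lambda>y. of_nat p powi (- r) * y) ` cball (0::'c) 1"
  obtain m where m: "vabs (of_nat p powi (- r) :: 'c) < real p ^ m" by (rule obtain_power_p_gt)
  have S: "vabs x \<le> real p ^ m" if x: "x \<in> ?S" for x
  proof -
    obtain y where y: "x = of_nat p powi (- r) * y" and "y \<in> cball 0 1"
      using x by blast
    then have "vabs y \<le> 1" by (simp add: dist_vabs)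
    have "vabs x \<le> vabs (of_nat p powi (- r) :: 'c) * 1"
      unfolding y vabs_mult using \<open>vabs y \<le> 1\<close> by (intro mult_left_mono) auto
    with m show ?thesis by simp
  qed
  have "(\<lambda>N. real p ^ psum m * real p ^ m * (1 / real p) ^ N) \<longlonglongrightarrow> 0"
    using tendsto_mult[OF tendsto_const[of "real p ^ psum m * real p ^ m"] LIMSEQ_power_zero[of "1 / real p"]]
      p_pos by simp
  then have "\<forall>\<^sub>F N in sequentially. real p ^ psum m * real p ^ m * (1 / real p) ^ N < e"
    using e by (intro order_tendstoD)
  then show "\<forall>\<^sub>F N in sequentially. \<forall>x\<in>?S. dist (fps_value (fps_of_poly (psi_partial N)) x) (psi x) < e"
    using eventually_gt_at_top[of m]
  proof eventually_elim
    case (elim N)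
    show ?case
    proof
      fix x assume "x \<in> ?S"
      from psi_partial_approx[OF S[OF this] elim(2)] elim(1)
      show "dist (fps_value (fps_of_poly (psi_partial N)) x) (psi x) < e"
        unfolding dist_vabs fps_value_of_poly by (simp add: power_divide)
    qed
  qed
qed

text \<open>For a p-adic z with |z| = p^n, the inverse 1/z is p^n times a unit u of
  \<open>Zp\<close>.\<close>

lemma prod_linear_factors_integral:
  assumes "finite Z" "\<And>z. z \<in> Z \<Longrightarrow> z \<in> Qp \<and> vabs (z::'c) = real p ^ n"
  shows "\<exists>q. (\<forall>i. coeff q i \<in> Zp) \<and>
    (\<Prod>z\<in>Z. [:1, - (1 / z):]) = 1 + smult (of_nat p ^ n) ([:0, 1:] * q)"
  using assms
proof (induction Z rule: finite_induct)
  case empty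
  show ?case by (intro exI[of _ 0]) (simp add: Zp_0)
next
  case (insert z Z)
  then obtain q where q: "\<And>i. coeff q i \<in> Zp"
      "(\<Prod>z\<in>Z. [:1, - (1 / z):]) = 1 + smult (of_nat p ^ n) ([:0, 1:] * q)" by auto
  define u where "u = 1 / (of_nat p ^ n * z)"
  have z: "z \<in> Qp" "vabs z = real p ^ n" using insert.prems by auto
  have "vabs u = 1" using z p_pos by (simp add: u_def vabs_divide vabs_mult vabs_p_power)
  then have u: "u \<in> Zp"
    using z by (auto simp: Zp_def u_def intro!: Qp_divide Qp_mult Qp_power Qp_of_nat Qp_1)
  have zu: "1 / z = of_nat p ^ n * u" using p_pos by (simp add: u_def)
  \<comment> \<open>Read off from (1 - p^n u X)(1 + p^n X q) = 1 + p^n X (q - u - p^n u X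
    q).\<close>
  define q' where "q' = q - [:u:] - smult (of_nat p ^ n * u) (pCons 0 q)"
  have "coeff q' i \<in> Zp" for i
  proof -
    have "coeff [:u:] i \<in> Zp" "coeff (pCons 0 q) i \<in> Zp"
      using u q(1) by (auto simp: coeff_pCons Zp_0 split: nat.split)
    then show ?thesis unfolding q'_def coeff_diff coeff_smult
      by (intro Zp_diff Zp_mult Zp_power Zp_of_nat q(1) u)
  qed
  moreover have "(\<Prod>z\<in>insert z Z. [:1, - (1 / z):]) = 1 + smult (of_nat p ^ n) ([:0, 1:] * q')"
  proof -
    have "[:1, - (of_nat p ^ n * u):] * (1 + smult (of_nat p ^ n) ([:0, 1:] * q))
        = 1 + smult (of_nat p ^ n) ([:0, 1:] * q')"
      unfolding poly_eq_poly_eq_iff[symmetric]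
      by (rule ext) (simp add: q'_def algebra_simps)
    then show ?thesis unfolding prod.insert[OF insert.hyps(1,2)] q(2) zu .
  qed
  ultimately show ?case by blast
qed

section \<open>Translation to valuations, vanishing orders and discs\<close>

lemma vp_eq_iff: "vp p (z::'c) = - ereal (real n) \<longleftrightarrow> vabs z = real p ^ n"
proof (cases "z = 0")
  case False
  have "vp p z = - ereal (real n) \<longleftrightarrow> log (real p) (vabs z) = real n"
    using False by (simp add: vp_def)
  also have "\<dots> \<longleftrightarrow> vabs z = real p powr real n"
    using False p_pos by (metis log_powr_cancel less_irrefl powr_log_cancel vabs_pos_iff)
  finally show ?thesis using p_pos by (simp add: powr_realpow)
qed (use p_pos in \<open>simp add: vp_def\<close>)

lemma vp_greater_iff: "- 1 < vp p (z::'c) \<longleftrightarrow> vabs z < real p"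
proof (cases "z = 0")
  case False
  then have "- 1 < vp p z \<longleftrightarrow> log (real p) (vabs z) < 1"
    by (simp add: vp_def one_ereal_def)
  also have "\<dots> \<longleftrightarrow> vabs z < real p" using False p_pos by simp
  finally show ?thesis .
qed (use p_pos in \<open>simp add: vp_def one_ereal_def\<close>)

lemma zeros_of_valuation_Psi: "zeros_of_valuation p \<Psi> (- ereal (real n)) = psi_zeros n"
  unfolding zeros_of_valuation_def psi_zeros_def vp_eq_iff ..

lemma simple_zero_Psi:
  assumes "z \<in> psi_zeros n"
  shows "simple_zero \<Psi> z"
  using assms psi_deriv_nonzero by (simp add: vanishing_order_def psi_zeros_def)

lemma simple_zeros_of_valuation:
  assumes "n \<ge> 1"
  shows "{z \<in> Qp. simple_zero \<Psi> z \<and> vp p z = - ereal (real n)} = psi_zeros n"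
proof
  show "psi_zeros n \<subseteq> {z \<in> Qp. simple_zero \<Psi> z \<and> vp p z = - ereal (real n)}"
    using psi_zeros_subset_Qp[OF assms] simple_zero_Psi[of _ n] unfolding vp_eq_iff
    by (auto simp: psi_zeros_def)
  show "{z \<in> Qp. simple_zero \<Psi> z \<and> vp p z = - ereal (real n)} \<subseteq> psi_zeros n"
    unfolding vp_eq_iff by (auto simp: vanishing_order_def psi_zeros_def)
qed

lemma infinite_schnirelmann_product_Psi: "infinite_schnirelmann_product p \<Psi> [:0, 1:] psi_poly"
  unfolding infinite_schnirelmann_product_def
proof (intro conjI)
  show "\<exists>c k. c \<noteq> 0 \<and> [:0, 1 :: 'c:] = monom c k"
    by (intro exI[of _ 1]) (simp add: monom_Suc monom_0)
  show "fps_of_poly [:0, 1 :: 'c:] \<in> entire_Qp"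
    using psi_partial_entire[of 0] by simp
  show "\<forall>n\<ge>1. fps_of_poly (psi_poly n) \<in> entire_Qp \<and> coeff (psi_poly n) 0 = 1 \<and> degree (psi_poly n) > 0"
  proof (intro allI impI conjI)
    fix n :: nat assume n: "n \<ge> 1"
    show "fps_of_poly (psi_poly n) \<in> entire_Qp" by (intro fps_of_poly_entire_Qp psi_poly_Qp n)
    show "coeff (psi_poly n) 0 = 1" by (simp add: poly_0_coeff_0[symmetric] poly_prod psi_poly_def)
    have "degree (psi_poly n) = (\<Sum>z\<in>psi_zeros n. degree [:1, - (1 / z):])"
      unfolding psi_poly_def by (intro degree_prod_eq_sum_degree) auto
    also have "\<dots> = (\<Sum>z\<in>psi_zeros n. 1)"
      using zero_notin_psi_zeros[of n] by (intro sum.cong) auto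
    finally show "degree (psi_poly n) > 0"
      using card_psi_zeros[OF n] power_p_diff_pos[OF n] by simp
  qed
  have roots: "poly (psi_poly n) z = 0 \<longleftrightarrow> z \<in> psi_zeros n" if "n \<ge> 1" for n z
    using finite_psi_zeros[OF that] zero_notin_psi_zeros[of n] unfolding psi_poly_def poly_prod
    by (subst prod_zero_iff) (auto simp: field_simps)
  show "\<exists>v :: nat \<Rightarrow> ereal. (\<forall>n\<ge>1. v (Suc n) < v n) \<and>
        (\<forall>n\<ge>1. \<forall>z. poly (psi_poly n) z = 0 \<longrightarrow> vp p z = v n) \<and>
        (\<forall>n\<ge>1. \<forall>z. vp p z = v n \<longrightarrow> vanishing_order \<Psi> z (order z (psi_poly n))) \<and>
        (\<forall>z. z \<noteq> 0 \<and> psi z = 0 \<longrightarrow> (\<exists>n\<ge>1. vp p z = v n))"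
  proof (intro exI[of _ "\<lambda>n. - ereal (real n)"] conjI allI impI)
    show "- ereal (real (Suc n)) < - ereal (real n)" for n by simp
    show "vp p z = - ereal (real n)" if "n \<ge> 1" "poly (psi_poly n) z = 0" for n z
      using that roots unfolding vp_eq_iff by (simp add: psi_zeros_def)
    show "\<exists>n\<ge>1. vp p z = - ereal (real n)" if "z \<noteq> 0 \<and> psi z = 0" for z
      using nonzero_psi_zero_cases[of z] that by (metis (mono_tags) vp_eq_iff psi_zeros_def mem_Collect_eq)
    fix n and z :: 'c assume n: "n \<ge> 1" and z: "vp p z = - ereal (real n)"
    show "vanishing_order \<Psi> z (order z (psi_poly n))"
    proof (cases "z \<in> psi_zeros n")
      case True
      then have "order z (psi_poly n) = 1"
        unfolding psi_poly_def using finite_psi_zeros[OF n] zero_notin_psi_zeros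
        by (intro order_prod_linear_factors) auto
      then show ?thesis using simple_zero_Psi[OF True] by simp
    next
      case False
      \<comment> \<open>Points of valuation -n that are no zeros are covered as well: root order 0
        has to match a nonzero value.\<close>
      then have "order z (psi_poly n) = 0" using roots[OF n] by (intro order_0I) auto
      moreover have "psi z \<noteq> 0" using False z unfolding vp_eq_iff by (simp add: psi_zeros_def)
      ultimately show ?thesis by (simp add: vanishing_order_def)
    qed
  qed
  show "frechet_tendsto p (\<lambda>N. fps_of_poly (psi_partial N)) \<Psi>" by (rule frechet_tendsto_psi_partial)
qed

text \<open>x y is congruent to 1 modulo p^n with n >= 1, hence |x y| = 1, and neither factor
  exceeds 1.\<close>

lemma Zp_unit_mod_vabs:
  fixes x :: 'c
  assumes "Zp_unit_mod p n x" "n \<ge> 1"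
  shows "vabs x = 1"
proof -
  obtain y t where x: "x \<in> Zp" and y: "y \<in> Zp" and t: "t \<in> Zp" "x * y - 1 = of_nat p ^ n * t"
    using assms(1) by (auto simp: Zp_unit_mod_def Zp_cong_def)
  have "vabs (x * y - 1) \<le> 1 / real p ^ n * 1"
    unfolding t(2) vabs_mult vabs_p_power using t(1) by (intro mult_left_mono) (auto simp: Zp_def)
  also have "\<dots> < 1" using assms(2) p_pos by (simp add: one_less_power)
  finally have "vabs (x * y) = 1" using vabs_eq_of_diff_less[of "x * y" 1] by simp
  moreover have "vabs x \<le> 1" "vabs y \<le> 1" using x y by (auto simp: Zp_def)
  moreover have "vabs x * vabs y \<le> vabs x * 1" using \<open>vabs y \<le> 1\<close> by (intro mult_left_mono) auto
  ultimately show ?thesis by (simp add: vabs_mult)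
qed

text \<open>Existence comes from the closed disc of radius 1, uniqueness from injectivity on the
  open disc of radius p. Distinct representatives are more than 1 apart after division by p^n, so
  their zeros differ; conversely p^n w is a p-adic unit for a zero w of valuation -n, hence
  congruent to some \<open>a j\<close>.\<close>

lemma psi_zeros_in_discs:
  fixes a :: "nat \<Rightarrow> 'c"
  assumes n: "n \<ge> 1" and a: "unit_representatives p n J a"
  shows "\<exists>z. (\<forall>j\<in>J. z j \<in> Qp \<and> {w \<in> ball (a j / of_nat p ^ n) (real p). psi w = 0} = {z j}) \<and>
    bij_betw z J (psi_zeros n)"
proof -
  define c where "c = (\<lambda>j. a j / of_nat p ^ n)"
  have unit: "Zp_unit_mod p n (a j)" if "j \<in> J" for j
    using a that by (auto simp: unit_representatives_def)
  have aQ: "a j \<in> Qp" if "j \<in> J" for j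
    using unit[OF that] by (auto simp: Zp_unit_mod_def Zp_def)
  have c: "c j \<in> Qp" if "j \<in> J" for j
    using aQ[OF that] by (auto simp: c_def intro!: Qp_divide Qp_power Qp_of_nat)
  have vc: "vabs (c j) = real p ^ n" if "j \<in> J" for j
    using Zp_unit_mod_vabs[OF unit[OF that] n] by (simp add: c_def vabs_divide vabs_p_power)
  have "\<forall>j\<in>J. \<exists>z. z \<in> Qp \<and> vabs (z - c j) \<le> 1 \<and> psi z = 0"
    using psi_zero_exists c by blast
  then obtain z where z: "\<And>j. j \<in> J \<Longrightarrow> z j \<in> Qp" "\<And>j. j \<in> J \<Longrightarrow> vabs (z j - c j) \<le> 1"
      "\<And>j. j \<in> J \<Longrightarrow> psi (z j) = 0"
    by metis
  have unique: "w = z j" if "j \<in> J" "vabs (w - c j) < real p" "psi w = 0" for w j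
    by (rule psi_inj_on_disc[OF c[OF that(1)] that(2) le_less_trans[OF z(2)[OF that(1)] p_pos(3)]])
      (simp only: that(3) z(3)[OF that(1)])
  have ball: "{w \<in> ball (c j) (real p). psi w = 0} = {z j}" if "j \<in> J" for j
  proof -
    have "w \<in> ball (c j) (real p) \<longleftrightarrow> vabs (w - c j) < real p" for w
      by (simp add: dist_vabs vabs_minus_commute[of "c j"])
    moreover have "vabs (z j - c j) < real p" by (rule le_less_trans[OF z(2)[OF that] p_pos(3)])
    ultimately show ?thesis using unique[OF that] z(3)[OF that] by blast
  qed
  have "inj_on z J"
  proof (rule inj_onI)
    fix i j assume ij: "i \<in> J" "j \<in> J" "z i = z j"
    have "vabs ((z j - c j) - (z i - c i)) \<le> 1" by (intro vabs_diff_le z(2) ij)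
    then have "c i - c j \<in> Zp" using ij c by (auto simp: Zp_def Qp_diff)
    moreover have "a i - a j = of_nat p ^ n * (c i - c j)" using p_pos by (simp add: c_def field_simps)
    ultimately have "Zp_cong p n (a i) (a j)" unfolding Zp_cong_def by blast
    moreover have "Zp_cong p n (a i) (a i)" unfolding Zp_cong_def by (intro bexI[OF _ Zp_0]) simp
    ultimately show "i = j" using a unit[OF ij(1)] ij unfolding unit_representatives_def by blast
  qed
  moreover have "z ` J = psi_zeros n"
  proof
    show "z ` J \<subseteq> psi_zeros n"
      using disc_vabs_eq[OF vc n le_less_trans[OF z(2) p_pos(3)]] z(3) by (auto simp: psi_zeros_def)
    show "psi_zeros n \<subseteq> z ` J"
    proof
      fix w assume w: "w \<in> psi_zeros n"
      define u where "u = of_nat p ^ n * w"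
      have u1: "vabs u = 1" using w p_pos by (simp add: u_def vabs_mult vabs_p_power psi_zeros_def)
      have uQ: "u \<in> Qp" using w psi_zeros_subset_Qp[OF n] by (auto simp: u_def intro!: Qp_mult Qp_power Qp_of_nat)
      have "u \<noteq> 0" using u1 by auto
      then have "Zp_cong p n (u * inverse u) 1" unfolding Zp_cong_def by (intro bexI[OF _ Zp_0]) simp
      moreover have "inverse u \<in> Zp" using uQ u1 by (simp add: Zp_def Qp_inverse vabs_inverse)
      ultimately have "Zp_unit_mod p n u" using uQ u1 by (auto simp: Zp_unit_mod_def Zp_def)
      then obtain j where j: "j \<in> J" "Zp_cong p n u (a j)"
        using a by (auto simp: unit_representatives_def)
      then obtain t where t: "t \<in> Zp" "u - a j = of_nat p ^ n * t" by (auto simp: Zp_cong_def)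
      have "w - c j = t" using t(2) p_pos by (simp add: u_def c_def field_simps)
      then have "vabs (w - c j) < real p" using t(1) p_pos by (auto simp: Zp_def)
      then have "w = z j" using w by (intro unique j) (auto simp: psi_zeros_def)
      then show "w \<in> z ` J" using j by blast
    qed
  qed
  ultimately have "bij_betw z J (psi_zeros n)" by (simp add: bij_betw_def)
  then show ?thesis using z(1) ball unfolding c_def by blast
qed

section \<open>The disc of convergence of the inverse\<close>

text \<open>The recursion for \<beta> reproduces the bound: \<beta>^k has Gauss norm at most p^k at
  radius p, and |\<Psi>_k| p^k <= p is the Gauss bound for \<Psi> at the same radius.\<close>

lemma inverse_Psi_gauss_le:
  assumes "is_compositional_inverse (Psi p) \<beta>"
  shows "gauss_le (real p) (real p) (fps_of_int_coeffs \<beta> :: 'c fps)"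
proof -
  have f: "Psi p $ 0 = 0" "Psi p $ 1 = 1" using is_Psi_Psi[OF p_ge_2] by (auto simp: is_Psi_def)
  have \<beta>: "\<beta> $ 0 = 0" "Psi p oo \<beta> = fps_X" using assms by (auto simp: is_compositional_inverse_def)
  then have rec: "\<forall>n\<ge>1. \<beta> $ n = (if n = 1 then 1 else 0) - (\<Sum>k=2..n. Psi p $ k * (\<beta> ^ k) $ n)"
    using fps_compose_eq_X_iff[OF f \<beta>(1)] by blast
  have Psi1: "gauss_le (real p) (real p) \<Psi>" using gauss_le_Psi[of 1] by (simp add: psum_def)
  have "vabs (of_int (\<beta> $ n) :: 'c) * real p ^ n \<le> real p" for n
  proof (induction n rule: less_induct)
    case (less n)
    show ?case
    proof (cases "n = 0")
      case False
      \<comment> \<open>Truncation below n turns the induction hypothesis into a Gauss bound for a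
        whole series; for k >= 2 it does not change the coefficient n of the k-th power.\<close>
      define b where "b = Abs_fps (\<lambda>i. if i < n then \<beta> $ i else 0)"
      have "gauss_le (real p) (real p) (fps_of_int_coeffs b :: 'c fps)"
        unfolding gauss_le_def using less.IH by (simp add: b_def)
      from gauss_le_power[OF _ this]
      have b: "gauss_le (real p) (real p ^ k) (fps_of_int_coeffs (b ^ k) :: 'c fps)" for k
        by (simp add: fps_of_int_coeffs_power)
      have pn: "0 < real p ^ n" using p_pos by simp
      have "vabs (of_int (Psi p $ k * (\<beta> ^ k) $ n) :: 'c) \<le> real p / real p ^ n" if "k \<in> {2..n}" for k
      proof -
        have eq: "(\<beta> ^ k) $ n = (b ^ k) $ n"
          using that \<beta>(1) False by (intro fps_power_nth_cong) (auto simp: b_def)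
        have "vabs (of_int (Psi p $ k) :: 'c) * (vabs (of_int ((b ^ k) $ n) :: 'c) * real p ^ n)
            \<le> vabs (of_int (Psi p $ k) :: 'c) * real p ^ k"
          using gauss_leD[OF b, of k n] by (intro mult_left_mono) auto
        also have "\<dots> \<le> real p" using gauss_leD[OF Psi1, of k] by (simp add: \<Psi>_def)
        finally show ?thesis unfolding eq using pn by (simp add: vabs_mult pos_le_divide_eq mult.assoc)
      qed
      then have "vabs (\<Sum>k=2..n. of_int (Psi p $ k * (\<beta> ^ k) $ n) :: 'c) \<le> real p / real p ^ n"
        using p_pos by (intro vabs_sum_le) auto
      moreover have "vabs (if n = 1 then 1 else 0 :: 'c) \<le> real p / real p ^ n" using p_pos by simp
      ultimately have "vabs ((if n = 1 then 1 else 0) - (\<Sum>k=2..n. of_int (Psi p $ k * (\<beta> ^ k) $ n) :: 'c))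
          \<le> real p / real p ^ n" by (rule vabs_diff_le[rotated])
      moreover have "(of_int (\<beta> $ n) :: 'c)
          = (if n = 1 then 1 else 0) - (\<Sum>k=2..n. of_int (Psi p $ k * (\<beta> ^ k) $ n))"
        using False by (subst rec[rule_format]) auto
      ultimately have "vabs (of_int (\<beta> $ n) :: 'c) \<le> real p / real p ^ n" by (simp only:)
      then show ?thesis using pn by (simp only: pos_le_divide_eq)
    qed (simp add: \<beta>)
  qed
  then show ?thesis by (simp add: gauss_le_def)
qed

text \<open>
  If \<open>\<beta>\<close> converged on the disc of radius \<open>p\<close>, which \<open>\<Psi>\<close> maps to itself, then \<open>\<beta>(\<Psi>(z)) = z\<close> would hold
  at a zero \<open>z\<close> of \<open>\<Psi>\<close> of valuation \<open>-1\<close>.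
\<close>

lemma inverse_Psi_not_conv:
  assumes inv: "is_compositional_inverse (Psi p) \<beta>"
  shows "\<not> fps_conv (real p) (fps_of_int_coeffs \<beta> :: 'c fps)"
proof
  define B where "B = (fps_of_int_coeffs \<beta> :: 'c fps)"
  assume "fps_conv (real p) (fps_of_int_coeffs \<beta> :: 'c fps)"
  then have "(\<lambda>k. vabs (B $ k) * real p ^ k) \<longlonglongrightarrow> 0" unfolding B_def fps_conv_def .
  \<comment> \<open>Any positive bound strictly below p, the absolute value of the zero chosen
    later, would serve.\<close>
  then obtain N where N: "\<And>k. k \<ge> N \<Longrightarrow> vabs (B $ k) * real p ^ k < real p / 2"
    using order_tendstoD(2)[of _ 0 sequentially "real p / 2"] p_pos by (auto simp: eventually_sequentially)
  have \<beta>: "\<beta> $ 0 = 0" "\<beta> oo Psi p = fps_X" using inv by (auto simp: is_compositional_inverse_def)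
  have comp: "(\<Sum>k=0..n. B $ k * (\<Psi> ^ k) $ n) = (fps_X :: 'c fps) $ n" for n
  proof -
    have "(\<Sum>k=0..n. B $ k * (\<Psi> ^ k) $ n) = of_int ((\<beta> oo Psi p) $ n)"
      by (simp add: B_def \<Psi>_def fps_of_int_coeffs_power fps_compose_nth)
    then show ?thesis by (simp add: \<beta>(2))
  qed
  obtain z where "z \<in> psi_zeros 1" using psi_zeros_nonempty[of 1] by auto
  then have z: "psi z = 0" "vabs z = real p" by (auto simp: psi_zeros_def)
  \<comment> \<open>The remainder of \<beta>(\<Psi>) = X after N terms. Its value at z is z, as all
    subtracted terms vanish there; its coefficients involve only \<open>B $ k\<close> with k >= N,
    so its Gauss norm at radius p is at most p/2.\<close>
  define E where "E = (\<lambda>N. fps_X - (\<Sum>k<N. fps_const (B $ k) * \<Psi> ^ k))"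
  have E: "fps_conv (vabs z) (E N) \<and> fps_value (E N) z = z" for N
  proof (induction N)
    case 0
    then show ?case by (simp add: E_def fps_conv_fps_X fps_value_fps_X)
  next
    case (Suc N)
    have conv: "fps_conv (vabs z) (\<Psi> ^ N)" "fps_conv (vabs z) (fps_const (B $ N) * \<Psi> ^ N)"
      by (intro fps_conv_mult fps_conv_power fps_conv_Psi fps_conv_fps_const vabs_nonneg)+
    have "fps_value (fps_const (B $ N) * \<Psi> ^ N) z = B $ N * psi z ^ N"
      by (simp add: fps_value_mult fps_conv_fps_const conv fps_value_fps_const fps_value_power fps_conv_Psi)
    also have "\<dots> = 0" using z(1) by (cases N) (auto simp: B_def \<beta>(1))
    finally have "fps_value (fps_const (B $ N) * \<Psi> ^ N) z = 0" .
    moreover have "E (Suc N) = E N - fps_const (B $ N) * \<Psi> ^ N" by (simp add: E_def diff_diff_eq)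
    ultimately show ?case using Suc.IH conv by (simp add: fps_conv_diff fps_value_diff)
  qed
  have Psi1: "gauss_le (real p) (real p) \<Psi>" using gauss_le_Psi[of 1] by (simp add: psum_def)
  have "gauss_le (vabs z) (real p / 2) (E N)"
    unfolding gauss_le_def z(2)
  proof
    fix n
    have pn: "0 < real p ^ n" using p_pos by simp
    have "(\<Sum>k<N. B $ k * (\<Psi> ^ k) $ n) = (\<Sum>k\<in>{..<N} \<inter> {0..n}. B $ k * (\<Psi> ^ k) $ n)"
    proof (intro sum.mono_neutral_right ballI)
      fix k assume "k \<in> {..<N} - {..<N} \<inter> {0..n}"
      then have "n < k" by auto
      then show "B $ k * (\<Psi> ^ k) $ n = 0" by (simp add: Psi_power_nth_eq_0)
    qed auto
    then have "E N $ n = (\<Sum>k=0..n. B $ k * (\<Psi> ^ k) $ n) - (\<Sum>k\<in>{..<N} \<inter> {0..n}. B $ k * (\<Psi> ^ k) $ n)"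
      by (simp add: E_def fps_sum_nth comp)
    also have "\<dots> = (\<Sum>k\<in>{0..n} - {..<N} \<inter> {0..n}. B $ k * (\<Psi> ^ k) $ n)"
      by (rule sum_diff[symmetric]) auto
    finally have En: "E N $ n = \<dots>" .
    have "vabs (E N $ n) \<le> real p / 2 / real p ^ n"
      unfolding En
    proof (rule vabs_sum_le)
      fix k assume "k \<in> {0..n} - {..<N} \<inter> {0..n}"
      then have k: "k \<ge> N" by auto
      have "vabs (B $ k) * (vabs ((\<Psi> ^ k) $ n) * real p ^ n) \<le> vabs (B $ k) * real p ^ k"
        by (intro mult_left_mono gauss_leD gauss_le_power Psi1) auto
      also have "\<dots> \<le> real p / 2" using N[OF k] by simp
      finally show "vabs (B $ k * (\<Psi> ^ k) $ n) \<le> real p / 2 / real p ^ n"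
        by (simp only: pos_le_divide_eq[OF pn] vabs_mult mult.assoc)
    qed simp
    then show "vabs (E N $ n) * real p ^ n \<le> real p / 2" by (simp only: pos_le_divide_eq[OF pn])
  qed
  from vabs_fps_value_le[OF _ this] have "vabs z \<le> real p / 2" using E by metis
  then show False using z p_pos by simp
qed

text \<open>The Gauss bound at radius p gives geometric decay on the open disc; convergence at a
  point with |x| >= p would imply convergence at radius p.\<close>

lemma fps_convergence_set_inverse_Psi:
  assumes inv: "is_compositional_inverse (Psi p) \<beta>"
  shows "fps_convergence_set (fps_of_int_coeffs \<beta> :: 'c fps) = {x. vp p x > -1}"
proof -
  define B where "B = (fps_of_int_coeffs \<beta> :: 'c fps)"
  have gB: "gauss_le (real p) (real p) B" unfolding B_def by (rule inverse_Psi_gauss_le[OF inv])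
  have nB: "\<not> fps_conv (real p) B" unfolding B_def by (rule inverse_Psi_not_conv[OF inv])
  have "fps_conv (vabs x) B \<longleftrightarrow> vabs x < real p" for x :: 'c
  proof
    assume "fps_conv (vabs x) B"
    then show "vabs x < real p" using fps_conv_mono[of "vabs x" B "real p"] nB by fastforce
  next
    assume x: "vabs x < real p"
    let ?q = "vabs x / real p"
    show "fps_conv (vabs x) B" unfolding fps_conv_def
    proof (rule Lim_null_comparison[OF always_eventually])
      show "(\<lambda>k. real p * ?q ^ k) \<longlonglongrightarrow> 0"
        using tendsto_mult[OF tendsto_const[of "real p"] LIMSEQ_power_zero[of ?q]] x p_pos by simp
      show "\<forall>k. norm (vabs (B $ k) * vabs x ^ k) \<le> real p * ?q ^ k"
      proof
        fix k
        have "vabs (B $ k) * vabs x ^ k = vabs (B $ k) * real p ^ k * ?q ^ k"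
          using p_pos by (simp add: power_divide)
        also have "\<dots> \<le> real p * ?q ^ k" by (intro mult_right_mono gauss_leD[OF gB]) auto
        finally show "norm (vabs (B $ k) * vabs x ^ k) \<le> real p * ?q ^ k" by simp
      qed
    qed
  qed
  then show ?thesis
    unfolding B_def[symmetric]
    by (intro set_eqI) (simp only: mem_fps_convergence_set_iff mem_Collect_eq vp_greater_iff)
qed

end

theorem theorem3p12:
  fixes p :: nat and \<Psi> :: "'c::complete_ultrametric_field fps" and d :: "nat \<Rightarrow> nat"
  assumes "prime p" and "is_Cp p TYPE('c)"
  defines "\<Psi> \<equiv> fps_of_int_coeffs (Psi p)"
    and "d \<equiv> \<lambda>n. p ^ n - p ^ (n - 1)"
  shows
    "(\<forall>n\<ge>1.
        card {z \<in> Qp. simple_zero \<Psi> z \<and> vp p z = - ereal (real n)} = d n \<and>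
        (\<forall>a. unit_representatives p n {1..d n} a \<longrightarrow>
           (\<exists>z. (\<forall>j\<in>{1..d n}.
                   z j \<in> Qp \<and>
                   {w \<in> ball (a j / of_nat p ^ n) (real p). fps_value \<Psi> w = 0} = {z j}) \<and>
                bij_betw z {1..d n} (zeros_of_valuation p \<Psi> (- ereal (real n))))))
     \<and>
     (\<forall>z. (\<forall>n\<ge>1. bij_betw (z n) {1..d n} (zeros_of_valuation p \<Psi> (- ereal (real n)))) \<longrightarrow>
        (let \<psi> = (\<lambda>n. \<Prod>j=1..d n. [:1, - (1 / z n j):]) in
           (\<forall>n\<ge>1. \<exists>q. (\<forall>i. coeff q i \<in> Zp) \<and>
              \<psi> n = 1 + smult (of_nat p ^ n) ([:0, 1:] * q)) \<and>
           infinite_schnirelmann_product p \<Psi> [:0, 1:] \<psi>))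
     \<and>
     (\<exists>!\<beta>. is_compositional_inverse (Psi p) \<beta>) \<and>
     (\<forall>\<beta>. is_compositional_inverse (Psi p) \<beta> \<longrightarrow>
        fps_nth \<beta> 0 = 0 \<and> fps_nth \<beta> 1 = 1 \<and>
        fps_convergence_set (fps_of_int_coeffs \<beta> :: 'c fps) = {x. vp p x > -1})"
proof -
  interpret F: padic_valued_field p "TYPE('c)"
    using assms(1,2) by unfold_locales (auto simp: is_Cp_def)
  have \<Psi>: "\<Psi> = F.\<Psi>" by (simp add: \<Psi>_def F.\<Psi>_def)
  have f: "Psi p $ 0 = 0" "Psi p $ 1 = 1" using is_Psi_Psi[OF F.p_ge_2] by (auto simp: is_Psi_def)
  have part1: "card {z \<in> Qp. simple_zero \<Psi> z \<and> vp p z = - ereal (real n)} = d n \<and>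
        (\<forall>a. unit_representatives p n {1..d n} a \<longrightarrow>
           (\<exists>z. (\<forall>j\<in>{1..d n}. z j \<in> Qp \<and>
                   {w \<in> ball (a j / of_nat p ^ n) (real p). fps_value \<Psi> w = 0} = {z j}) \<and>
                bij_betw z {1..d n} (zeros_of_valuation p \<Psi> (- ereal (real n)))))" if "n \<ge> 1" for n
    unfolding \<Psi> F.simple_zeros_of_valuation[OF that] F.zeros_of_valuation_Psi
    using F.card_psi_zeros[OF that] F.psi_zeros_in_discs[OF that] by (simp add: d_def)
  have part2: "let \<psi> = (\<lambda>n. \<Prod>j=1..d n. [:1, - (1 / z n j):]) in
           (\<forall>n\<ge>1. \<exists>q. (\<forall>i. coeff q i \<in> Zp) \<and>
              \<psi> n = 1 + smult (of_nat p ^ n) ([:0, 1:] * q)) \<and>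
           infinite_schnirelmann_product p \<Psi> [:0, 1:] \<psi>"
    if "\<forall>n\<ge>1. bij_betw (z n) {1..d n} (zeros_of_valuation p \<Psi> (- ereal (real n)))" for z
  proof -
    \<comment> \<open>The two factor functions are shown to agree at n = 0 too: truncated
      subtraction makes \<open>d 0 = 0\<close>, and \<Psi> has no zeros of absolute value 1.\<close>
    have "(\<Prod>j=1..d n. [:1, - (1 / z n j):]) = F.psi_poly n" for n
    proof (cases "n = 0")
      case True
      then show ?thesis by (simp add: d_def F.psi_poly_def F.psi_zeros_0)
    next
      case False
      then have "bij_betw (z n) {1..d n} (F.psi_zeros n)"
        using that unfolding \<Psi> F.zeros_of_valuation_Psi by simp
      then show ?thesis unfolding F.psi_poly_def by (rule prod.reindex_bij_betw)
    qed
    moreover have "\<exists>q. (\<forall>i. coeff q i \<in> Zp) \<and>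
        F.psi_poly n = 1 + smult (of_nat p ^ n) ([:0, 1:] * q)" if "n \<ge> 1" for n
      unfolding F.psi_poly_def
      using F.finite_psi_zeros[OF that] F.psi_zeros_subset_Qp[OF that]
      by (intro F.prod_linear_factors_integral) (auto simp: F.psi_zeros_def)
    ultimately show ?thesis
      using F.infinite_schnirelmann_product_Psi unfolding Let_def \<Psi> by presburger
  qed
  have part3: "fps_nth \<beta> 1 = 1" if "is_compositional_inverse (Psi p) \<beta>" for \<beta>
  proof -
    have "\<beta> $ 0 = 0" "Psi p oo \<beta> = fps_X" using that by (auto simp: is_compositional_inverse_def)
    then show ?thesis using fps_compose_eq_X_iff[OF f, of \<beta>] by simp
  qed
  show ?thesis
    using part1 part2 part3 compositional_inverse_ex1[OF f] F.fps_convergence_set_inverse_Psi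
    by (auto simp: is_compositional_inverse_def)
qed

end
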